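(* Let $d\ge 1$ be an integer, let $\ell>0$ and $\nu>0$, and put $\beta=\nu+d/2$. Let $\mathcal{W}$ be spatial Gaussian white noise with unit variance on $\mathbb{R}^d$. Then the solution $x(\boldsymbol{u})$ of the stochastic partial differential equation $$(1-\ell^{2}\Delta)^{\beta/2}x(\boldsymbol{u})=\mathcal{W}(\boldsymbol{u}),\qquad \boldsymbol{u}\in\mathbb{R}^d,$$ is a Gaussian field with mean zero and Mat\'ern covariance function with smoothness parameter $\nu$ and range parameter $\ell$; that is, for some marginal variance $\sigma^2>0$, for all $\boldsymbol{u},\boldsymbol{u}'\in\mathbb{R}^d$, $$\mathrm{Cov}(x(\boldsymbol{u}),x(\boldsymbol{u}'))=C(\Vert\boldsymbol{u}-\boldsymbol{u}'\Vert),\qquad C(r)=\sigma^2\,\frac{(r/\ell)^{\nu}K_{\nu}(r/\ell)}{2^{\nu-1}\Gamma(\nu)},$$ where the value of $C$ at $r=0$ is understood as the limit $\sigma^2$.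
   Context: $\Delta=\sum_{i=1}^d \partial^2/\partial u_i^2$ is the Laplacian on $\mathbb{R}^d$, $\Vert\cdot\Vert$ is the Euclidean norm, $\Gamma$ is the gamma function, and $K_\nu$ is the modified Bessel function of the second kind of order $\nu$. Gaussian field: a real stochastic process $\{x(\boldsymbol{u}):\boldsymbol{u}\in\mathbb{R}^d\}$ such that for every $k\ge 1$ and all $\boldsymbol{u}_1,\dots,\boldsymbol{u}_k$ the vector $[x(\boldsymbol{u}_1),\dots,x(\boldsymbol{u}_k)]^T$ is normally distributed. Its covariance function is $(\boldsymbol{u},\boldsymbol{u}')\mapsto\mathrm{Cov}(x(\boldsymbol{u}),x(\boldsymbol{u}'))$. White noise: for an orthonormal basis $\{\phi_j\}_{j\ge1}$ of $L^2(\mathbb{R}^d)$ (real-valued functions), spatial Gaussian white noise with unit variance is the formal series $\mathcal{W}(\boldsymbol{u})=\sum_{j=1}^\infty \xi_j\phi_j(\boldsymbol{u})$ with $\xi_j$ i.i.d. $\mathcal{N}(0,1)$. For $f\in L^2(\mathbb{R}^d)$, $\int_{\mathbb{R}^d} f(\boldsymbol{v})\mathcal{W}(\boldsymbol{v})\,d\boldsymbol{v}$ denotes the series $\sum_j \xi_j\int_{\mathbb{R}^d} f\phi_j\,d\boldsymbol{v}$ (convergent in mean square). The operator $(1-\ell^2\Delta)^{\beta/2}$ is the Fourier multiplier with symbol $(1+\ell^2\Vert\boldsymbol{\omega}\Vert^2)^{\beta/2}$ on tempered distributions. The solution of the equation is the field defined through the Green's function: $$x(\boldsymbol{u})=\int_{\mathbb{R}^d}g(\boldsymbol{u},\boldsymbol{v})\mathcal{W}(\boldsymbol{v})\,d\boldsymbol{v},$$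 where $g(\boldsymbol{u},\boldsymbol{v})=g(\boldsymbol{u}-\boldsymbol{v})$ is the Green's function of the operator, i.e. the tempered distribution satisfying $(1-\ell^2\Delta)^{\beta/2}g=\delta_f$, with $\delta_f$ the Dirac delta at the origin. *)

theory Defs
  imports "HOL-Probability.Probability"
begin

section \<open>Schwartz functions and tempered distributions\<close>

text \<open>Iterated partial derivatives; the multi-index is the list of the coordinate directions
  (elements of \<^term>\<open>Basis\<close>).\<close>

primrec iter_partial :: "'a list \<Rightarrow> ('a::euclidean_space \<Rightarrow> complex) \<Rightarrow> 'a \<Rightarrow> complex" where
  "iter_partial [] f = f"
| "iter_partial (b # bs) f = (\<lambda>x. frechet_derivative (iter_partial bs f) (at x) b)"

definition schwartz :: "('a::euclidean_space \<Rightarrow> complex) \<Rightarrow> bool" where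
  "schwartz f \<longleftrightarrow> (\<forall>bs \<in> lists Basis.
     (\<forall>x. iter_partial bs f differentiable (at x)) \<and>
     (\<forall>k::nat. bdd_above (range (\<lambda>x. norm x ^ k * norm (iter_partial bs f x)))))"

definition schwartz_seminorm :: "nat \<Rightarrow> ('a::euclidean_space \<Rightarrow> complex) \<Rightarrow> real" where
  "schwartz_seminorm N f =
     (\<Sum>k\<le>N. \<Sum>bs | bs \<in> lists Basis \<and> length bs \<le> N.
        SUP x. norm x ^ k * norm (iter_partial bs f x))"

text \<open>A distribution is a functional whose values matter on Schwartz functions only; it is
  unconstrained elsewhere.\<close>

type_synonym 'a distribution = "('a \<Rightarrow> complex) \<Rightarrow> complex"

definition tempered_distribution :: "'a::euclidean_space distribution \<Rightarrow> bool" where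
  "tempered_distribution T \<longleftrightarrow>
     (\<forall>f h. schwartz f \<longrightarrow> schwartz h \<longrightarrow> T (\<lambda>x. f x + h x) = T f + T h) \<and>
     (\<forall>c f. schwartz f \<longrightarrow> T (\<lambda>x. c * f x) = c * T f) \<and>
     (\<exists>N C. \<forall>f. schwartz f \<longrightarrow> norm (T f) \<le> C * schwartz_seminorm N f)"

definition dirac_delta :: "'a::euclidean_space distribution" where
  "dirac_delta f = f 0"

definition represents :: "('a::euclidean_space \<Rightarrow> real) \<Rightarrow> 'a distribution \<Rightarrow> bool" where
  "represents g T \<longleftrightarrow> (\<forall>f. schwartz f \<longrightarrow>
     integrable lborel (\<lambda>v. complex_of_real (g v) * f v) \<and>
     T f = (LINT v|lborel. complex_of_real (g v) * f v))"

section \<open>Fourier multipliers\<close>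

text \<open>The Fourier transform is taken in angular frequency, so that the negative Laplacian has the
  symbol \<open>\<omega> \<mapsto> (norm \<omega>)\<^sup>2\<close>.\<close>

definition fourier :: "('a::euclidean_space \<Rightarrow> complex) \<Rightarrow> 'a \<Rightarrow> complex" where
  "fourier f \<omega> = (LINT x|lborel. exp (- \<i> * complex_of_real (x \<bullet> \<omega>)) * f x)"

definition inv_fourier :: "('a::euclidean_space \<Rightarrow> complex) \<Rightarrow> 'a \<Rightarrow> complex" where
  "inv_fourier f x =
     (LINT \<omega>|lborel. exp (\<i> * complex_of_real (x \<bullet> \<omega>)) * f \<omega>) / complex_of_real ((2 * pi) ^ DIM('a))"

definition fourier_dist :: "'a::euclidean_space distribution \<Rightarrow> 'a distribution" where
  "fourier_dist T f = T (fourier f)"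

definition inv_fourier_dist :: "'a::euclidean_space distribution \<Rightarrow> 'a distribution" where
  "inv_fourier_dist T f = T (inv_fourier f)"

definition mult_dist :: "('a::euclidean_space \<Rightarrow> complex) \<Rightarrow> 'a distribution \<Rightarrow> 'a distribution" where
  "mult_dist m T f = T (\<lambda>x. m x * f x)"

definition fourier_multiplier ::
    "('a::euclidean_space \<Rightarrow> complex) \<Rightarrow> 'a distribution \<Rightarrow> 'a distribution" where
  "fourier_multiplier m T = inv_fourier_dist (mult_dist m (fourier_dist T))"

definition whittle_matern_op ::
    "real \<Rightarrow> real \<Rightarrow> 'a::euclidean_space distribution \<Rightarrow> 'a distribution" where
  "whittle_matern_op l \<beta> =
     fourier_multiplier (\<lambda>\<omega>. complex_of_real ((1 + l\<^sup>2 * (norm \<omega>)\<^sup>2) powr (\<beta> / 2)))"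

definition greens_function :: "real \<Rightarrow> real \<Rightarrow> 'a::euclidean_space distribution \<Rightarrow> bool" where
  "greens_function l \<beta> G \<longleftrightarrow> tempered_distribution G \<and>
     (\<forall>f. schwartz f \<longrightarrow> whittle_matern_op l \<beta> G f = dirac_delta f)"

section \<open>White noise\<close>

definition square_integrable :: "'b measure \<Rightarrow> ('b \<Rightarrow> real) \<Rightarrow> bool" where
  "square_integrable N f \<longleftrightarrow> f \<in> borel_measurable N \<and> integrable N (\<lambda>x. (f x)\<^sup>2)"

definition tendsto_L2 :: "'b measure \<Rightarrow> (nat \<Rightarrow> 'b \<Rightarrow> real) \<Rightarrow> ('b \<Rightarrow> real) \<Rightarrow> bool" where
  "tendsto_L2 N F f \<longleftrightarrow>
     (\<forall>n. square_integrable N (F n)) \<and> square_integrable N f \<and>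
     (\<lambda>n. LINT x|N. (F n x - f x)\<^sup>2) \<longlonglongrightarrow> 0"

definition orthonormal_basis_L2 :: "(nat \<Rightarrow> 'a::euclidean_space \<Rightarrow> real) \<Rightarrow> bool" where
  "orthonormal_basis_L2 \<phi> \<longleftrightarrow>
     (\<forall>j. square_integrable lborel (\<phi> j)) \<and>
     (\<forall>i j. (LINT v|lborel. \<phi> i v * \<phi> j v) = (if i = j then 1 else 0)) \<and>
     (\<forall>f. square_integrable lborel f \<longrightarrow>
        tendsto_L2 lborel (\<lambda>n v. \<Sum>j<n. (LINT w|lborel. f w * \<phi> j w) * \<phi> j v) f)"

text \<open>The formal series \<open>\<Sum>j. \<xi> j * \<phi> j\<close> is given by its coefficients and its basis.\<close>

definition white_noise ::
    "'w measure \<Rightarrow> (nat \<Rightarrow> 'a::euclidean_space \<Rightarrow> real) \<Rightarrow> (nat \<Rightarrow> 'w \<Rightarrow> real) \<Rightarrow> bool" where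
  "white_noise M \<phi> \<xi> \<longleftrightarrow>
     prob_space M \<and> orthonormal_basis_L2 \<phi> \<and>
     prob_space.indep_vars M (\<lambda>_. borel) \<xi> UNIV \<and>
     (\<forall>j. distributed M lborel (\<xi> j) std_normal_density)"

text \<open>\<open>X\<close> is a version of the integral of \<open>f\<close> against the white noise.\<close>

definition white_noise_integral ::
    "'w measure \<Rightarrow> (nat \<Rightarrow> 'a::euclidean_space \<Rightarrow> real) \<Rightarrow> (nat \<Rightarrow> 'w \<Rightarrow> real) \<Rightarrow>
     ('a \<Rightarrow> real) \<Rightarrow> ('w \<Rightarrow> real) \<Rightarrow> bool" where
  "white_noise_integral M \<phi> \<xi> f X \<longleftrightarrow> square_integrable lborel f \<and>
     tendsto_L2 M (\<lambda>n w. \<Sum>j<n. \<xi> j w * (LINT v|lborel. f v * \<phi> j v)) X"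

definition spde_solution ::
    "'w measure \<Rightarrow> (nat \<Rightarrow> 'a::euclidean_space \<Rightarrow> real) \<Rightarrow> (nat \<Rightarrow> 'w \<Rightarrow> real) \<Rightarrow>
     real \<Rightarrow> real \<Rightarrow> ('a \<Rightarrow> 'w \<Rightarrow> real) \<Rightarrow> bool" where
  "spde_solution M \<phi> \<xi> l \<beta> x \<longleftrightarrow>
     (\<exists>G g. greens_function l \<beta> G \<and> represents g G \<and>
        (\<forall>u. white_noise_integral M \<phi> \<xi> (\<lambda>v. g (u - v)) (x u)))"

section \<open>Gaussian fields\<close>

text \<open>Constants count as normal variables: a Gaussian vector may have a singular covariance
  matrix, for instance when sampling points coincide.\<close>

definition normal_variable :: "'w measure \<Rightarrow> ('w \<Rightarrow> real) \<Rightarrow> bool" where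
  "normal_variable M X \<longleftrightarrow> X \<in> borel_measurable M \<and>
     (\<exists>\<mu> \<sigma>. (\<sigma> > 0 \<and> distributed M lborel X (normal_density \<mu> \<sigma>)) \<or> (AE w in M. X w = \<mu>))"

definition normal_vector :: "'w measure \<Rightarrow> nat \<Rightarrow> (nat \<Rightarrow> 'w \<Rightarrow> real) \<Rightarrow> bool" where
  "normal_vector M k X \<longleftrightarrow> (\<forall>i<k. X i \<in> borel_measurable M) \<and>
     (\<forall>c :: nat \<Rightarrow> real. normal_variable M (\<lambda>w. \<Sum>i<k. c i * X i w))"

definition gaussian_field :: "'w measure \<Rightarrow> ('a::euclidean_space \<Rightarrow> 'w \<Rightarrow> real) \<Rightarrow> bool" where
  "gaussian_field M x \<longleftrightarrow> prob_space M \<and>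
     (\<forall>k\<ge>1. \<forall>u :: nat \<Rightarrow> 'a. normal_vector M k (\<lambda>i. x (u i)))"

definition covariance :: "'w measure \<Rightarrow> ('w \<Rightarrow> real) \<Rightarrow> ('w \<Rightarrow> real) \<Rightarrow> real" where
  "covariance M X Y =
     (LINT w|M. (X w - (LINT w'|M. X w')) * (Y w - (LINT w'|M. Y w')))"

section \<open>Bessel functions and the Mat\'ern covariance function\<close>

text \<open>Modified Bessel functions of real order at positive real arguments. The function
  \<^const>\<open>rGamma\<close> is the reciprocal Gamma function, which is zero at the poles.\<close>

definition bessel_I :: "real \<Rightarrow> real \<Rightarrow> real" where
  "bessel_I \<nu> z =
     (\<Sum>k. (z / 2) powr (2 * real k + \<nu>) * rGamma (real k + \<nu> + 1) / fact k)"

definition bessel_K :: "real \<Rightarrow> real \<Rightarrow> real" where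
  "bessel_K \<nu> z =
     (let K = (\<lambda>\<mu>. pi / 2 * (bessel_I (- \<mu>) z - bessel_I \<mu> z) / sin (\<mu> * pi))
      in if \<nu> \<in> \<int> then Lim (at \<nu>) K else K \<nu>)"

definition matern_cov :: "real \<Rightarrow> real \<Rightarrow> real \<Rightarrow> real \<Rightarrow> real" where
  "matern_cov \<sigma>2 \<nu> l r =
     (if r = 0 then \<sigma>2
      else \<sigma>2 * ((r / l) powr \<nu> * bessel_K \<nu> (r / l)) / (2 powr (\<nu> - 1) * Gamma \<nu>))"

end

theory Submission
  imports Defs
begin

text \<open>
  Write \<open>d\<close> for the dimension and \<open>K\<^sub>s\<close> for the heat kernel, the Gaussian density of covariance
  \<open>s\<close> times the identity. For \<open>T\<close> of Gamma law with shape \<open>\<beta>/2\<close>, the Laplace transform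
  \<open>(1 + l\<^sup>2 |\<omega>|\<^sup>2) powr (- \<beta>/2) = E (exp (- T l\<^sup>2 |\<omega>|\<^sup>2))\<close> shows that the reciprocal symbol of
  the operator is a mixture of Gaussians, and each Gaussian is the Fourier transform of a heat
  kernel. Hence the only candidate for the Green's function is the density
  \<open>g\<^sub>0 = E (K\<^bsub>2 l\<^sup>2 T\<^esub>)\<close>, here called \<open>potential_kernel\<close>; it is the Bessel potential kernel.

  Existence. That \<open>g\<^sub>0\<close> is a Green's function (\<open>potential_kernel_greens_function\<close>) comes down to
  Fourier inversion at the origin for a Schwartz function (\<open>schwartz_inversion_at_0\<close>). The latter
  needs a transform that decays faster than any power, which is integration by parts
  (\<open>osc_integral_partial\<close>).

  Autocovariance. Heat kernels form a convolution semigroup and the Gamma laws do as well, so the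
  autocorrelation of \<open>g\<^sub>0\<close> is the expectation of \<open>K\<^bsub>2 l\<^sup>2 R\<^esub>\<close> for \<open>R\<close> of Gamma law with shape \<open>\<beta>\<close>.
  Because \<open>\<beta> = \<nu> + d/2\<close>, the factor \<open>R powr (- d/2)\<close> of the kernel lowers the shape to \<open>\<nu>\<close>, and
  what remains is the integral of \<open>r powr (\<nu> - 1) * exp (- r - x / r)\<close> with
  \<open>x = (|u - u'| / l)\<^sup>2 / 4\<close>. Up to a constant and a power of \<open>x\<close> this is the Bessel function
  \<open>K\<^sub>\<nu>\<close> at \<open>|u - u'| / l\<close> (\<open>bessel_K_eq_integral\<close>, \<open>potential_kernel_autocovariance\<close>).
  At coinciding points it is finite because \<open>\<nu> > 0\<close>, so \<open>g\<^sub>0\<close> is square integrable.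

  Uniqueness. A solution may use any function \<open>g\<close> that represents a Green's function, but \<open>g\<close> is
  square integrable because it is integrated against white noise. For a Gaussian test function the
  equation of the Green's function can be solved explicitly: the required argument of the operator
  is again a mixture of heat kernels, now with scales bounded away from zero, and therefore a
  Schwartz function (\<open>schwartz_heat_mix\<close>). Thus all heat averages of \<open>g\<close> are determined
  (\<open>greens_function_heat_average\<close>). Heat kernels are complete in the space of square integrable
  functions (\<open>heat_kernel_complete\<close>), so \<open>g = g\<^sub>0\<close> almost everywhere.

  Probability. By Parseval's identity the white noise integral is an isometry, so the covariance of
  the field is the autocorrelation of \<open>g\<^sub>0\<close>. Mean square limits of Gaussian sums are Gaussian
  because characteristic functions converge. The integrals exist by completeness of the space of
  square integrable random variables.
\<close>

section \<open>Square-integrable functions\<close>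

lemma square_integrableI:
  assumes "f \<in> borel_measurable N" "integrable N (\<lambda>x. (f x)\<^sup>2)" shows "square_integrable N f"
  using assms by (simp add: square_integrable_def)

lemma square_integrable_measurable: "square_integrable N f \<Longrightarrow> f \<in> borel_measurable N"
  and square_integrable_square: "square_integrable N f \<Longrightarrow> integrable N (\<lambda>x. (f x)\<^sup>2)"
  by (simp_all add: square_integrable_def)

lemma square_integrable_mult:
  assumes f: "square_integrable N f" and h: "square_integrable N h"
  shows "integrable N (\<lambda>x. f x * h x)"
proof (rule Bochner_Integration.integrable_bound)
  note [measurable] = square_integrable_measurable[OF f] square_integrable_measurable[OF h]
  show "integrable N (\<lambda>x. (f x)\<^sup>2 + (h x)\<^sup>2)" using f h by (simp add: square_integrable_square)
  show "AE x in N. norm (f x * h x) \<le> norm ((f x)\<^sup>2 + (h x)\<^sup>2)"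
  proof (rule AE_I2)
    fix x
    have "2 * \<bar>f x\<bar> * \<bar>h x\<bar> \<le> \<bar>f x\<bar>\<^sup>2 + \<bar>h x\<bar>\<^sup>2" by (rule sum_squares_bound)
    moreover have "0 \<le> \<bar>f x\<bar> * \<bar>h x\<bar>" by simp
    ultimately have "\<bar>f x\<bar> * \<bar>h x\<bar> \<le> (f x)\<^sup>2 + (h x)\<^sup>2" unfolding power2_abs by linarith
    then show "norm (f x * h x) \<le> norm ((f x)\<^sup>2 + (h x)\<^sup>2)" by (simp add: abs_mult)
  qed
  show "(\<lambda>x. f x * h x) \<in> borel_measurable N" by measurable
qed

lemma square_integrable_add:
  assumes f: "square_integrable N f" and h: "square_integrable N h"
  shows "square_integrable N (\<lambda>x. f x + h x)"
proof (rule square_integrableI)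
  note [measurable] = square_integrable_measurable[OF f] square_integrable_measurable[OF h]
  show "(\<lambda>x. f x + h x) \<in> borel_measurable N" by measurable
  have "integrable N (\<lambda>x. (f x)\<^sup>2 + (h x)\<^sup>2 + 2 * (f x * h x))"
    using square_integrable_square[OF f] square_integrable_square[OF h] square_integrable_mult[OF f h] by auto
  then show "integrable N (\<lambda>x. (f x + h x)\<^sup>2)" by (simp add: power2_sum mult.assoc)
qed

lemma square_integrable_cmult:
  assumes f: "square_integrable N f" shows "square_integrable N (\<lambda>x. c * f x)"
  using f by (auto simp: square_integrable_def power_mult_distrib)

lemma square_integrable_diff:
  assumes f: "square_integrable N f" and h: "square_integrable N h"
  shows "square_integrable N (\<lambda>x. f x - h x)"
  using square_integrable_add[OF f square_integrable_cmult[OF h, of "-1"]] by simp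

lemma square_integrable_zero: "square_integrable N (\<lambda>x. 0)"
  by (simp add: square_integrable_def)

lemma square_integrable_sum:
  assumes "\<And>i. i \<in> I \<Longrightarrow> square_integrable N (f i)"
  shows "square_integrable N (\<lambda>x. \<Sum>i\<in>I. f i x)"
  using assms by (induction I rule: infinite_finite_induct) (auto intro: square_integrable_add square_integrable_zero)

lemma L2_cauchy_schwarz:
  assumes f: "square_integrable N f" and h: "square_integrable N h"
  shows "(LINT x|N. \<bar>f x * h x\<bar>) \<le> sqrt (LINT x|N. (f x)\<^sup>2) * sqrt (LINT x|N. (h x)\<^sup>2)"
proof -
  note [measurable] = square_integrable_measurable[OF f] square_integrable_measurable[OF h]
  let ?a = "LINT x|N. (f x)\<^sup>2" and ?b = "LINT x|N. (h x)\<^sup>2" and ?c = "LINT x|N. \<bar>f x * h x\<bar>"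
  have c: "?c \<ge> 0" by simp
  have "(\<integral>\<^sup>+ x. ennreal \<bar>f x\<bar> * ennreal \<bar>h x\<bar> \<partial>N)\<^sup>2 \<le> (\<integral>\<^sup>+ x. (ennreal \<bar>f x\<bar>)\<^sup>2 \<partial>N) * (\<integral>\<^sup>+ x. (ennreal \<bar>h x\<bar>)\<^sup>2 \<partial>N)"
    by (rule Cauchy_Schwarz_nn_integral) measurable
  moreover have "(\<integral>\<^sup>+ x. ennreal \<bar>f x\<bar> * ennreal \<bar>h x\<bar> \<partial>N) = ennreal ?c"
    using integrable_abs[OF square_integrable_mult[OF f h]]
    by (subst nn_integral_eq_integral [symmetric]) (auto simp: ennreal_mult' [symmetric] abs_mult)
  moreover have "(\<integral>\<^sup>+ x. (ennreal \<bar>f x\<bar>)\<^sup>2 \<partial>N) = ennreal ?a"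
    using square_integrable_square[OF f] by (subst nn_integral_eq_integral [symmetric]) (auto simp: ennreal_power)
  moreover have "(\<integral>\<^sup>+ x. (ennreal \<bar>h x\<bar>)\<^sup>2 \<partial>N) = ennreal ?b"
    using square_integrable_square[OF h] by (subst nn_integral_eq_integral [symmetric]) (auto simp: ennreal_power)
  ultimately have "ennreal (?c\<^sup>2) \<le> ennreal (?a * ?b)"
    using c by (simp add: ennreal_power ennreal_mult')
  then have "?c\<^sup>2 \<le> ?a * ?b" by (simp add: ennreal_le_iff)
  then have "sqrt (?c\<^sup>2) \<le> sqrt (?a * ?b)" by (rule real_sqrt_le_mono)
  then show ?thesis using c by (simp add: real_sqrt_mult)
qed

lemma tendsto_L2_const: "square_integrable N f \<Longrightarrow> tendsto_L2 N (\<lambda>n. f) f"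
  by (simp add: tendsto_L2_def)

text \<open>Bilinearity splits the difference into three terms, each controlled by the Cauchy--Schwarz
  inequality. With a constant second factor this gives convergence of expectations.\<close>

lemma tendsto_L2_inner:
  assumes F: "tendsto_L2 N F f" and H: "tendsto_L2 N H h"
  shows "(\<lambda>n. LINT x|N. F n x * H n x) \<longlonglongrightarrow> (LINT x|N. f x * h x)"
proof -
  have sq: "square_integrable N (F n)" "square_integrable N (H n)" "square_integrable N f" "square_integrable N h" for n
    using F H by (auto simp: tendsto_L2_def)
  define a where "a n = (LINT x|N. (F n x - f x)\<^sup>2)" for n
  define b where "b n = (LINT x|N. (H n x - h x)\<^sup>2)" for n
  define A where "A = sqrt (LINT x|N. (f x)\<^sup>2)"
  define B where "B = sqrt (LINT x|N. (h x)\<^sup>2)"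
  have ab: "a \<longlonglongrightarrow> 0" "b \<longlonglongrightarrow> 0"
    using F H unfolding a_def b_def tendsto_L2_def by auto
  have dF: "square_integrable N (\<lambda>x. F n x - f x)" and dH: "square_integrable N (\<lambda>x. H n x - h x)" for n
    by (auto intro: square_integrable_diff sq)
  have cs: "\<bar>LINT x|N. p x * q x\<bar> \<le> sqrt (LINT x|N. (p x)\<^sup>2) * sqrt (LINT x|N. (q x)\<^sup>2)"
    if "square_integrable N p" "square_integrable N q" for p q
    using L2_cauchy_schwarz[OF that] integral_abs_bound[of N "\<lambda>x. p x * q x"] by linarith
  have "(\<lambda>n. (LINT x|N. F n x * H n x) - (LINT x|N. f x * h x)) \<longlonglongrightarrow> 0"
  proof (rule Lim_null_comparison)
    show "\<forall>\<^sub>F n in sequentially. norm ((LINT x|N. F n x * H n x) - (LINT x|N. f x * h x))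
       \<le> sqrt (a n) * sqrt (b n) + sqrt (a n) * B + A * sqrt (b n)"
    proof (rule always_eventually, rule allI)
      fix n
      have "(LINT x|N. F n x * H n x) - (LINT x|N. f x * h x) = (LINT x|N. F n x * H n x - f x * h x)"
        by (subst Bochner_Integration.integral_diff) (auto intro: square_integrable_mult sq)
      also have "\<dots> = (LINT x|N. (F n x - f x) * (H n x - h x) + (F n x - f x) * h x + f x * (H n x - h x))"
        by (intro Bochner_Integration.integral_cong) (auto simp: algebra_simps)
      also have "\<dots> = (LINT x|N. (F n x - f x) * (H n x - h x)) + (LINT x|N. (F n x - f x) * h x) + (LINT x|N. f x * (H n x - h x))"
        using square_integrable_mult[OF dF dH] square_integrable_mult[OF dF sq(4)] square_integrable_mult[OF sq(3) dH]
        by simp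
      finally have "(LINT x|N. F n x * H n x) - (LINT x|N. f x * h x)
        = (LINT x|N. (F n x - f x) * (H n x - h x)) + (LINT x|N. (F n x - f x) * h x) + (LINT x|N. f x * (H n x - h x))" .
      then show "norm ((LINT x|N. F n x * H n x) - (LINT x|N. f x * h x))
         \<le> sqrt (a n) * sqrt (b n) + sqrt (a n) * B + A * sqrt (b n)"
        using cs[OF dF dH, of n n] cs[OF dF sq(4), of n] cs[OF sq(3) dH, of n]
        unfolding a_def b_def A_def B_def real_norm_def by linarith
    qed
    have "(\<lambda>n. sqrt (a n) * sqrt (b n) + sqrt (a n) * B + A * sqrt (b n)) \<longlonglongrightarrow> sqrt 0 * sqrt 0 + sqrt 0 * B + A * sqrt 0"
      by (intro tendsto_intros ab)
    then show "(\<lambda>n. sqrt (a n) * sqrt (b n) + sqrt (a n) * B + A * sqrt (b n)) \<longlonglongrightarrow> 0" by simp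
  qed
  then show ?thesis by (simp add: LIM_zero_iff)
qed

lemma tendsto_L2_add:
  assumes F: "tendsto_L2 N F f" and H: "tendsto_L2 N H h"
  shows "tendsto_L2 N (\<lambda>n x. F n x + H n x) (\<lambda>x. f x + h x)"
proof -
  have sq: "square_integrable N (F n)" "square_integrable N (H n)" "square_integrable N f" "square_integrable N h" for n
    using F H by (auto simp: tendsto_L2_def)
  have dF: "square_integrable N (\<lambda>x. F n x - f x)" and dH: "square_integrable N (\<lambda>x. H n x - h x)" for n
    by (auto intro: square_integrable_diff sq)
  have s: "square_integrable N (\<lambda>x. F n x + H n x - (f x + h x))" for n
    by (intro square_integrable_diff square_integrable_add sq)
  have "(\<lambda>n. LINT x|N. (F n x + H n x - (f x + h x))\<^sup>2) \<longlonglongrightarrow> 0"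
  proof (rule tendsto_sandwich)
    show "\<forall>\<^sub>F n in sequentially. 0 \<le> (LINT x|N. (F n x + H n x - (f x + h x))\<^sup>2)" by simp
    show "\<forall>\<^sub>F n in sequentially. (LINT x|N. (F n x + H n x - (f x + h x))\<^sup>2)
      \<le> 2 * (LINT x|N. (F n x - f x)\<^sup>2) + 2 * (LINT x|N. (H n x - h x)\<^sup>2)"
    proof (rule always_eventually, rule allI)
      fix n
      have "(LINT x|N. (F n x + H n x - (f x + h x))\<^sup>2) \<le> (LINT x|N. 2 * (F n x - f x)\<^sup>2 + 2 * (H n x - h x)\<^sup>2)"
      proof (rule integral_mono)
        show "integrable N (\<lambda>x. 2 * (F n x - f x)\<^sup>2 + 2 * (H n x - h x)\<^sup>2)"
          using square_integrable_square[OF dF, of n] square_integrable_square[OF dH, of n] by simp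
        fix x
        have "(p + q)\<^sup>2 \<le> 2 * p\<^sup>2 + 2 * q\<^sup>2" for p q :: real
          using sum_squares_bound[of p q] by (simp add: power2_sum)
        from this[of "F n x - f x" "H n x - h x"]
        show "(F n x + H n x - (f x + h x))\<^sup>2 \<le> 2 * (F n x - f x)\<^sup>2 + 2 * (H n x - h x)\<^sup>2"
          by (simp add: algebra_simps)
      qed (rule square_integrable_square[OF s])
      also have "\<dots> = 2 * (LINT x|N. (F n x - f x)\<^sup>2) + 2 * (LINT x|N. (H n x - h x)\<^sup>2)"
        using square_integrable_square[OF dF, of n] square_integrable_square[OF dH, of n] by simp
      finally show "(LINT x|N. (F n x + H n x - (f x + h x))\<^sup>2)
        \<le> 2 * (LINT x|N. (F n x - f x)\<^sup>2) + 2 * (LINT x|N. (H n x - h x)\<^sup>2)" .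
    qed
    have "(\<lambda>n. 2 * (LINT x|N. (F n x - f x)\<^sup>2) + 2 * (LINT x|N. (H n x - h x)\<^sup>2)) \<longlonglongrightarrow> 2 * 0 + 2 * 0"
      using F H unfolding tendsto_L2_def by (intro tendsto_intros) auto
    then show "(\<lambda>n. 2 * (LINT x|N. (F n x - f x)\<^sup>2) + 2 * (LINT x|N. (H n x - h x)\<^sup>2)) \<longlonglongrightarrow> 0" by simp
  qed simp
  then show ?thesis unfolding tendsto_L2_def by (auto intro: square_integrable_add sq)
qed

lemma tendsto_L2_cmult:
  assumes F: "tendsto_L2 N F f"
  shows "tendsto_L2 N (\<lambda>n x. c * F n x) (\<lambda>x. c * f x)"
proof -
  have "(\<lambda>n. c\<^sup>2 * (LINT x|N. (F n x - f x)\<^sup>2)) \<longlonglongrightarrow> c\<^sup>2 * 0"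
    using F unfolding tendsto_L2_def by (intro tendsto_intros) auto
  moreover have "c\<^sup>2 * (LINT x|N. (F n x - f x)\<^sup>2) = (LINT x|N. (c * F n x - c * f x)\<^sup>2)" for n
    by (simp add: power_mult_distrib right_diff_distrib [symmetric])
  ultimately show ?thesis using F unfolding tendsto_L2_def by (auto intro: square_integrable_cmult)
qed

lemma tendsto_L2_sum:
  assumes "\<And>i. i \<in> I \<Longrightarrow> tendsto_L2 N (F i) (f i)"
  shows "tendsto_L2 N (\<lambda>n x. \<Sum>i\<in>I. F i n x) (\<lambda>x. \<Sum>i\<in>I. f i x)"
  using assms
proof (induction I rule: infinite_finite_induct)
  case (insert i I)
  then show ?case by (simp add: tendsto_L2_add)
qed (auto intro: tendsto_L2_const square_integrable_zero)

text \<open>A subsequence whose consecutive distances are at most \<open>2\<^bsup>-k\<^esup>\<close> converges almost surely, since its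
  increments are absolutely summable in expectation. Fatou's lemma turns the almost sure limit into a
  mean square limit of the whole sequence.\<close>

lemma (in prob_space) L2_complete:
  fixes F :: "nat \<Rightarrow> 'a \<Rightarrow> real"
  assumes F: "\<And>n. square_integrable M (F n)"
    and cauchy: "\<And>e. e > 0 \<Longrightarrow> \<exists>N. \<forall>m\<ge>N. \<forall>n\<ge>N. (LINT x|M. (F m x - F n x)\<^sup>2) < e"
  shows "\<exists>f. tendsto_L2 M F f"
proof -
  note [measurable] = square_integrable_measurable[OF F]
  have dF: "square_integrable M (\<lambda>x. F m x - F n x)" for m n
    by (intro square_integrable_diff F)
  have one: "square_integrable M (\<lambda>x. 1)" by (simp add: square_integrable_def)
  obtain N where N: "\<And>e m n. e > 0 \<Longrightarrow> m \<ge> N e \<Longrightarrow> n \<ge> N e \<Longrightarrow> (LINT x|M. (F m x - F n x)\<^sup>2) < e"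
    using cauchy by metis
  \<comment> \<open>Summing the thresholds makes the indices monotone; the summand \<open>k\<close> makes them unbounded.\<close>
  define r where "r k = k + (\<Sum>i\<le>k. N ((1 / 4) ^ i))" for k
  have rN: "r k \<ge> N ((1 / 4) ^ k)" for k
  proof -
    have "N ((1 / 4) ^ k) \<le> (\<Sum>i\<le>k. N ((1 / 4) ^ i))" by (intro member_le_sum) auto
    then show ?thesis by (simp add: r_def)
  qed
  have r_Suc: "r k \<le> r (Suc k)" for k by (simp add: r_def)
  have rk: "r k \<ge> k" for k by (simp add: r_def)
  define d where "d k x = \<bar>F (r (Suc k)) x - F (r k) x\<bar>" for k x
  have [measurable]: "d k \<in> borel_measurable M" for k unfolding d_def[abs_def] by measurable
  have d1: "(\<integral>\<^sup>+ x. ennreal (d k x) \<partial>M) \<le> ennreal ((1 / 2) ^ k)" for k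
  proof -
    have i: "integrable M (\<lambda>x. d k x)"
      unfolding d_def using square_integrable_mult[OF dF one] by simp
    have "(LINT x|M. d k x) \<le> sqrt (LINT x|M. (F (r (Suc k)) x - F (r k) x)\<^sup>2) * sqrt (LINT x|M. (1::real)\<^sup>2)"
      unfolding d_def using L2_cauchy_schwarz[OF dF one, of "r (Suc k)" "r k"] by simp
    also have "\<dots> = sqrt (LINT x|M. (F (r (Suc k)) x - F (r k) x)\<^sup>2)" by (simp add: prob_space)
    also have "\<dots> \<le> sqrt ((1 / 4) ^ k)"
    proof -
      have "(LINT x|M. (F (r (Suc k)) x - F (r k) x)\<^sup>2) < (1 / 4) ^ k"
        by (rule N) (use rN[of k] r_Suc[of k] in auto)
      then show ?thesis by (intro real_sqrt_le_mono less_imp_le)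
    qed
    also have "\<dots> = (1 / 2) ^ k" by (simp add: real_sqrt_power real_sqrt_divide)
    finally have "(LINT x|M. d k x) \<le> (1 / 2) ^ k" .
    moreover have "(\<integral>\<^sup>+ x. ennreal (d k x) \<partial>M) = ennreal (LINT x|M. d k x)"
      by (rule nn_integral_eq_integral[OF i]) (simp add: d_def)
    ultimately show ?thesis by (simp add: ennreal_leI)
  qed
  have "(\<integral>\<^sup>+ x. (\<Sum>k. ennreal (d k x)) \<partial>M) = (\<Sum>k. \<integral>\<^sup>+ x. ennreal (d k x) \<partial>M)"
    by (rule nn_integral_suminf) measurable
  also have "\<dots> \<le> (\<Sum>k. ennreal ((1 / 2) ^ k))" by (intro suminf_le d1) auto
  also have "\<dots> = ennreal (\<Sum>k. (1 / 2) ^ k)" by (intro suminf_ennreal2) auto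
  also have "\<dots> < \<infinity>" by simp
  finally have "AE x in M. (\<Sum>k. ennreal (d k x)) \<noteq> \<infinity>"
    by (intro nn_integral_PInf_AE) auto
  then have conv: "AE x in M. convergent (\<lambda>k. F (r k) x)"
  proof eventually_elim
    case (elim x)
    have "summable (\<lambda>k. d k x)"
      by (rule summable_suminf_not_top) (use elim in \<open>auto simp: d_def\<close>)
    then have "summable (\<lambda>k. F (r (Suc k)) x - F (r k) x)"
      unfolding d_def by (rule summable_rabs_cancel)
    then have "convergent (\<lambda>n. \<Sum>k<n. F (r (Suc k)) x - F (r k) x)" by (simp add: summable_iff_convergent)
    then have "convergent (\<lambda>n. F (r n) x - F (r 0) x)" by (simp add: sum_lessThan_telescope[of "\<lambda>k. F (r k) x"])
    from convergent_add[OF this convergent_const[of "F (r 0) x"]] show ?case by simp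
  qed
  define f where "f x = lim (\<lambda>k. F (r k) x)" for x
  have [measurable]: "f \<in> borel_measurable M" unfolding f_def[abs_def] by measurable
  have lim: "AE x in M. (\<lambda>k. F (r k) x) \<longlonglongrightarrow> f x"
    using conv by eventually_elim (simp add: f_def convergent_LIMSEQ_iff)
  have bound: "(\<integral>\<^sup>+ x. ennreal ((F m x - f x)\<^sup>2) \<partial>M) \<le> ennreal e" if e: "e > 0" and m: "m \<ge> N e" for e m
  proof -
    have "(\<integral>\<^sup>+ x. ennreal ((F m x - f x)\<^sup>2) \<partial>M) = (\<integral>\<^sup>+ x. liminf (\<lambda>k. ennreal ((F m x - F (r k) x)\<^sup>2)) \<partial>M)"
    proof (rule nn_integral_cong_AE)
      show "AE x in M. ennreal ((F m x - f x)\<^sup>2) = liminf (\<lambda>k. ennreal ((F m x - F (r k) x)\<^sup>2))"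
        using lim
      proof eventually_elim
        case (elim x)
        then have "(\<lambda>k. ennreal ((F m x - F (r k) x)\<^sup>2)) \<longlonglongrightarrow> ennreal ((F m x - f x)\<^sup>2)"
          by (intro tendsto_intros)
        then show ?case by (intro lim_imp_Liminf [symmetric]) auto
      qed
    qed
    also have "\<dots> \<le> liminf (\<lambda>k. \<integral>\<^sup>+ x. ennreal ((F m x - F (r k) x)\<^sup>2) \<partial>M)"
      by (rule nn_integral_liminf) measurable
    also have "\<dots> \<le> limsup (\<lambda>k. \<integral>\<^sup>+ x. ennreal ((F m x - F (r k) x)\<^sup>2) \<partial>M)"
      by (rule Liminf_le_Limsup) simp
    also have "\<dots> \<le> ennreal e"
    proof (rule Limsup_bounded)
      show "\<forall>\<^sub>F k in sequentially. (\<integral>\<^sup>+ x. ennreal ((F m x - F (r k) x)\<^sup>2) \<partial>M) \<le> ennreal e"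
        using eventually_ge_at_top[of "N e"]
      proof eventually_elim
        case (elim k)
        then have "r k \<ge> N e" using rk[of k] by linarith
        then have "(LINT x|M. (F m x - F (r k) x)\<^sup>2) < e" using e m by (intro N)
        then show ?case
          using square_integrable_square[OF dF] by (subst nn_integral_eq_integral) (auto intro: ennreal_leI)
      qed
    qed
    finally show ?thesis .
  qed
  have dsq: "square_integrable M (\<lambda>x. F m x - f x)" if "m \<ge> N 1" for m
  proof (rule square_integrableI)
    show "integrable M (\<lambda>x. (F m x - f x)\<^sup>2)"
      using bound[OF _ that] by (intro integrableI_bounded) (auto intro: le_less_trans)
  qed measurable
  have fsq: "square_integrable M f"
    using square_integrable_diff[OF F dsq, of "N 1" "N 1"] by simp
  have "(\<lambda>n. LINT x|M. (F n x - f x)\<^sup>2) \<longlonglongrightarrow> 0"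
  proof (rule LIMSEQ_I)
    fix e :: real assume e: "e > 0"
    have "norm ((LINT x|M. (F m x - f x)\<^sup>2) - 0) < e" if m: "m \<ge> N (e / 2)" for m
    proof -
      have "ennreal (LINT x|M. (F m x - f x)\<^sup>2) \<le> ennreal (e / 2)"
        using bound[of "e / 2" m] e m square_integrable_square[OF square_integrable_diff[OF F fsq, of m]]
        by (subst (asm) nn_integral_eq_integral) auto
      then have "(LINT x|M. (F m x - f x)\<^sup>2) \<le> e / 2" using e by (simp add: ennreal_le_iff)
      moreover have "(LINT x|M. (F m x - f x)\<^sup>2) \<ge> 0" by simp
      ultimately show ?thesis using e by simp
    qed
    then show "\<exists>no. \<forall>n\<ge>no. norm ((LINT x|M. (F n x - f x)\<^sup>2) - 0) < e" by blast
  qed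
  then show ?thesis using F fsq unfolding tendsto_L2_def by blast
qed

text \<open>Used twice: for an orthonormal basis of functions, and for the independent standard normal
  coefficients of the white noise.\<close>

lemma orthonormal_sum_inner:
  fixes e :: "nat \<Rightarrow> 'b \<Rightarrow> real"
  assumes e: "\<And>j. square_integrable N (e j)"
    and on: "\<And>i j. (LINT x|N. e i x * e j x) = (if i = j then 1 else 0)"
    and fin: "finite I"
  shows "(LINT x|N. (\<Sum>i\<in>I. a i * e i x) * (\<Sum>j\<in>I. b j * e j x)) = (\<Sum>j\<in>I. a j * b j)"
proof -
  have "(LINT x|N. (\<Sum>i\<in>I. a i * e i x) * (\<Sum>j\<in>I. b j * e j x))
     = (LINT x|N. (\<Sum>i\<in>I. \<Sum>j\<in>I. a i * b j * (e i x * e j x)))"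
    by (simp add: sum_product mult_ac)
  also have "\<dots> = (\<Sum>i\<in>I. \<Sum>j\<in>I. a i * b j * (LINT x|N. e i x * e j x))"
    by (subst Bochner_Integration.integral_sum, (intro Bochner_Integration.integrable_sum integrable_mult_right square_integrable_mult e)?,
        simp add: Bochner_Integration.integral_sum square_integrable_mult e)
  also have "\<dots> = (\<Sum>j\<in>I. a j * b j)"
    by (simp add: on fin if_distrib cong: if_cong)
  finally show ?thesis .
qed

section \<open>Laplace-type integrals and the Macdonald function\<close>

text \<open>A function \<open>y \<mapsto> \<integral> w exp (- y \<tau>)\<close> lies above its tangents because the exponential does.
  Differentiating such integrals through convexity avoids dominating the difference quotients.\<close>

lemma laplace_tangent:
  fixes w \<tau> :: "'b \<Rightarrow> real"
  assumes "\<And>r. 0 \<le> w r"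
    and y: "integrable N (\<lambda>r. w r * exp (- y * \<tau> r))"
    and z: "integrable N (\<lambda>r. w r * exp (- z * \<tau> r))"
    and y1: "integrable N (\<lambda>r. w r * \<tau> r * exp (- y * \<tau> r))"
  shows "(LINT r|N. w r * exp (- y * \<tau> r)) - (z - y) * (LINT r|N. w r * \<tau> r * exp (- y * \<tau> r))
    \<le> (LINT r|N. w r * exp (- z * \<tau> r))"
proof -
  have "(LINT r|N. w r * exp (- y * \<tau> r)) - (z - y) * (LINT r|N. w r * \<tau> r * exp (- y * \<tau> r))
    = (LINT r|N. w r * exp (- y * \<tau> r) - (z - y) * (w r * \<tau> r * exp (- y * \<tau> r)))"
    by (subst Bochner_Integration.integral_diff) (use y y1 in auto)
  also have "\<dots> \<le> (LINT r|N. w r * exp (- z * \<tau> r))"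
  proof (rule integral_mono)
    fix r
    have "1 - (z - y) * \<tau> r \<le> exp (- (z - y) * \<tau> r)"
      using exp_ge_add_one_self[of "- (z - y) * \<tau> r"] by (simp only: mult_minus_left diff_conv_add_uminus)
    then have "exp (- y * \<tau> r) * (1 - (z - y) * \<tau> r) \<le> exp (- y * \<tau> r) * exp (- (z - y) * \<tau> r)"
      by (intro mult_left_mono) auto
    also have "\<dots> = exp (- z * \<tau> r)" by (simp only: exp_add [symmetric]) (simp add: algebra_simps)
    finally have "w r * (exp (- y * \<tau> r) * (1 - (z - y) * \<tau> r)) \<le> w r * exp (- z * \<tau> r)"
      using assms(1) by (intro mult_left_mono) auto
    then show "w r * exp (- y * \<tau> r) - (z - y) * (w r * \<tau> r * exp (- y * \<tau> r)) \<le> w r * exp (- z * \<tau> r)"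
      by (simp add: algebra_simps)
  qed (use y y1 z in auto)
  finally show ?thesis .
qed

lemma convex_on_exp_linear: "convex_on UNIV (\<lambda>y::real. exp (- y * t))"
proof (rule convex_onI)
  fix u a b :: real assume u: "0 < u" "u < 1"
  have "exp ((1 - u) *\<^sub>R (- a * t) + u *\<^sub>R (- b * t)) \<le> (1 - u) * exp (- a * t) + u * exp (- b * t)"
    by (rule convex_onD[OF exp_convex]) (use u in auto)
  then show "exp (- ((1 - u) *\<^sub>R a + u *\<^sub>R b) * t) \<le> (1 - u) * exp (- a * t) + u * exp (- b * t)"
    by (simp add: algebra_simps)
qed auto

text \<open>Convexity gives continuity on open intervals for free.\<close>

lemma laplace_convex:
  fixes w \<tau> :: "'b \<Rightarrow> real"
  assumes w: "\<And>r. 0 \<le> w r"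
    and int: "\<And>y. c < y \<Longrightarrow> integrable N (\<lambda>r. w r * exp (- y * \<tau> r))"
  shows "convex_on {c<..} (\<lambda>y. LINT r|N. w r * exp (- y * \<tau> r))"
proof (rule convex_onI)
  fix u a b :: real assume u: "0 < u" "u < 1" and ab: "a \<in> {c<..}" "b \<in> {c<..}"
  have c: "c < (1 - u) *\<^sub>R a + u *\<^sub>R b"
    using convexD_alt[of "{c<..}" a b u] u ab by auto
  have "(LINT r|N. w r * exp (- ((1 - u) *\<^sub>R a + u *\<^sub>R b) * \<tau> r))
     \<le> (LINT r|N. (1 - u) * (w r * exp (- a * \<tau> r)) + u * (w r * exp (- b * \<tau> r)))"
  proof (rule integral_mono)
    fix r
    have "exp (- ((1 - u) *\<^sub>R a + u *\<^sub>R b) * \<tau> r) \<le> (1 - u) * exp (- a * \<tau> r) + u * exp (- b * \<tau> r)"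
      by (rule convex_onD[OF convex_on_exp_linear]) (use u in auto)
    from mult_left_mono[OF this w[of r]]
    show "w r * exp (- ((1 - u) *\<^sub>R a + u *\<^sub>R b) * \<tau> r)
      \<le> (1 - u) * (w r * exp (- a * \<tau> r)) + u * (w r * exp (- b * \<tau> r))"
      by (simp add: algebra_simps)
  qed (use int[OF c] int ab in auto)
  also have "\<dots> = (1 - u) * (LINT r|N. w r * exp (- a * \<tau> r)) + u * (LINT r|N. w r * exp (- b * \<tau> r))"
    by (subst Bochner_Integration.integral_add) (use int ab in auto)
  finally show "(LINT r|N. w r * exp (- ((1 - u) *\<^sub>R a + u *\<^sub>R b) * \<tau> r))
    \<le> (1 - u) * (LINT r|N. w r * exp (- a * \<tau> r)) + u * (LINT r|N. w r * exp (- b * \<tau> r))" .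
qed auto

text \<open>The tangent inequalities at \<open>y\<close> and at \<open>z\<close> enclose the difference quotient between the two values
  of the derivative integral, and this integral is itself convex, hence continuous.\<close>

lemma laplace_has_derivative:
  fixes w \<tau> :: "'b \<Rightarrow> real"
  assumes w: "\<And>r. 0 \<le> w r" "\<And>r. 0 \<le> w r * \<tau> r"
    and int: "\<And>y. c < y \<Longrightarrow> integrable N (\<lambda>r. w r * exp (- y * \<tau> r))"
    and int1: "\<And>y. c < y \<Longrightarrow> integrable N (\<lambda>r. w r * \<tau> r * exp (- y * \<tau> r))"
    and y: "c < y"
  shows "((\<lambda>y. LINT r|N. w r * exp (- y * \<tau> r)) has_real_derivative
    - (LINT r|N. w r * \<tau> r * exp (- y * \<tau> r))) (at y)"
proof -
  define L where "L y = (LINT r|N. w r * exp (- y * \<tau> r))" for y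
  define L1 where "L1 y = (LINT r|N. w r * \<tau> r * exp (- y * \<tau> r))" for y
  have tan: "L y - (z - y) * L1 y \<le> L z" if "c < y" "c < z" for y z
    unfolding L_def L1_def using that by (intro laplace_tangent w int int1)
  have "convex_on {c<..} L1"
    unfolding L1_def by (intro laplace_convex w int1)
  then have "continuous_on {c<..} L1"
    by (intro convex_on_continuous) auto
  then have cont: "L1 \<midarrow>y\<rightarrow> L1 y"
    using y by (simp add: continuous_on_eq_continuous_at isCont_def)
  have "(\<lambda>z. (L z - L y) / (z - y) + L1 y) \<midarrow>y\<rightarrow> 0"
  proof (rule Lim_null_comparison)
    have "eventually (\<lambda>z. z \<in> {c<..}) (at y)"
      using y by (intro eventually_at_in_open') auto
    then show "\<forall>\<^sub>F z in at y. norm ((L z - L y) / (z - y) + L1 y) \<le> norm (L1 z - L1 y)"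
      using eventually_neq_at_within[of y y UNIV]
    proof eventually_elim
      case (elim z)
      then have z: "c < z" "z \<noteq> y" by auto
      have a: "L y - (z - y) * L1 y \<le> L z" "L z - (y - z) * L1 z \<le> L y"
        using tan z y by auto
      show ?case
      proof (cases "z > y")
        case True
        then have "- L1 y \<le> (L z - L y) / (z - y)" "(L z - L y) / (z - y) \<le> - L1 z"
          using a by (auto simp: field_simps)
        then show ?thesis by auto
      next
        case False
        then have "z < y" using z by auto
        then have "(L z - L y) / (z - y) \<le> - L1 y" "- L1 z \<le> (L z - L y) / (z - y)"
          using a by (auto simp: field_simps)
        then show ?thesis by auto
      qed
    qed
    show "(\<lambda>z. norm (L1 z - L1 y)) \<midarrow>y\<rightarrow> 0"
      using tendsto_norm[OF tendsto_diff[OF cont tendsto_const[of "L1 y"]]] by simp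
  qed
  then have "(\<lambda>z. (L z - L y) / (z - y)) \<midarrow>y\<rightarrow> - L1 y"
    using tendsto_add[OF _ tendsto_const[of "- L1 y"], of "\<lambda>z. (L z - L y) / (z - y) + L1 y" 0] by simp
  then show ?thesis
    unfolding has_field_derivative_iff L_def L1_def .
qed

text \<open>With \<open>x = z\<^sup>2 / 4\<close> this is \<open>2 (z / 2)\<^sup>\<mu> K\<^sub>\<mu>(z)\<close>. In the variable \<open>x\<close> the order is lowered by
  differentiation, and for \<open>\<mu> > 0\<close> the limit \<open>\<Gamma>(\<mu>)\<close> at the origin is finite.\<close>

definition macdonald_integral :: "real \<Rightarrow> real \<Rightarrow> real" where
  "macdonald_integral \<mu> x = (LBINT r:{0<..}. r powr (\<mu> - 1) * exp (- r - x / r))"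

lemma Gamma_integral_lborel:
  fixes a :: real assumes "a > 0"
  shows "set_integrable lborel {0<..} (\<lambda>r. r powr (a - 1) * exp (- r))"
    and "(LBINT r:{0<..}. r powr (a - 1) * exp (- r)) = Gamma a"
proof -
  have "has_bochner_integral lborel (\<lambda>t::real. indicator {0..} t * t powr (a - 1) / exp t) (Gamma a)"
    by (rule has_bochner_integral_nn_integral)
       (use assms in \<open>auto simp: Gamma_conv_nn_integral_real[symmetric] Gamma_real_pos less_imp_le\<close>)
  also have "(\<lambda>t::real. indicator {0..} t * t powr (a - 1) / exp t)
      = (\<lambda>t. indicator {0<..} t *\<^sub>R (t powr (a - 1) * exp (- t)))"
    by (auto simp: fun_eq_iff indicator_def exp_minus field_simps)
  finally show "set_integrable lborel {0<..} (\<lambda>r. r powr (a - 1) * exp (- r))"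
    "(LBINT r:{0<..}. r powr (a - 1) * exp (- r)) = Gamma a"
    unfolding set_integrable_def set_lebesgue_integral_def
    by (auto simp: has_bochner_integral_iff)
qed

text \<open>Exponential decay against powers, from a single term of the exponential series.\<close>

lemma exp_neg_le_power:
  fixes y :: real assumes "y > 0"
  shows "exp (- y) \<le> fact n / y ^ n"
proof -
  have "y ^ n / fact n \<le> exp y"
    using sum_le_suminf[OF summable_exp_generic[of y], of "{n}"] assms
    by (simp add: exp_def field_simps)
  then show ?thesis
    using assms by (simp add: exp_minus field_simps)
qed

lemma macdonald_integrable:
  fixes x \<mu> :: real
  assumes "x > 0 \<or> x = 0 \<and> \<mu> > 0"
  shows "set_integrable lborel {0<..} (\<lambda>r. r powr (\<mu> - 1) * exp (- r - x / r))"
proof -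
  \<comment> \<open>For \<open>x > 0\<close> the factor \<open>exp (- x / r)\<close> supplies as many powers of \<open>r\<close> as are needed to make the
    order positive.\<close>
  define n where "n = (if x = 0 then 0 else nat (\<lceil>1 - \<mu>\<rceil>))"
  have n: "\<mu> + real n > 0" using assms unfolding n_def by (auto simp: of_nat_ceiling) linarith+
  show ?thesis
    unfolding set_integrable_def
  proof (rule Bochner_Integration.integrable_bound)
    show "integrable lborel (\<lambda>r. fact n / x ^ n * (indicator {0<..} r *\<^sub>R (r powr (\<mu> + real n - 1) * exp (- r))))"
      using Gamma_integral_lborel(1)[OF n] by (simp add: set_integrable_def)
    show "AE r in lborel. norm (indicator {0<..} r *\<^sub>R (r powr (\<mu> - 1) * exp (- r - x / r)))
       \<le> norm (fact n / x ^ n * (indicator {0<..} r *\<^sub>R (r powr (\<mu> + real n - 1) * exp (- r))))"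
    proof (rule AE_I2)
      fix r :: real
      show "norm (indicator {0<..} r *\<^sub>R (r powr (\<mu> - 1) * exp (- r - x / r)))
       \<le> norm (fact n / x ^ n * (indicator {0<..} r *\<^sub>R (r powr (\<mu> + real n - 1) * exp (- r))))"
      proof (cases "r > 0")
        case True
        have "exp (- (x / r)) \<le> fact n / x ^ n * r ^ n"
          using exp_neg_le_power[of "x / r" n] assms True
          by (cases "x = 0") (auto simp: n_def power_divide field_simps)
        then have "r powr (\<mu> - 1) * exp (- r) * exp (- (x / r))
           \<le> r powr (\<mu> - 1) * exp (- r) * (fact n / x ^ n * r ^ n)"
          by (intro mult_left_mono) auto
        also have "\<dots> = fact n / x ^ n * (r powr (\<mu> + real n - 1) * exp (- r))"
          using True by (simp add: powr_add powr_diff powr_realpow field_simps)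
        finally have "r powr (\<mu> - 1) * exp (- r - x / r)
           \<le> fact n / x ^ n * (r powr (\<mu> + real n - 1) * exp (- r))"
          by (simp add: exp_diff exp_minus field_simps)
        then show ?thesis using True assms by (auto simp: abs_mult)
      qed auto
    qed
  qed auto
qed

lemma macdonald_integral_0: "\<mu> > 0 \<Longrightarrow> macdonald_integral \<mu> 0 = Gamma \<mu>"
  using Gamma_integral_lborel(2)[of \<mu>] by (simp add: macdonald_integral_def)

lemma macdonald_integral_pos:
  assumes "x > 0 \<or> x = 0 \<and> \<mu> > 0"
  shows "macdonald_integral \<mu> x > 0"
proof -
  let ?f = "\<lambda>r. indicator {0<..} r *\<^sub>R (r powr (\<mu> - 1) * exp (- r - x / r))"
  have int: "integrable lborel ?f"
    using macdonald_integrable[OF assms] by (simp add: set_integrable_def)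
  have "integral\<^sup>L lborel ?f \<noteq> 0"
  proof
    assume "integral\<^sup>L lborel ?f = 0"
    then have "AE r in lborel. ?f r = 0"
      using int by (subst (asm) integral_nonneg_eq_0_iff_AE) auto
    then have "AE r in lborel. r \<notin> {0<..<1::real}"
      by eventually_elim (auto simp: indicator_def split: if_splits)
    then have "emeasure lborel {0<..<1::real} = 0"
      by (subst (asm) AE_iff_measurable[of "{0<..<1::real}"]) auto
    then show False by simp
  qed
  moreover have "integral\<^sup>L lborel ?f \<ge> 0" by (intro integral_nonneg_AE) auto
  ultimately show ?thesis unfolding macdonald_integral_def set_lebesgue_integral_def by linarith
qed

text \<open>Lowering the order by one divides the integrand by \<open>r\<close>, which is what the derivative of
  \<open>exp (- x / r)\<close> does up to sign.\<close>

lemma macdonald_integral_has_derivative: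
  assumes "x > 0"
  shows "(macdonald_integral \<mu> has_real_derivative - macdonald_integral (\<mu> - 1) x) (at x)"
proof -
  have powr_minus_2: "x powr (\<mu> - 2) = x powr (\<mu> - 1) / x" if "x > 0" for x :: real
    using that powr_diff[of x "\<mu> - 1" 1] by simp
  define w where "w r = indicator {0<..} r * (r powr (\<mu> - 1) * exp (- r))" for r :: real
  have eq: "macdonald_integral \<mu> y = (LINT r|lborel. w r * exp (- y * (1 / r)))" for y
    unfolding macdonald_integral_def set_lebesgue_integral_def w_def
    by (intro Bochner_Integration.integral_cong) (auto simp: exp_diff exp_minus field_simps)
  have eq': "macdonald_integral (\<mu> - 1) y = (LINT r|lborel. w r * (1 / r) * exp (- y * (1 / r)))" for y
    unfolding macdonald_integral_def set_lebesgue_integral_def w_def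
    by (intro Bochner_Integration.integral_cong)
      (auto simp: exp_diff exp_minus indicator_def powr_minus_2 inverse_eq_divide)
  have fe: "(\<lambda>r. w r * exp (- y * (1 / r))) =
     (\<lambda>r. indicator {0<..} r *\<^sub>R (r powr (\<mu> - 1) * exp (- r - y / r)))" for y
    by (auto simp: w_def fun_eq_iff exp_diff exp_minus field_simps)
  have fe': "(\<lambda>r. w r * (1 / r) * exp (- y * (1 / r))) =
     (\<lambda>r. indicator {0<..} r *\<^sub>R (r powr (\<mu> - 1 - 1) * exp (- r - y / r)))" for y
    by (auto simp: w_def fun_eq_iff exp_diff exp_minus field_simps indicator_def powr_diff power2_eq_square)
  have "((\<lambda>y. LINT r|lborel. w r * exp (- y * (1 / r))) has_real_derivative
    - (LINT r|lborel. w r * (1 / r) * exp (- x * (1 / r)))) (at x)"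
  proof (rule laplace_has_derivative[where c = 0])
    fix y :: real assume "0 < y"
    then show "integrable lborel (\<lambda>r. w r * exp (- y * (1 / r)))"
      "integrable lborel (\<lambda>r. w r * (1 / r) * exp (- y * (1 / r)))"
      unfolding fe fe' using macdonald_integrable[of y \<mu>] macdonald_integrable[of y "\<mu> - 1"]
      by (auto simp: set_integrable_def)
  qed (use assms in \<open>auto simp: w_def indicator_def\<close>)
  then show ?thesis
    unfolding eq' eq[abs_def] .
qed

text \<open>As a function of the order this is again a Laplace-type integral, with exponent \<open>- ln r\<close>.\<close>

lemma isCont_macdonald_integral_order:
  assumes "x > 0"
  shows "isCont (\<lambda>\<mu>. macdonald_integral \<mu> x) \<mu>"
proof -
  define w where "w r = indicator {0<..} r * (exp (- r - x / r) / r)" for r :: real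
  have fe: "(\<lambda>r. w r * exp (- m * (- ln r))) =
     (\<lambda>r. indicator {0<..} r *\<^sub>R (r powr (m - 1) * exp (- r - x / r)))" for m
    by (auto simp: w_def fun_eq_iff indicator_def powr_def left_diff_distrib exp_diff field_simps)
  have "convex_on {\<mu> - 1<..} (\<lambda>m. LINT r|lborel. w r * exp (- m * (- ln r)))"
  proof (rule laplace_convex)
    show "integrable lborel (\<lambda>r. w r * exp (- m * (- ln r)))" for m
      unfolding fe using macdonald_integrable[of x] assms by (simp add: set_integrable_def)
  qed (auto simp: w_def indicator_def)
  then have "continuous_on {\<mu> - 1<..} (\<lambda>m. LINT r|lborel. w r * exp (- m * (- ln r)))"
    by (intro convex_on_continuous) auto
  then have "isCont (\<lambda>m. LINT r|lborel. w r * exp (- m * (- ln r))) \<mu>"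
    by (subst (asm) continuous_on_eq_continuous_at) auto
  then show ?thesis
    unfolding fe macdonald_integral_def[abs_def] set_lebesgue_integral_def .
qed

text \<open>The substitution \<open>r = x / s\<close> exchanges the two terms of the exponent.\<close>

lemma macdonald_integral_reflect:
  assumes x: "x > 0"
  shows "macdonald_integral \<mu> x = x powr \<mu> * macdonald_integral (- \<mu>) x"
proof -
  define f where "f r = r powr (\<mu> - 1) * exp (- r - x / r)" for r :: real
  define h where "h s = - x / s\<^sup>2" for s :: real
  have img: "(\<lambda>s. x / s) ` {0<..} = {0<..}"
  proof (intro equalityI subsetI)
    fix r :: real assume "r \<in> {0<..}"
    then show "r \<in> (\<lambda>s. x / s) ` {0<..}" using x by (intro image_eqI[of _ _ "x / r"]) auto
  qed (use x in auto)
  have "(\<lambda>s. \<bar>h s\<bar> *\<^sub>R f (x / s)) absolutely_integrable_on {0<..} \<and>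
        integral {0<..} (\<lambda>s. \<bar>h s\<bar> *\<^sub>R f (x / s)) = macdonald_integral \<mu> x \<longleftrightarrow>
      f absolutely_integrable_on (\<lambda>s. x / s) ` {0<..} \<and>
        integral ((\<lambda>s. x / s) ` {0<..}) f = macdonald_integral \<mu> x"
  proof (rule has_absolute_integral_change_of_variables_real)
    show "((\<lambda>s. x / s) has_field_derivative h s) (at s within {0<..})" if "s \<in> {0<..}" for s
      using that x unfolding h_def by (auto intro!: derivative_eq_intros simp: power2_eq_square field_simps)
    show "inj_on (\<lambda>s. x / s) {0<..}" using x by (auto simp: inj_on_def)
  qed auto
  moreover have sf: "set_integrable lborel {0<..} f"
    unfolding f_def using macdonald_integrable x by blast
  then have "f absolutely_integrable_on {0<..}"
    by (simp add: set_integrable_def integrable_completion)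
  moreover have "integral {0<..} f = macdonald_integral \<mu> x"
    using set_borel_integral_eq_integral(2)[OF sf] by (simp add: macdonald_integral_def f_def)
  ultimately have "integral {0<..} (\<lambda>s. \<bar>h s\<bar> *\<^sub>R f (x / s)) = macdonald_integral \<mu> x"
    by (simp add: img)
  also have "integral {0<..} (\<lambda>s. \<bar>h s\<bar> *\<^sub>R f (x / s))
     = integral {0<..} (\<lambda>s. x powr \<mu> * (s powr (- \<mu> - 1) * exp (- s - x / s)))"
  proof (rule integral_cong)
    fix s :: real assume "s \<in> {0<..}"
    then have s: "s > 0" by simp
    have "\<bar>h s\<bar> *\<^sub>R f (x / s) = x / s\<^sup>2 * ((x / s) powr (\<mu> - 1) * exp (- (x / s) - s))"
      using s x by (simp add: h_def f_def abs_mult)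
    also have "x / s\<^sup>2 * (x / s) powr (\<mu> - 1) = x powr \<mu> * s powr (- \<mu> - 1)"
      using s x by (simp add: powr_divide powr_diff powr_minus power2_eq_square field_simps)
    then have "x / s\<^sup>2 * ((x / s) powr (\<mu> - 1) * exp (- (x / s) - s))
        = x powr \<mu> * (s powr (- \<mu> - 1) * exp (- (x / s) - s))"
      by (metis mult.assoc)
    finally show "\<bar>h s\<bar> *\<^sub>R f (x / s) = x powr \<mu> * (s powr (- \<mu> - 1) * exp (- s - x / s))"
      by (simp add: algebra_simps)
  qed
  also have "\<dots> = x powr \<mu> * integral {0<..} (\<lambda>s. s powr (- \<mu> - 1) * exp (- s - x / s))"
    by simp
  also have "integral {0<..} (\<lambda>s. s powr (- \<mu> - 1) * exp (- s - x / s)) = macdonald_integral (- \<mu>) x"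
    using set_borel_integral_eq_integral(2)[OF macdonald_integrable[of x "- \<mu>"]] x
    by (simp add: macdonald_integral_def)
  finally show ?thesis by simp
qed

lemma macdonald_integral_tendsto_Gamma:
  assumes "\<mu> > 0"
  shows "(macdonald_integral \<mu> \<longlongrightarrow> Gamma \<mu>) (at_right 0)"
  unfolding filterlim_at_right_to_top macdonald_integral_0[OF assms, symmetric]
  unfolding macdonald_integral_def set_lebesgue_integral_def
proof (rule integral_dominated_convergence_at_top)
  show "integrable lborel (\<lambda>r::real. indicator {0<..} r *\<^sub>R (r powr (\<mu> - 1) * exp (- r)))"
    using Gamma_integral_lborel(1)[OF assms] by (simp add: set_integrable_def)
  show "AE r in lborel. ((\<lambda>t::real. indicator {0<..} r *\<^sub>R (r powr (\<mu> - 1) * exp (- r - inverse t / r)))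
      \<longlongrightarrow> indicator {0<..} r *\<^sub>R (r powr (\<mu> - 1) * exp (- r - 0 / r))) at_top"
  proof (rule AE_I2)
    fix r :: real
    show "((\<lambda>t::real. indicator {0<..} r *\<^sub>R (r powr (\<mu> - 1) * exp (- r - inverse t / r)))
      \<longlongrightarrow> indicator {0<..} r *\<^sub>R (r powr (\<mu> - 1) * exp (- r - 0 / r))) at_top"
    proof (cases "r > 0")
      case True
      then have "((\<lambda>t::real. r powr (\<mu> - 1) * exp (- r - inverse t / r))
          \<longlongrightarrow> r powr (\<mu> - 1) * exp (- r - 0 / r)) at_top"
        by (intro tendsto_intros tendsto_inverse_0_at_top filterlim_ident) auto
      then show ?thesis using True by simp
    qed simp
  qed
  show "\<forall>\<^sub>F t::real in at_top. AE r in lborel.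
      norm (indicator {0<..} r *\<^sub>R (r powr (\<mu> - 1) * exp (- r - inverse t / r)))
      \<le> indicator {0<..} r *\<^sub>R (r powr (\<mu> - 1) * exp (- r))"
    using eventually_gt_at_top[of 0]
  proof eventually_elim
    case (elim t)
    then show ?case by (intro AE_I2) (auto simp: indicator_def)
  qed
qed auto

text \<open>The entire function with \<open>I\<^sub>\<mu>(z) = (z / 2)\<^sup>\<mu> bessel_series (1 + \<mu>) (z\<^sup>2 / 4)\<close>.\<close>

definition bessel_series :: "real \<Rightarrow> real \<Rightarrow> real" where
  "bessel_series s x = (\<Sum>k. rGamma (real k + s) / fact k * x ^ k)"

text \<open>Since \<open>rGamma (k + s) = (k + s) rGamma (k + s + 1)\<close>, the quotient of consecutive terms is
  \<open>x / ((k + 1) (k + s))\<close>.\<close>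

lemma summable_bessel_series: "summable (\<lambda>k. rGamma (real k + s) / fact k * x ^ k)"
proof -
  \<comment> \<open>Beyond \<open>N\<close> the ratio of consecutive terms is at most one half.\<close>
  define N where "N = nat \<lceil>\<bar>s\<bar> + 2 * \<bar>x\<bar> + 1\<rceil>"
  show ?thesis
  proof (rule summable_ratio_test[of "1/2" N])
    fix k assume "N \<le> k"
    then have k: "real k \<ge> \<bar>s\<bar> + 2 * \<bar>x\<bar> + 1" unfolding N_def by linarith
    have r: "rGamma (real k + s) = (real k + s) * rGamma (real k + s + 1)"
      by (simp add: rGamma_plus1)
    have "2 * \<bar>x\<bar> * 1 \<le> (real k + s) * (real k + 1)"
      using k by (intro mult_mono) auto
    then have le: "\<bar>x\<bar> / (real k + 1) \<le> 1/2 * (real k + s)" by (simp add: field_simps)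
    have "norm (rGamma (real (Suc k) + s) / fact (Suc k) * x ^ Suc k)
       = (\<bar>x\<bar> / (real k + 1)) * (\<bar>rGamma (real k + s + 1)\<bar> / fact k * \<bar>x\<bar> ^ k)"
      by (simp add: abs_mult power_abs field_simps)
    also have "\<dots> \<le> (1/2 * (real k + s)) * (\<bar>rGamma (real k + s + 1)\<bar> / fact k * \<bar>x\<bar> ^ k)"
      by (intro mult_right_mono le) auto
    also have "\<dots> = 1/2 * norm (rGamma (real k + s) / fact k * x ^ k)"
      using k by (subst r) (simp add: abs_mult power_abs)
    finally show "norm (rGamma (real (Suc k) + s) / fact (Suc k) * x ^ Suc k)
      \<le> 1/2 * norm (rGamma (real k + s) / fact k * x ^ k)" .
  qed auto
qed

lemma bessel_series_has_derivative:
  "(bessel_series s has_real_derivative bessel_series (s + 1) x) (at x)"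
proof -
  have "real (Suc k) * (G / fact (Suc k)) = G / fact k" for k :: nat and G :: real
    unfolding fact_Suc by (simp del: of_nat_Suc)
  then have "diffs (\<lambda>k. rGamma (real k + s) / fact k) = (\<lambda>k. rGamma (real k + (s + 1)) / fact k)"
    by (simp add: diffs_def fun_eq_iff add_ac del: fact_Suc)
  then show ?thesis
    using termdiffs_strong_converges_everywhere[OF summable_bessel_series, of s x]
    by (simp add: bessel_series_def[abs_def])
qed

lemma bessel_series_0: "bessel_series s 0 = rGamma s"
  unfolding bessel_series_def by (subst powser_zero) simp

lemma bessel_series_recurrence:
  "bessel_series s x = s * bessel_series (s + 1) x + x * bessel_series (s + 2) x"
proof -
  let ?a = "\<lambda>k. rGamma (real k + (s + 1)) / fact k * x ^ k"
  let ?b = "\<lambda>k. rGamma (real k + (s + 2)) / fact k * x ^ k"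
  let ?c = "\<lambda>k. real k * ?a k"
  have "real (Suc k) * (G / fact (Suc k) * x ^ Suc k) = x * (G / fact k * x ^ k)" for k :: nat and G :: real
    unfolding fact_Suc by (simp del: of_nat_Suc)
  then have c: "?c (Suc k) = x * ?b k" for k
    by (simp add: add_ac del: fact_Suc power_Suc)
  have "summable (\<lambda>k. ?c (Suc k))"
    unfolding c by (intro summable_mult summable_bessel_series)
  then have sc: "summable ?c" by (subst (asm) summable_Suc_iff)
  have cs: "suminf ?c = x * bessel_series (s + 2) x"
    using suminf_split_head[OF sc] unfolding c bessel_series_def
    unfolding suminf_mult[OF summable_bessel_series] by simp
  have "rGamma (real k + s) / fact k * x ^ k = s * ?a k + ?c k" for k
  proof -
    have "rGamma (real k + s) = (real k + s) * rGamma (real k + (s + 1))"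
      using rGamma_plus1[of "real k + s"] by (simp add: add_ac)
    then show ?thesis by (simp add: algebra_simps add_divide_distrib)
  qed
  then have "bessel_series s x = (\<Sum>k. s * ?a k + ?c k)"
    unfolding bessel_series_def by simp
  also have "\<dots> = (\<Sum>k. s * ?a k) + suminf ?c"
    by (intro suminf_add[symmetric] sc summable_mult summable_bessel_series)
  also have "(\<Sum>k. s * ?a k) = s * bessel_series (s + 1) x"
    unfolding bessel_series_def by (rule suminf_mult[OF summable_bessel_series])
  finally show ?thesis using cs by simp
qed

text \<open>The combination of \<open>I\<^sub>-\<^sub>\<mu>\<close> and \<open>I\<^sub>\<mu>\<close> that defines \<open>K\<^sub>\<mu>\<close> for non-integral orders, in the
  normalisation of \<open>macdonald_integral\<close>.\<close>

definition macdonald_series :: "real \<Rightarrow> real \<Rightarrow> real" where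
  "macdonald_series \<mu> x =
     pi / sin (pi * \<mu>) * (bessel_series (1 - \<mu>) x - x powr \<mu> * bessel_series (1 + \<mu>) x)"

lemma macdonald_series_shift:
  "macdonald_series (\<mu> - 1) x = - (pi / sin (pi * \<mu>)) *
     (bessel_series (2 - \<mu>) x - x powr (\<mu> - 1) * bessel_series \<mu> x)"
  by (simp add: macdonald_series_def sin_diff right_diff_distrib algebra_simps)

text \<open>The series satisfies the same two identities as the integral: differentiation lowers the order,
  and reflection of the order multiplies by a power of \<open>x\<close>.\<close>

lemma macdonald_series_has_derivative:
  assumes "x > 0"
  shows "(macdonald_series \<mu> has_real_derivative - macdonald_series (\<mu> - 1) x) (at x)"
proof -
  have *: "(bessel_series s has_real_derivative bessel_series (s + 1) x) (at x)" for s
    by (rule bessel_series_has_derivative)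
  have "bessel_series \<mu> x = \<mu> * bessel_series (1 + \<mu>) x + x * bessel_series (2 + \<mu>) x"
    using bessel_series_recurrence[of \<mu> x] by (simp add: add_ac)
  then have "x powr (\<mu> - 1) * bessel_series \<mu> x
     = \<mu> * x powr (\<mu> - 1) * bessel_series (1 + \<mu>) x + x powr \<mu> * bessel_series (2 + \<mu>) x"
    using assms by (simp add: algebra_simps powr_diff)
  then have "\<mu> * x powr (\<mu> - 1) * bessel_series (1 + \<mu>) x + x powr \<mu> * bessel_series (1 + \<mu> + 1) x
     = x powr (\<mu> - 1) * bessel_series \<mu> x"
    by (simp add: add_ac)
  then have "pi / sin (pi * \<mu>) * (bessel_series (1 - \<mu> + 1) x
      - (\<mu> * x powr (\<mu> - 1) * bessel_series (1 + \<mu>) x + x powr \<mu> * bessel_series (1 + \<mu> + 1) x))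
     = - macdonald_series (\<mu> - 1) x"
    unfolding macdonald_series_shift by (simp only: mult_minus_left minus_minus) (simp add: add_ac)
  moreover have "(macdonald_series \<mu> has_real_derivative
     pi / sin (pi * \<mu>) * (bessel_series (1 - \<mu> + 1) x
      - (\<mu> * x powr (\<mu> - 1) * bessel_series (1 + \<mu>) x + x powr \<mu> * bessel_series (1 + \<mu> + 1) x))) (at x)"
    unfolding macdonald_series_def[abs_def] using assms
    by (intro DERIV_cmult) (auto intro!: derivative_eq_intros * )
  ultimately show ?thesis by simp
qed

lemma macdonald_series_reflect:
  assumes "x > 0"
  shows "macdonald_series \<mu> x = x powr \<mu> * macdonald_series (- \<mu>) x"
proof -
  have "x powr \<mu> * x powr (- \<mu>) = 1" using assms by (simp add: powr_minus)
  moreover have "x powr \<mu> * (- c * (B - x powr (- \<mu>) * A)) = c * (x powr \<mu> * x powr (- \<mu>) * A - x powr \<mu> * B)"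
    for A B c by (simp add: algebra_simps)
  from this[of "pi / sin (pi * \<mu>)"] have "x powr \<mu> * macdonald_series (- \<mu>) x = pi / sin (pi * \<mu>) *
      (x powr \<mu> * x powr (- \<mu>) * bessel_series (1 - \<mu>) x - x powr \<mu> * bessel_series (1 + \<mu>) x)"
    by (simp add: macdonald_series_def)
  ultimately show ?thesis by (simp add: macdonald_series_def)
qed

lemma Gamma_reflection_real:
  fixes z :: real shows "Gamma z * Gamma (1 - z) = pi / sin (pi * z)"
proof -
  have "complex_of_real (Gamma z * Gamma (1 - z)) = complex_of_real (pi / sin (pi * z))"
    using Gamma_reflection_complex[of "of_real z"]
    by (simp add: Gamma_complex_of_real [symmetric] sin_of_real [symmetric])
  then show ?thesis unfolding of_real_eq_iff .
qed

lemma macdonald_series_tendsto_Gamma: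
  assumes "0 < \<mu>" "\<mu> < 1"
  shows "(macdonald_series \<mu> \<longlongrightarrow> Gamma \<mu>) (at_right 0)"
proof -
  have b: "(bessel_series s \<longlongrightarrow> rGamma s) (at_right 0)" for s
    using DERIV_isCont[OF bessel_series_has_derivative[of s 0]]
    by (auto simp: isCont_def bessel_series_0 intro: filterlim_mono at_le)
  have "((\<lambda>x::real. x powr \<mu>) \<longlongrightarrow> 0) (at_right 0)"
    using assms by real_asymp
  then have "(macdonald_series \<mu> \<longlongrightarrow> pi / sin (pi * \<mu>) * (rGamma (1 - \<mu>) - 0 * rGamma (1 + \<mu>))) (at_right 0)"
    unfolding macdonald_series_def[abs_def] by (intro tendsto_intros b)
  also have "pi / sin (pi * \<mu>) * (rGamma (1 - \<mu>) - 0 * rGamma (1 + \<mu>)) = Gamma \<mu>"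
    using assms Gamma_real_pos[of "1 - \<mu>"]
    unfolding Gamma_reflection_real [symmetric] rGamma_inverse_Gamma by (simp del: Gamma_real_pos)
  finally show ?thesis .
qed

lemma constant_on_right_half_line_eq_limit:
  fixes f :: "real \<Rightarrow> real"
  assumes "\<And>x. x > 0 \<Longrightarrow> (f has_real_derivative 0) (at x)"
    and lim: "(f \<longlongrightarrow> L) (at_right 0)" and x: "x > 0"
  shows "f x = L"
proof -
  obtain c where c: "\<And>x. x > 0 \<Longrightarrow> f x = c"
    using has_field_derivative_zero_constant[of "{0<..}" f] assms(1)
    by (auto intro: has_field_derivative_at_within)
  have "(f \<longlongrightarrow> c) (at_right 0)"
    by (rule tendsto_eventually) (auto simp: eventually_at_filter c)
  then have "c = L" using lim by (rule tendsto_unique[rotated]) simp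
  then show ?thesis using c x by simp
qed

text \<open>The Wronskian \<open>Y\<^sub>1\<^sub>-\<^sub>\<mu> F\<^sub>\<mu> - Y\<^sub>\<mu> F\<^sub>1\<^sub>-\<^sub>\<mu>\<close> of series \<open>Y\<close> and integral \<open>F\<close> has derivative zero by the
  reflection identities, and it vanishes at the origin because both functions have the limits
  \<open>\<Gamma>(\<mu>)\<close> and \<open>\<Gamma>(1 - \<mu>)\<close> there. A vanishing Wronskian makes \<open>Y / F\<close> constant, and the limit at the
  origin shows that the constant is one.\<close>

lemma macdonald_integral_eq_series_base:
  assumes \<mu>: "0 < \<mu>" "\<mu> < 1" and x: "x > 0"
  shows "macdonald_integral \<mu> x = macdonald_series \<mu> x"
proof -
  let ?F = macdonald_integral and ?Y = macdonald_series
  have W: "?Y (1 - \<mu>) x * ?F \<mu> x - ?Y \<mu> x * ?F (1 - \<mu>) x = 0" if "x > 0" for x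
  proof (rule constant_on_right_half_line_eq_limit[OF _ _ that])
    fix x :: real assume x: "x > 0"
    have r: "?F \<mu> x = x powr \<mu> * ?F (- \<mu>) x" "?F (1 - \<mu>) x = x powr (1 - \<mu>) * ?F (\<mu> - 1) x"
      "?Y \<mu> x = x powr \<mu> * ?Y (- \<mu>) x" "?Y (1 - \<mu>) x = x powr (1 - \<mu>) * ?Y (\<mu> - 1) x"
      using macdonald_integral_reflect[OF x, of \<mu>] macdonald_integral_reflect[OF x, of "1 - \<mu>"]
        macdonald_series_reflect[OF x, of \<mu>] macdonald_series_reflect[OF x, of "1 - \<mu>"] by simp_all
    have "((\<lambda>x. ?Y (1 - \<mu>) x * ?F \<mu> x - ?Y \<mu> x * ?F (1 - \<mu>) x) has_real_derivative
       (- ?Y (- \<mu>) x * ?F \<mu> x + - ?F (\<mu> - 1) x * ?Y (1 - \<mu>) x)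
       - (- ?Y (\<mu> - 1) x * ?F (1 - \<mu>) x + - ?F (- \<mu>) x * ?Y \<mu> x)) (at x)"
      using macdonald_integral_has_derivative[OF x, of \<mu>] macdonald_integral_has_derivative[OF x, of "1 - \<mu>"]
        macdonald_series_has_derivative[OF x, of \<mu>] macdonald_series_has_derivative[OF x, of "1 - \<mu>"]
      by (intro DERIV_diff DERIV_mult) simp_all
    also have "(- ?Y (- \<mu>) x * ?F \<mu> x + - ?F (\<mu> - 1) x * ?Y (1 - \<mu>) x)
       - (- ?Y (\<mu> - 1) x * ?F (1 - \<mu>) x + - ?F (- \<mu>) x * ?Y \<mu> x) = 0"
      unfolding r by (simp add: algebra_simps)
    finally show "((\<lambda>x. ?Y (1 - \<mu>) x * ?F \<mu> x - ?Y \<mu> x * ?F (1 - \<mu>) x) has_real_derivative 0) (at x)" .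
  next
    have "((\<lambda>x. ?Y (1 - \<mu>) x * ?F \<mu> x - ?Y \<mu> x * ?F (1 - \<mu>) x) \<longlongrightarrow>
      Gamma (1 - \<mu>) * Gamma \<mu> - Gamma \<mu> * Gamma (1 - \<mu>)) (at_right 0)"
      using \<mu> by (intro tendsto_intros macdonald_series_tendsto_Gamma macdonald_integral_tendsto_Gamma) auto
    then show "((\<lambda>x. ?Y (1 - \<mu>) x * ?F \<mu> x - ?Y \<mu> x * ?F (1 - \<mu>) x) \<longlongrightarrow> 0) (at_right 0)" by simp
  qed
  have pos: "?F \<mu> x > 0" if "x > 0" for x using macdonald_integral_pos that by blast
  have Gamma_nz: "Gamma \<mu> \<noteq> 0" using \<mu> by (metis Gamma_real_pos less_irrefl)
  have "?Y \<mu> x / ?F \<mu> x = Gamma \<mu> / Gamma \<mu>"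
  proof (rule constant_on_right_half_line_eq_limit[OF _ _ x])
    fix x :: real assume x: "x > 0"
    have r: "?F (1 - \<mu>) x = x powr (1 - \<mu>) * ?F (\<mu> - 1) x" "?Y (1 - \<mu>) x = x powr (1 - \<mu>) * ?Y (\<mu> - 1) x"
      using macdonald_integral_reflect[OF x, of "1 - \<mu>"] macdonald_series_reflect[OF x, of "1 - \<mu>"] by simp_all
    have "x powr (1 - \<mu>) * (?Y (\<mu> - 1) x * ?F \<mu> x - ?Y \<mu> x * ?F (\<mu> - 1) x) = 0"
      using W[OF x] unfolding r by (simp add: algebra_simps)
    then have w: "?Y (\<mu> - 1) x * ?F \<mu> x = ?Y \<mu> x * ?F (\<mu> - 1) x" using x by simp
    have "((\<lambda>x. ?Y \<mu> x / ?F \<mu> x) has_real_derivative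
       (- ?Y (\<mu> - 1) x * ?F \<mu> x - ?Y \<mu> x * - ?F (\<mu> - 1) x) / (?F \<mu> x * ?F \<mu> x)) (at x)"
      using pos[OF x] x
      by (intro DERIV_divide macdonald_integral_has_derivative macdonald_series_has_derivative) auto
    then show "((\<lambda>x. ?Y \<mu> x / ?F \<mu> x) has_real_derivative 0) (at x)" by (simp add: w)
  next
    show "((\<lambda>x. ?Y \<mu> x / ?F \<mu> x) \<longlongrightarrow> Gamma \<mu> / Gamma \<mu>) (at_right 0)"
      using \<mu> Gamma_nz
      by (intro tendsto_intros macdonald_series_tendsto_Gamma macdonald_integral_tendsto_Gamma)
  qed
  then show ?thesis using pos[OF x] Gamma_nz by (simp add: field_simps)
qed

text \<open>From orders in the unit interval, differentiation reaches all negative non-integral orders, and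
  reflection takes these to the positive ones.\<close>

lemma macdonald_integral_eq_series:
  assumes "\<mu> > 0" "\<mu> \<notin> \<int>" and x: "x > 0"
  shows "macdonald_integral \<mu> x = macdonald_series \<mu> x"
proof -
  have down: "macdonald_integral (t - real n) x = macdonald_series (t - real n) x"
    if t: "0 < t" "t < 1" and "x > 0" for t n x
    using that(3)
  proof (induction n arbitrary: x)
    case 0
    then show ?case using macdonald_integral_eq_series_base[OF t] by simp
  next
    case (Suc n)
    have "(macdonald_series (t - real n) has_real_derivative - macdonald_integral (t - real n - 1) x) (at x)"
      by (rule has_field_derivative_transform_within_open
          [OF macdonald_integral_has_derivative[OF Suc.prems] open_greaterThan[of 0]])
        (use Suc in auto)
    from DERIV_unique[OF this macdonald_series_has_derivative[OF Suc.prems]]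
    show ?case by (simp add: algebra_simps)
  qed
  define n where "n = nat \<lceil>\<mu>\<rceil>"
  have n: "real n = of_int \<lceil>\<mu>\<rceil>" using assms(1) by (simp add: n_def)
  have "\<mu> \<noteq> of_int \<lceil>\<mu>\<rceil>" using assms(2) by (metis Ints_of_int)
  then have t: "0 < real n - \<mu>" "real n - \<mu> < 1" unfolding n by linarith+
  have "macdonald_integral (- \<mu>) x = macdonald_series (- \<mu>) x"
    using down[OF t x, of n] by simp
  then show ?thesis
    using macdonald_integral_reflect[OF x, of \<mu>] macdonald_series_reflect[OF x, of \<mu>] by simp
qed

lemma bessel_I_eq_series:
  assumes "z > 0"
  shows "bessel_I \<mu> z = (z / 2) powr \<mu> * bessel_series (1 + \<mu>) (z\<^sup>2 / 4)"
proof -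
  have "(z / 2) powr (2 * real k + \<mu>) * rGamma (real k + \<mu> + 1) / fact k
      = (z / 2) powr \<mu> * (rGamma (real k + (1 + \<mu>)) / fact k * (z\<^sup>2 / 4) ^ k)" for k
  proof -
    have "(z / 2) powr (2 * real k) = (z / 2) ^ (2 * k)"
      using powr_realpow[of "z / 2" "2 * k"] assms by simp
    also have "\<dots> = (z\<^sup>2 / 4) ^ k" unfolding power_mult power_divide by simp
    finally show ?thesis
      by (simp only: powr_add) (simp add: add_ac)
  qed
  then show ?thesis
    unfolding bessel_I_def bessel_series_def
    by (simp only: suminf_mult[OF summable_bessel_series])
qed

lemma bessel_K_nonint:
  assumes "\<nu> > 0" "\<nu> \<notin> \<int>" "z > 0"
  shows "pi / 2 * (bessel_I (- \<nu>) z - bessel_I \<nu> z) / sin (\<nu> * pi)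
     = (z / 2) powr (- \<nu>) * macdonald_integral \<nu> (z\<^sup>2 / 4) / 2"
proof -
  have x: "z\<^sup>2 / 4 > 0" using assms by simp
  have "z\<^sup>2 / 4 = (z / 2) powr 2" using assms by (simp add: powr_numeral power_divide)
  then have "(z\<^sup>2 / 4) powr \<nu> = (z / 2) powr \<nu> * (z / 2) powr \<nu>"
    by (simp only: powr_powr powr_add [symmetric]) simp
  then have p: "(z / 2) powr (- \<nu>) * (z\<^sup>2 / 4) powr \<nu> = (z / 2) powr \<nu>"
    using assms by (simp add: powr_minus)
  have "pi / 2 * (bessel_I (- \<nu>) z - bessel_I \<nu> z) / sin (\<nu> * pi) =
    pi / sin (pi * \<nu>) * ((z / 2) powr (- \<nu>) * bessel_series (1 - \<nu>) (z\<^sup>2 / 4)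
       - (z / 2) powr \<nu> * bessel_series (1 + \<nu>) (z\<^sup>2 / 4)) / 2"
    using assms by (simp add: bessel_I_eq_series mult.commute)
  also have "\<dots> = (z / 2) powr (- \<nu>) * macdonald_series \<nu> (z\<^sup>2 / 4) / 2"
    unfolding macdonald_series_def p[symmetric] by (simp add: algebra_simps)
  finally show ?thesis using macdonald_integral_eq_series[OF assms(1,2) x] by simp
qed

text \<open>At an integer the function \<open>K\<^sub>\<nu>\<close> is a limit over neighbouring orders, which are not integers;
  continuity of the integral in the order identifies the limit.\<close>

theorem bessel_K_eq_integral:
  assumes \<nu>: "\<nu> > 0" and z: "z > 0"
  shows "bessel_K \<nu> z = (z / 2) powr (- \<nu>) * macdonald_integral \<nu> (z\<^sup>2 / 4) / 2"
proof (cases "\<nu> \<in> \<int>")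
  case False
  then show ?thesis using bessel_K_nonint[OF \<nu> _ z] by (simp add: bessel_K_def Let_def)
next
  case True
  define K where "K \<mu> = pi / 2 * (bessel_I (- \<mu>) z - bessel_I \<mu> z) / sin (\<mu> * pi)" for \<mu>
  have "isCont (\<lambda>\<mu>. (z / 2) powr (- \<mu>) * macdonald_integral \<mu> (z\<^sup>2 / 4) / 2) \<nu>"
    using z by (intro continuous_intros isCont_macdonald_integral_order) auto
  then have *: "(\<lambda>\<mu>. (z / 2) powr (- \<mu>) * macdonald_integral \<mu> (z\<^sup>2 / 4) / 2) \<midarrow>\<nu>\<rightarrow>
      (z / 2) powr (- \<nu>) * macdonald_integral \<nu> (z\<^sup>2 / 4) / 2"
    by (simp add: isCont_def)
  obtain n where n: "\<nu> = of_int n" using True by (auto elim: Ints_cases)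
  have "\<forall>\<^sub>F \<mu> in at \<nu>. \<mu> \<in> {\<nu> - 1<..<\<nu> + 1} - {\<nu>}"
    by (intro eventually_at_in_open) auto
  then have "\<forall>\<^sub>F \<mu> in at \<nu>. (z / 2) powr (- \<mu>) * macdonald_integral \<mu> (z\<^sup>2 / 4) / 2 = K \<mu>"
  proof eventually_elim
    case (elim \<mu>)
    then have "\<mu> \<notin> \<int>" unfolding n by (auto elim!: Ints_cases)
    moreover have "\<mu> > 0" using elim \<nu> unfolding n by auto
    ultimately show ?case unfolding K_def using bessel_K_nonint[of \<mu> z] z by simp
  qed
  with * have "K \<midarrow>\<nu>\<rightarrow> (z / 2) powr (- \<nu>) * macdonald_integral \<nu> (z\<^sup>2 / 4) / 2"
    by (rule Lim_transform_eventually)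
  then have "Lim (at \<nu>) K = (z / 2) powr (- \<nu>) * macdonald_integral \<nu> (z\<^sup>2 / 4) / 2"
    by (intro tendsto_Lim) auto
  then show ?thesis using True by (simp add: bessel_K_def K_def[abs_def])
qed

section \<open>The heat kernel\<close>

text \<open>Translations and reflections of Lebesgue measure: the Green's function enters as \<open>g (u - v)\<close>.\<close>

lemma lborel_distr_reflect:
  fixes u :: "'a::euclidean_space"
  shows "distr lborel borel (\<lambda>v. u - v) = lborel"
  using lborel_affine[of "-1" u] by (simp add: density_1)

lemma lborel_distr_translate:
  fixes u :: "'a::euclidean_space"
  shows "distr lborel borel (\<lambda>v. v - u) = lborel"
  using lborel_affine[of 1 "- u"] by (simp add: density_1)

lemma integrable_lborel_reflect:
  fixes f :: "'a::euclidean_space \<Rightarrow> 'b::{banach, second_countable_topology}"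
  assumes "integrable lborel f"
  shows "integrable lborel (\<lambda>v. f (u - v))"
proof -
  have [measurable]: "f \<in> borel_measurable borel" using assms by (auto dest: borel_measurable_integrable)
  show ?thesis
    using assms by (subst (asm) lborel_distr_reflect[of u, symmetric]) (simp add: integrable_distr_eq)
qed

lemma AE_lborel_reflect:
  fixes P :: "'a::euclidean_space \<Rightarrow> bool"
  assumes "AE v in lborel. P v"
  shows "AE v in lborel. P (u - v)"
proof -
  have "AE v in distr lborel borel (\<lambda>v. u - v). P v"
    unfolding lborel_distr_reflect by (rule assms)
  then show ?thesis by (rule AE_distrD[rotated]) measurable
qed

lemma integral_lborel_translate:
  fixes f :: "'a::euclidean_space \<Rightarrow> 'b::{banach, second_countable_topology}"
  assumes [measurable]: "f \<in> borel_measurable borel"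
  shows "(LINT v|lborel. f (v - u)) = (LINT v|lborel. f v)"
  by (subst (2) lborel_distr_translate[of u, symmetric]) (simp add: integral_distr)

lemma integrable_lborel_translate:
  fixes f :: "'a::euclidean_space \<Rightarrow> 'b::{banach, second_countable_topology}"
  assumes "integrable lborel f"
  shows "integrable lborel (\<lambda>v. f (v - u))"
proof -
  have [measurable]: "f \<in> borel_measurable borel" using assms by (auto dest: borel_measurable_integrable)
  show ?thesis
    using assms by (subst (asm) lborel_distr_translate[of u, symmetric]) (simp add: integrable_distr_eq)
qed

definition heat_kernel :: "real \<Rightarrow> 'a::euclidean_space \<Rightarrow> real" where
  "heat_kernel s x = exp (- (norm x)\<^sup>2 / (2 * s)) / (2 * pi * s) powr (DIM('a) / 2)"

lemma heat_kernel_nonneg [simp]: "heat_kernel s x \<ge> 0"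
  by (simp add: heat_kernel_def)

lemma heat_kernel_minus [simp]: "heat_kernel s (- x) = heat_kernel s x"
  by (simp add: heat_kernel_def)

lemma borel_measurable_heat_kernel [measurable]:
  assumes [measurable]: "f \<in> borel_measurable M" "g \<in> borel_measurable M"
  shows "(\<lambda>x. heat_kernel (f x) (g x)) \<in> borel_measurable M"
  unfolding heat_kernel_def by measurable

lemma sum_Basis_inner_square:
  fixes x :: "'a::euclidean_space"
  shows "(\<Sum>b\<in>Basis. (x \<bullet> b)\<^sup>2) = (norm x)\<^sup>2"
  unfolding power2_norm_eq_inner by (subst euclidean_inner) (simp add: power2_eq_square)

text \<open>Everything about the kernel reduces to one dimension through this product.\<close>

lemma heat_kernel_eq_prod:
  fixes x :: "'a::euclidean_space"
  assumes s: "s > 0"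
  shows "heat_kernel s x = (\<Prod>b\<in>Basis. normal_density 0 (sqrt s) (x \<bullet> b))"
proof -
  have "(\<Prod>b\<in>Basis. normal_density 0 (sqrt s) (x \<bullet> b))
     = (\<Prod>b\<in>(Basis::'a set). 1 / sqrt (2 * pi * s)) * (\<Prod>b\<in>Basis. exp (- (x \<bullet> b)\<^sup>2 / (2 * s)))"
    unfolding prod.distrib [symmetric] using s by (simp add: normal_density_def)
  also have "(\<Prod>b\<in>Basis. exp (- (x \<bullet> b)\<^sup>2 / (2 * s))) = exp (- (norm x)\<^sup>2 / (2 * s))"
    by (simp add: exp_sum [symmetric] sum_divide_distrib [symmetric] sum_negf sum_Basis_inner_square)
  also have "(\<Prod>b\<in>(Basis::'a set). 1 / sqrt (2 * pi * s)) = 1 / (2 * pi * s) powr (DIM('a) / 2)"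
  proof -
    have "(2 * pi * s) powr (DIM('a) / 2) = ((2 * pi * s) powr (1 / 2)) powr (real DIM('a))"
      by (simp add: powr_powr)
    also have "\<dots> = sqrt (2 * pi * s) ^ DIM('a)"
      using s by (simp add: powr_half_sqrt powr_realpow)
    finally show ?thesis by (simp add: power_one_over)
  qed
  finally show ?thesis by (simp add: heat_kernel_def)
qed

lemma nn_integral_heat_kernel:
  assumes s: "s > 0"
  shows "(\<integral>\<^sup>+ x. ennreal (heat_kernel s (x::'a::euclidean_space)) \<partial>lborel) = 1"
proof -
  have "(\<integral>\<^sup>+ x. ennreal (heat_kernel s (x::'a)) \<partial>lborel)
    = (\<integral>\<^sup>+ x. (\<Prod>b\<in>Basis. ennreal (normal_density 0 (sqrt s) ((x::'a) \<bullet> b))) \<partial>lborel)"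
    by (simp add: heat_kernel_eq_prod[OF s] prod_ennreal)
  also have "\<dots> = (\<Prod>b\<in>(Basis::'a set). \<integral>\<^sup>+ x. ennreal (normal_density 0 (sqrt s) x) \<partial>lborel)"
    by (rule nn_integral_lborel_prod) auto
  also have "(\<integral>\<^sup>+ x. ennreal (normal_density 0 (sqrt s) x) \<partial>lborel) = 1"
    using s by (subst nn_integral_eq_integral) auto
  finally show ?thesis by simp
qed

lemma integrable_heat_kernel: "s > 0 \<Longrightarrow> integrable lborel (heat_kernel s :: 'a::euclidean_space \<Rightarrow> real)"
  and integral_heat_kernel: "s > 0 \<Longrightarrow> (LINT x|lborel. heat_kernel s (x::'a::euclidean_space)) = 1"
  using has_bochner_integral_nn_integral[of "heat_kernel s :: 'a \<Rightarrow> real" lborel 1] nn_integral_heat_kernel[of s]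
  by (auto simp: has_bochner_integral_iff)

lemma nn_integral_heat_kernel_convolution:
  fixes u u' :: "'a::euclidean_space"
  assumes s: "s > 0" and t: "t > 0"
  shows "(\<integral>\<^sup>+ v. ennreal (heat_kernel s (u - v)) * ennreal (heat_kernel t (u' - v)) \<partial>lborel)
     = ennreal (heat_kernel (s + t) (u - u'))"
proof -
  have one: "(\<integral>\<^sup>+ y. ennreal (normal_density 0 (sqrt s) (a - y)) * ennreal (normal_density 0 (sqrt t) (b - y)) \<partial>lborel)
     = ennreal (normal_density 0 (sqrt (s + t)) (a - b))" for a b :: real
  proof -
    have "(\<integral>\<^sup>+ y. ennreal (normal_density 0 (sqrt s) (a - y)) * ennreal (normal_density 0 (sqrt t) (b - y)) \<partial>lborel)
      = (\<integral>\<^sup>+ y. ennreal (normal_density 0 (sqrt s) (a - b - y)) * ennreal (normal_density 0 (sqrt t) (- y)) \<partial>lborel)"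
      by (subst nn_integral_real_affine[where t = b and c = 1]) (auto simp: algebra_simps)
    also have "\<dots> = (\<integral>\<^sup>+ y. ennreal (normal_density 0 (sqrt s) (a - b - y) * normal_density 0 (sqrt t) y) \<partial>lborel)"
      by (intro nn_integral_cong) (simp add: ennreal_mult'' normal_density_nonneg, simp add: normal_density_def)
    also have "\<dots> = ennreal (normal_density 0 (sqrt (s + t)) (a - b))"
      using fun_cong[OF conv_normal_density_zero_mean[of "sqrt s" "sqrt t"], of "a - b"] s t by simp
    finally show ?thesis .
  qed
  have "(\<integral>\<^sup>+ v. ennreal (heat_kernel s (u - v)) * ennreal (heat_kernel t (u' - v)) \<partial>lborel)
    = (\<integral>\<^sup>+ v. (\<Prod>b\<in>Basis. ennreal (normal_density 0 (sqrt s) (u \<bullet> b - v \<bullet> b))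
          * ennreal (normal_density 0 (sqrt t) (u' \<bullet> b - v \<bullet> b))) \<partial>lborel)"
    using s t by (simp add: heat_kernel_eq_prod prod_ennreal inner_diff_left prod.distrib)
  also have "\<dots> = (\<Prod>b\<in>Basis. \<integral>\<^sup>+ y. ennreal (normal_density 0 (sqrt s) (u \<bullet> b - y))
          * ennreal (normal_density 0 (sqrt t) (u' \<bullet> b - y)) \<partial>lborel)"
    by (subst nn_integral_lborel_prod) auto
  also have "\<dots> = ennreal (heat_kernel (s + t) (u - u'))"
    unfolding one using s t by (simp add: heat_kernel_eq_prod prod_ennreal inner_diff_left)
  finally show ?thesis .
qed

lemma integral_lborel_prod_complex:
  fixes f :: "'a::euclidean_space \<Rightarrow> real \<Rightarrow> complex"
  assumes "\<And>b. b \<in> Basis \<Longrightarrow> integrable lborel (f b)"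
  shows "(LINT x|lborel. (\<Prod>b\<in>Basis. f b (x \<bullet> b))) = (\<Prod>b\<in>Basis. LINT y|lborel. f b y)"
proof -
  interpret product_sigma_finite "\<lambda>_::'a. lborel :: real measure" by standard
  have [measurable]: "\<And>b. b \<in> Basis \<Longrightarrow> f b \<in> borel_measurable borel"
    using assms by (auto dest: borel_measurable_integrable)
  have "(LINT x|lborel. (\<Prod>b\<in>Basis. f b (x \<bullet> b)))
     = (LINT y|(\<Pi>\<^sub>M b\<in>Basis. lborel). (\<Prod>b\<in>Basis. f b ((\<Sum>c\<in>Basis. y c *\<^sub>R c) \<bullet> b)))"
    by (subst lborel_eq, subst integral_distr) auto
  also have "\<dots> = (LINT y|(\<Pi>\<^sub>M b\<in>(Basis::'a set). lborel). (\<Prod>b\<in>Basis. f b (y b)))"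
    by (intro Bochner_Integration.integral_cong refl prod.cong) simp
  also have "\<dots> = (\<Prod>b\<in>Basis. LINT y|lborel. f b y)"
    by (rule product_integral_prod) (use assms in auto)
  finally show ?thesis .
qed

text \<open>Rescaling to the standard normal characteristic function.\<close>

lemma integral_normal_density_exp:
  assumes s: "s > 0"
  shows "(LINT y|lborel. iexp (y * t) * complex_of_real (normal_density 0 (sqrt s) y))
    = exp (- complex_of_real (s * t\<^sup>2 / 2))"
proof -
  have "(LINT y|lborel. iexp (y * t) * complex_of_real (normal_density 0 (sqrt s) y))
     = \<bar>sqrt s\<bar> *\<^sub>R (LINT y|lborel. iexp ((0 + sqrt s * y) * t) * complex_of_real (normal_density 0 (sqrt s) (0 + sqrt s * y)))"
    using s by (subst lborel_integral_real_affine[where t = 0 and c = "sqrt s"]) auto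
  also have "\<dots> = (LINT y|lborel. \<bar>sqrt s\<bar> *\<^sub>R (iexp ((0 + sqrt s * y) * t) * complex_of_real (normal_density 0 (sqrt s) (0 + sqrt s * y))))"
    by simp
  also have "\<dots> = (LINT y|lborel. std_normal_density y *\<^sub>R iexp ((sqrt s * t) * y))"
  proof (intro Bochner_Integration.integral_cong refl)
    fix y
    have "\<bar>sqrt s\<bar> * normal_density 0 (sqrt s) (0 + sqrt s * y) = std_normal_density y"
      using s by (simp add: normal_density_def power_mult_distrib real_sqrt_mult field_simps)
    then show "\<bar>sqrt s\<bar> *\<^sub>R (iexp ((0 + sqrt s * y) * t) * complex_of_real (normal_density 0 (sqrt s) (0 + sqrt s * y)))
       = std_normal_density y *\<^sub>R iexp ((sqrt s * t) * y)"
      by (simp add: scaleR_conv_of_real mult_ac flip: of_real_mult)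
  qed
  also have "\<dots> = char std_normal_distribution (sqrt s * t)"
    unfolding char_def by (subst integral_density) auto
  also have "\<dots> = exp (- complex_of_real (s * t\<^sup>2 / 2))"
  proof -
    have "(sqrt s * t)\<^sup>2 = s * t\<^sup>2" using s by (simp add: power_mult_distrib)
    then show ?thesis unfolding char_std_normal_distribution by (simp flip: exp_of_real)
  qed
  finally show ?thesis .
qed

lemma heat_kernel_fourier:
  fixes \<omega> :: "'a::euclidean_space"
  assumes s: "s > 0"
  shows "(LINT x|lborel. iexp (x \<bullet> \<omega>) * complex_of_real (heat_kernel s x))
    = complex_of_real (exp (- s * (norm \<omega>)\<^sup>2 / 2))"
proof -
  let ?f = "\<lambda>b y. iexp (y * (\<omega> \<bullet> b)) * complex_of_real (normal_density 0 (sqrt s) y)"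
  have i: "integrable lborel (?f b)" for b :: 'a
  proof (rule Bochner_Integration.integrable_bound)
    show "integrable lborel (normal_density 0 (sqrt s))" using s by simp
  qed (auto simp: norm_mult)
  have "(LINT x|lborel. iexp (x \<bullet> \<omega>) * complex_of_real (heat_kernel s x))
     = (LINT x|lborel. (\<Prod>b\<in>Basis. ?f b (x \<bullet> b)))"
    using s by (simp add: heat_kernel_eq_prod prod.distrib exp_sum [symmetric] sum_distrib_left [symmetric]
        euclidean_inner[of _ \<omega>])
  also have "\<dots> = (\<Prod>b\<in>(Basis::'a set). exp (- complex_of_real (s * (\<omega> \<bullet> b)\<^sup>2 / 2)))"
    by (subst integral_lborel_prod_complex) (use i integral_normal_density_exp[OF s] in auto)
  also have "\<dots> = exp (- complex_of_real (s * (\<Sum>b\<in>(Basis::'a set). (\<omega> \<bullet> b)\<^sup>2) / 2))"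
    by (simp add: exp_sum [symmetric] sum_negf sum_divide_distrib [symmetric] sum_distrib_left [symmetric])
  also have "(\<Sum>b\<in>(Basis::'a set). (\<omega> \<bullet> b)\<^sup>2) = (norm \<omega>)\<^sup>2"
    by (rule sum_Basis_inner_square)
  finally show ?thesis by (simp flip: exp_of_real)
qed

lemma lborel_integral_affine:
  fixes f :: "'a::euclidean_space \<Rightarrow> 'b::{banach, second_countable_topology}"
  assumes "c \<noteq> 0" and [measurable]: "f \<in> borel_measurable borel"
  shows "(LINT x|lborel. f x) = \<bar>c\<bar> ^ DIM('a) *\<^sub>R (LINT x|lborel. f (t + c *\<^sub>R x))"
  using assms(1) by (subst lborel_affine[of c t]) (simp_all add: integral_density integral_distr)

lemma heat_kernel_scale:
  fixes x :: "'a::euclidean_space"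
  assumes "s > 0"
  shows "sqrt s ^ DIM('a) * heat_kernel s (sqrt s *\<^sub>R x) = heat_kernel 1 x"
proof -
  have "s powr (DIM('a) / 2) = (s powr (1 / 2)) powr (real DIM('a))"
    by (simp add: powr_powr)
  also have "\<dots> = sqrt s ^ DIM('a)"
    using assms by (simp add: powr_half_sqrt powr_realpow)
  finally have "sqrt s ^ DIM('a) = s powr (DIM('a) / 2)" by simp
  then show ?thesis
    using assms by (simp add: heat_kernel_def power_mult_distrib powr_mult)
qed

lemma integral_heat_kernel_rescale:
  fixes f :: "'a::euclidean_space \<Rightarrow> complex"
  assumes s: "s > 0" and [measurable]: "f \<in> borel_measurable borel"
  shows "(LINT a|lborel. f a * complex_of_real (heat_kernel s (a - v)))
     = (LINT y|lborel. f (v + sqrt s *\<^sub>R y) * complex_of_real (heat_kernel 1 y))"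
proof -
  have "(LINT a|lborel. f a * complex_of_real (heat_kernel s (a - v)))
    = \<bar>sqrt s\<bar> ^ DIM('a) *\<^sub>R (LINT y|lborel. f (v + sqrt s *\<^sub>R y) * complex_of_real (heat_kernel s (v + sqrt s *\<^sub>R y - v)))"
    using s by (intro lborel_integral_affine) auto
  also have "\<dots> = (LINT y|lborel. \<bar>sqrt s\<bar> ^ DIM('a) *\<^sub>R (f (v + sqrt s *\<^sub>R y) * complex_of_real (heat_kernel s (v + sqrt s *\<^sub>R y - v))))"
    by simp
  also have "\<dots> = (LINT y|lborel. f (v + sqrt s *\<^sub>R y) * complex_of_real (heat_kernel 1 y))"
    using s by (intro Bochner_Integration.integral_cong refl)
      (simp add: heat_kernel_scale[OF s, symmetric] scaleR_conv_of_real)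
  finally show ?thesis .
qed

text \<open>After rescaling, the kernel is fixed and the argument of \<open>f\<close> contracts to \<open>v\<close>, so dominated
  convergence applies.\<close>

lemma heat_kernel_approximate_identity:
  fixes f :: "'a::euclidean_space \<Rightarrow> complex"
  assumes [measurable]: "f \<in> borel_measurable borel" and bound: "\<And>x. norm (f x) \<le> C"
    and cont: "isCont f v"
    and s: "\<And>n. s n > 0" "s \<longlonglongrightarrow> 0"
  shows "(\<lambda>n. LINT a|lborel. f a * complex_of_real (heat_kernel (s n) (a - v))) \<longlonglongrightarrow> f v"
proof -
  have "(\<lambda>n. LINT y|lborel. f (v + sqrt (s n) *\<^sub>R y) * complex_of_real (heat_kernel 1 y))
    \<longlonglongrightarrow> (LINT y|lborel. f v * complex_of_real (heat_kernel 1 (y::'a)))"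
  proof (rule integral_dominated_convergence)
    show "integrable lborel (\<lambda>y::'a. C * heat_kernel 1 y)"
      by (intro integrable_mult_right integrable_heat_kernel) auto
    show "AE y in lborel. (\<lambda>n. f (v + sqrt (s n) *\<^sub>R y) * complex_of_real (heat_kernel 1 y))
       \<longlonglongrightarrow> f v * complex_of_real (heat_kernel 1 y)"
    proof (rule AE_I2)
      fix y :: 'a
      have "(\<lambda>n. v + sqrt (s n) *\<^sub>R y) \<longlonglongrightarrow> v + sqrt 0 *\<^sub>R y" by (intro tendsto_intros s)
      then have "(\<lambda>n. v + sqrt (s n) *\<^sub>R y) \<longlonglongrightarrow> v" by simp
      then show "(\<lambda>n. f (v + sqrt (s n) *\<^sub>R y) * complex_of_real (heat_kernel 1 y))
       \<longlonglongrightarrow> f v * complex_of_real (heat_kernel 1 y)"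
        by (intro tendsto_intros isCont_tendsto_compose[OF cont])
    qed
  qed (auto simp: norm_mult intro!: mult_right_mono bound)
  moreover have "(LINT y|lborel. f v * complex_of_real (heat_kernel 1 (y::'a))) = f v"
    by (simp add: integral_heat_kernel)
  ultimately show ?thesis
    using s by (simp only: integral_heat_kernel_rescale assms)
qed

section \<open>The Gamma law\<close>

definition gamma_density :: "real \<Rightarrow> real \<Rightarrow> real" where
  "gamma_density a t = indicator {0<..} t * (t powr (a - 1) * exp (- t)) / Gamma a"

definition gamma_law :: "real \<Rightarrow> real measure" where
  "gamma_law a = density lborel (\<lambda>t. ennreal (gamma_density a t))"

lemma gamma_density_nonneg [simp]: "a > 0 \<Longrightarrow> gamma_density a t \<ge> 0"
  using Gamma_real_pos[of a] by (simp add: gamma_density_def)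

lemma borel_measurable_gamma_density [measurable]: "gamma_density a \<in> borel_measurable borel"
  unfolding gamma_density_def[abs_def] by measurable

lemma sets_gamma_law [simp, measurable_cong]: "sets (gamma_law a) = sets borel"
  and space_gamma_law [simp]: "space (gamma_law a) = UNIV"
  by (simp_all add: gamma_law_def)

lemma has_bochner_integral_gamma_kernel:
  fixes a c :: real
  assumes a: "a > 0" and c: "c > 0"
  shows "has_bochner_integral lborel (\<lambda>t. indicator {0<..} t * (t powr (a - 1) * exp (- c * t))) (Gamma a * c powr (- a))"
proof -
  have "has_bochner_integral lborel (\<lambda>t. indicator {0<..} t *\<^sub>R (t powr (a - 1) * exp (- t))) (Gamma a)"
    using Gamma_integral_lborel[OF a]
    by (simp add: has_bochner_integral_iff set_integrable_def set_lebesgue_integral_def)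
  then have "has_bochner_integral lborel (\<lambda>t. indicator {0<..} (0 + c * t) *\<^sub>R ((0 + c * t) powr (a - 1) * exp (- (0 + c * t)))) (Gamma a /\<^sub>R \<bar>c\<bar>)"
    using c by (subst (asm) lborel_has_bochner_integral_real_affine_iff[where c = c and t = 0]) auto
  then have "has_bochner_integral lborel (\<lambda>t. c powr (1 - a) * (indicator {0<..} (0 + c * t) *\<^sub>R ((0 + c * t) powr (a - 1) * exp (- (0 + c * t))))) (c powr (1 - a) * (Gamma a /\<^sub>R \<bar>c\<bar>))"
    by (intro has_bochner_integral_mult_right) auto
  also have "(\<lambda>t. c powr (1 - a) * (indicator {0<..} (0 + c * t) *\<^sub>R ((0 + c * t) powr (a - 1) * exp (- (0 + c * t)))))
     = (\<lambda>t. indicator {0<..} t * (t powr (a - 1) * exp (- c * t)))"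
  proof
    fix t
    have "c powr (1 - a) * (c * t) powr (a - 1) = t powr (a - 1)" if "t > 0"
      using c that by (simp add: powr_mult powr_add [symmetric] mult.assoc [symmetric])
    then have "c powr (1 - a) * ((c * t) powr (a - 1) * E) = t powr (a - 1) * E" if "t > 0" for E
      using that by (metis mult.assoc)
    then show "c powr (1 - a) * (indicator {0<..} (0 + c * t) *\<^sub>R ((0 + c * t) powr (a - 1) * exp (- (0 + c * t))))
      = indicator {0<..} t * (t powr (a - 1) * exp (- c * t))"
      using c by (auto simp: indicator_def zero_less_mult_iff)
  qed
  also have "c powr (1 - a) * (Gamma a /\<^sub>R \<bar>c\<bar>) = Gamma a * c powr (- a)"
    using c by (simp add: powr_diff powr_minus field_simps)
  finally show ?thesis .
qed

lemma has_bochner_integral_gamma_law_power_exp: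
  assumes a: "a > 0" and c: "c > -1"
  shows "has_bochner_integral (gamma_law a) (\<lambda>t. t ^ k * exp (- c * t))
     (Gamma (a + real k) / Gamma a * (1 + c) powr (- (a + real k)))"
  unfolding gamma_law_def
proof (rule has_bochner_integral_density)
  have "has_bochner_integral lborel (\<lambda>t. 1 / Gamma a * (indicator {0<..} t * (t powr ((a + real k) - 1) * exp (- (1 + c) * t))))
     (1 / Gamma a * (Gamma (a + real k) * (1 + c) powr (- (a + real k))))"
    by (intro has_bochner_integral_mult_right has_bochner_integral_gamma_kernel) (use a c in auto)
  also have "(\<lambda>t. 1 / Gamma a * (indicator {0<..} t * (t powr ((a + real k) - 1) * exp (- (1 + c) * t))))
    = (\<lambda>t. gamma_density a t *\<^sub>R (t ^ k * exp (- c * t)))"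
  proof
    fix t
    have "t powr ((a + real k) - 1) = t powr (a - 1) * t ^ k" if "t > 0"
      using that by (simp add: powr_realpow [symmetric] powr_add [symmetric] algebra_simps)
    moreover have "exp (- (1 + c) * t) = exp (- t) * exp (- c * t)"
      by (simp add: exp_add [symmetric] algebra_simps)
    ultimately show "1 / Gamma a * (indicator {0<..} t * (t powr ((a + real k) - 1) * exp (- (1 + c) * t)))
      = gamma_density a t *\<^sub>R (t ^ k * exp (- c * t))"
      by (auto simp: gamma_density_def indicator_def)
  qed
  finally show "has_bochner_integral lborel (\<lambda>t. gamma_density a t *\<^sub>R (t ^ k * exp (- c * t)))
    (Gamma (a + real k) / Gamma a * (1 + c) powr (- (a + real k)))" by simp
qed (use a in auto)

lemma prob_space_gamma_law:
  assumes "a > 0" shows "prob_space (gamma_law a)"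
proof
  have "Gamma a \<noteq> 0" using assms by (metis Gamma_real_pos less_irrefl)
  then have "has_bochner_integral (gamma_law a) (\<lambda>t. 1) (1::real)"
    using has_bochner_integral_gamma_law_power_exp[OF assms, of 0 0] by simp
  then have "integrable (gamma_law a) (\<lambda>t. 1::real)" "(LINT t|gamma_law a. 1::real) = 1"
    by (auto simp: has_bochner_integral_iff)
  then have "(\<integral>\<^sup>+ t. ennreal 1 \<partial>gamma_law a) = ennreal 1"
    by (subst nn_integral_eq_integral) auto
  then show "emeasure (gamma_law a) (space (gamma_law a)) = 1" by simp
qed

lemma AE_gamma_law_pos: "AE t in gamma_law a. t > 0"
  unfolding gamma_law_def by (subst AE_density) (auto simp: gamma_density_def indicator_def)

lemma integrable_gamma_law_power:
  assumes "a > 0" shows "integrable (gamma_law a) (\<lambda>t. t ^ k)"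
  using has_bochner_integral_gamma_law_power_exp[OF assms, of 0 k] by (simp add: has_bochner_integral_iff)

text \<open>This is the identity that produces the symbol of the operator.\<close>

lemma gamma_law_laplace:
  assumes "a > 0" "y \<ge> 0"
  shows "(LINT t|gamma_law a. exp (- y * t)) = (1 + y) powr (- a)"
proof -
  have "Gamma a \<noteq> 0" using assms by (metis Gamma_real_pos less_irrefl)
  then show ?thesis
    using has_bochner_integral_gamma_law_power_exp[OF assms(1), of y 0] assms by (simp add: has_bochner_integral_iff)
qed

lemma nn_integral_gamma_law:
  assumes [measurable]: "f \<in> borel_measurable borel"
  shows "(\<integral>\<^sup>+ t. f t \<partial>gamma_law a) = (\<integral>\<^sup>+ t. ennreal (gamma_density a t) * f t \<partial>lborel)"
  unfolding gamma_law_def by (simp add: nn_integral_density)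

text \<open>The substitution \<open>s = u y\<close> leaves the Beta integral.\<close>

lemma gamma_density_convolution:
  assumes a: "a > 0" and b: "b > 0"
  shows "(\<integral>\<^sup>+ s. ennreal (gamma_density a s) * ennreal (gamma_density b (u - s)) \<partial>lborel) = ennreal (gamma_density (a + b) u)"
proof (cases "u > 0")
  case False
  have "gamma_density a s * gamma_density b (u - s) = 0" for s
    using False by (auto simp: gamma_density_def indicator_def)
  then have "ennreal (gamma_density a s) * ennreal (gamma_density b (u - s)) = 0" for s
    using a by (metis ennreal_0 ennreal_mult' gamma_density_nonneg)
  then have "(\<integral>\<^sup>+ s. ennreal (gamma_density a s) * ennreal (gamma_density b (u - s)) \<partial>lborel) = (\<integral>\<^sup>+ s. 0 \<partial>(lborel :: real measure))"
    by (intro nn_integral_cong)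
  moreover have "gamma_density (a + b) u = 0" using False by (simp add: gamma_density_def)
  ultimately show ?thesis by simp
next
  case True
  have G: "Gamma a > 0" "Gamma b > 0" "Gamma (a + b) > 0" using a b Gamma_real_pos by auto
  define B where "B y = indicator {0..1} y * (y powr (a - 1) * (1 - y) powr (b - 1))" for y :: real
  have B: "(\<integral>\<^sup>+ y. ennreal (B y) \<partial>lborel) = ennreal (Beta a b)"
    using nn_integral_has_integral_lebesgue[OF _ has_integral_Beta_real[OF a b]] by (simp add: B_def)
  have "(\<integral>\<^sup>+ s. ennreal (gamma_density a s) * ennreal (gamma_density b (u - s)) \<partial>lborel)
     = ennreal \<bar>u\<bar> * (\<integral>\<^sup>+ y. ennreal (gamma_density a (0 + u * y)) * ennreal (gamma_density b (u - (0 + u * y))) \<partial>lborel)"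
    using True by (intro nn_integral_real_affine) auto
  also have "\<dots> = ennreal u * (\<integral>\<^sup>+ y. ennreal (u powr (a + b - 2) * exp (- u) / (Gamma a * Gamma b)) * ennreal (B y) \<partial>lborel)"
  proof -
    have "AE y in lborel. ennreal (gamma_density a (0 + u * y)) * ennreal (gamma_density b (u - (0 + u * y)))
       = ennreal (u powr (a + b - 2) * exp (- u) / (Gamma a * Gamma b)) * ennreal (B y)"
      using AE_lborel_singleton[of 0] AE_lborel_singleton[of 1]
    proof eventually_elim
      case (elim y)
      have "gamma_density a (u * y) * gamma_density b (u - u * y)
         = u powr (a + b - 2) * exp (- u) / (Gamma a * Gamma b) * B y"
      proof (cases "0 < y \<and> y < 1")
        case True
        have uy: "u - u * y = u * (1 - y)" by (simp add: algebra_simps)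
        have "u powr (a + b - 2) = u powr (a - 1) * u powr (b - 1)"
          by (simp add: powr_add [symmetric])
        moreover have "exp (- u) = exp (- (u * y)) * exp (- (u * (1 - y)))"
          by (simp add: exp_add [symmetric] algebra_simps)
        ultimately show ?thesis
          using True \<open>u > 0\<close> by (simp add: uy gamma_density_def B_def powr_mult)
      next
        case False
        then have "y < 0 \<or> y > 1" using elim by auto
        moreover have "u - u * y = u * (1 - y)" by (simp add: algebra_simps)
        ultimately show ?thesis
          using \<open>u > 0\<close> by (auto simp: gamma_density_def B_def indicator_def zero_less_mult_iff)
      qed
      then show ?case
        using G a b by (simp add: ennreal_mult' [symmetric])
    qed
    then show ?thesis using True by (simp add: nn_integral_cong_AE)
  qed
  also have "\<dots> = ennreal (u * (u powr (a + b - 2) * exp (- u) / (Gamma a * Gamma b) * Beta a b))"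
  proof -
    have [measurable]: "B \<in> borel_measurable borel" unfolding B_def[abs_def] by measurable
    show ?thesis using True G by (subst nn_integral_cmult) (simp_all add: B ennreal_mult' [symmetric])
  qed
  also have "u * (u powr (a + b - 2) * exp (- u) / (Gamma a * Gamma b) * Beta a b) = gamma_density (a + b) u"
  proof -
    have "u * u powr (a + b - 2) = u powr (a + b - 1)"
      using True powr_add[of u 1 "a + b - 2"] by simp
    then show ?thesis using True G by (simp add: gamma_density_def Beta_def)
  qed
  finally show ?thesis .
qed

lemma gamma_law_convolution:
  fixes f :: "real \<Rightarrow> ennreal"
  assumes a: "a > 0" and b: "b > 0" and [measurable]: "f \<in> borel_measurable borel"
  shows "(\<integral>\<^sup>+ s. (\<integral>\<^sup>+ t. f (s + t) \<partial>gamma_law b) \<partial>gamma_law a) = (\<integral>\<^sup>+ r. f r \<partial>gamma_law (a + b))"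
proof -
  have "(\<integral>\<^sup>+ s. (\<integral>\<^sup>+ t. f (s + t) \<partial>gamma_law b) \<partial>gamma_law a)
     = (\<integral>\<^sup>+ s. ennreal (gamma_density a s) * (\<integral>\<^sup>+ t. ennreal (gamma_density b t) * f (s + t) \<partial>lborel) \<partial>lborel)"
    by (simp add: nn_integral_gamma_law)
  also have "\<dots> = (\<integral>\<^sup>+ s. (\<integral>\<^sup>+ u. ennreal (gamma_density a s) * ennreal (gamma_density b (u - s)) * f u \<partial>lborel) \<partial>lborel)"
  proof (rule nn_integral_cong)
    fix s :: real
    have "(\<integral>\<^sup>+ t. ennreal (gamma_density b t) * f (s + t) \<partial>lborel)
      = (\<integral>\<^sup>+ u. ennreal (gamma_density b (u - s)) * f u \<partial>lborel)"
      by (subst nn_integral_real_affine[where c = 1 and t = "- s"]) (auto simp: algebra_simps)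
    then show "ennreal (gamma_density a s) * (\<integral>\<^sup>+ t. ennreal (gamma_density b t) * f (s + t) \<partial>lborel)
       = (\<integral>\<^sup>+ u. ennreal (gamma_density a s) * ennreal (gamma_density b (u - s)) * f u \<partial>lborel)"
      by (simp add: nn_integral_cmult [symmetric] mult.assoc)
  qed
  also have "\<dots> = (\<integral>\<^sup>+ u. (\<integral>\<^sup>+ s. ennreal (gamma_density a s) * ennreal (gamma_density b (u - s)) * f u \<partial>lborel) \<partial>lborel)"
    by (rule lborel_pair.Fubini') measurable
  also have "\<dots> = (\<integral>\<^sup>+ u. ennreal (gamma_density (a + b) u) * f u \<partial>lborel)"
    by (simp add: nn_integral_multc gamma_density_convolution[OF a b])
  also have "\<dots> = (\<integral>\<^sup>+ r. f r \<partial>gamma_law (a + b))"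
    by (simp add: nn_integral_gamma_law)
  finally show ?thesis .
qed

section \<open>Mixtures of heat kernels\<close>

definition heat_mix :: "real measure \<Rightarrow> 'a::euclidean_space \<Rightarrow> real" where
  "heat_mix Q x = (LINT s|Q. heat_kernel s x)"

locale scale_law = prob_space Q for Q :: "real measure" +
  assumes sets_Q [simp, measurable_cong]: "sets Q = sets borel"
    and AE_pos: "AE s in Q. 0 < s"
begin

lemma space_Q [simp]: "space Q = UNIV"
  using sets_eq_imp_space_eq[OF sets_Q] by simp

lemma measurable_heat_mix [measurable]: "heat_mix Q \<in> borel_measurable borel"
  unfolding heat_mix_def[abs_def] by measurable

lemma heat_mix_nonneg [simp]: "heat_mix Q x \<ge> 0"
  unfolding heat_mix_def by simp

lemma nn_integral_swap:
  assumes [measurable]: "(\<lambda>(s, x). f s x) \<in> borel_measurable (Q \<Otimes>\<^sub>M (lborel :: 'a::euclidean_space measure))"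
  shows "(\<integral>\<^sup>+ x. (\<integral>\<^sup>+ s. f s x \<partial>Q) \<partial>lborel) = (\<integral>\<^sup>+ s. (\<integral>\<^sup>+ (x::'a). f s x \<partial>lborel) \<partial>Q)"
proof -
  interpret pair_sigma_finite Q "lborel :: 'a measure" by standard
  show ?thesis using Fubini[of "\<lambda>(s, x). f s x"] by simp
qed

lemma integrable_pair_heat_kernel:
  "integrable (Q \<Otimes>\<^sub>M lborel) (\<lambda>(s, x). heat_kernel s (x::'a::euclidean_space))"
proof (rule integrableI_bounded)
  have "(\<integral>\<^sup>+ z. ennreal (norm (case z of (s, x) \<Rightarrow> heat_kernel s (x::'a))) \<partial>(Q \<Otimes>\<^sub>M lborel))
     = (\<integral>\<^sup>+ s. (\<integral>\<^sup>+ x. ennreal (heat_kernel s (x::'a)) \<partial>lborel) \<partial>Q)"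
    by (subst lborel.nn_integral_fst [symmetric]) auto
  also have "\<dots> = (\<integral>\<^sup>+ s. 1 \<partial>Q)"
    using AE_pos by (intro nn_integral_cong_AE) (auto simp: nn_integral_heat_kernel)
  also have "\<dots> < \<infinity>" using emeasure_space_1 by simp
  finally show "(\<integral>\<^sup>+ z. ennreal (norm (case z of (s, x) \<Rightarrow> heat_kernel s (x::'a))) \<partial>(Q \<Otimes>\<^sub>M lborel)) < \<infinity>" .
qed measurable

lemma AE_integrable_heat_kernel: "AE x in lborel. integrable Q (\<lambda>s. heat_kernel s (x::'a::euclidean_space))"
proof -
  interpret pair_sigma_finite Q "lborel :: 'a measure" by standard
  show ?thesis by (rule AE_integrable_snd[OF integrable_pair_heat_kernel])
qed

text \<open>If the mixing law charges small scales, the integral may diverge at the origin, where its value is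
  then zero by convention; hence the restriction to almost every point.\<close>

lemma AE_ennreal_heat_mix:
  "AE x in lborel. ennreal (heat_mix Q x) = (\<integral>\<^sup>+ s. ennreal (heat_kernel s (x::'a::euclidean_space)) \<partial>Q)"
  using AE_integrable_heat_kernel
  by eventually_elim (simp add: heat_mix_def nn_integral_eq_integral)

lemma integrable_heat_mix: "integrable lborel (heat_mix Q :: 'a::euclidean_space \<Rightarrow> real)"
proof -
  interpret pair_sigma_finite Q "lborel :: 'a measure" by standard
  show ?thesis unfolding heat_mix_def[abs_def] by (rule integrable_snd[OF integrable_pair_heat_kernel])
qed

lemma heat_mix_fourier:
  fixes \<omega> :: "'a::euclidean_space"
  shows "(LINT x|lborel. iexp (x \<bullet> \<omega>) * complex_of_real (heat_mix Q x))
    = complex_of_real (LINT s|Q. exp (- s * (norm \<omega>)\<^sup>2 / 2))"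
proof -
  interpret P: pair_sigma_finite Q "lborel :: 'a measure" by standard
  have "integrable (Q \<Otimes>\<^sub>M (lborel :: 'a measure)) (\<lambda>(s, x). iexp (x \<bullet> \<omega>) * complex_of_real (heat_kernel s x))"
    by (rule Bochner_Integration.integrable_bound[OF integrable_pair_heat_kernel]) (auto simp: norm_mult)
  from P.Fubini_integral[OF this]
  have "(LINT x|lborel. (LINT s|Q. iexp (x \<bullet> \<omega>) * complex_of_real (heat_kernel s x)))
     = (LINT s|Q. (LINT x|lborel. iexp (x \<bullet> \<omega>) * complex_of_real (heat_kernel s x)))" .
  also have "\<dots> = (LINT s|Q. complex_of_real (exp (- s * (norm \<omega>)\<^sup>2 / 2)))"
    using AE_pos by (intro integral_cong_AE) (auto simp: heat_kernel_fourier)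
  finally show ?thesis by (simp add: heat_mix_def)
qed

lemma heat_mix_inv_fourier:
  fixes a \<omega> :: "'a::euclidean_space"
  shows "inv_fourier (\<lambda>x. complex_of_real (heat_mix Q (x - a))) \<omega>
    = iexp (\<omega> \<bullet> a) * complex_of_real (LINT s|Q. exp (- s * (norm \<omega>)\<^sup>2 / 2))
      / complex_of_real ((2 * pi) ^ DIM('a))"
proof -
  have "(LINT x|lborel. iexp (\<omega> \<bullet> x) * complex_of_real (heat_mix Q (x - a)))
     = (LINT x|lborel. (\<lambda>y. iexp (\<omega> \<bullet> a) * (iexp (y \<bullet> \<omega>) * complex_of_real (heat_mix Q y))) (x - a))"
    by (intro Bochner_Integration.integral_cong refl)
      (simp add: exp_add [symmetric] inner_diff_left inner_commute mult.assoc [symmetric] algebra_simps)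
  also have "\<dots> = (LINT y|lborel. iexp (\<omega> \<bullet> a) * (iexp (y \<bullet> \<omega>) * complex_of_real (heat_mix Q y)))"
    by (rule integral_lborel_translate) measurable
  also have "\<dots> = iexp (\<omega> \<bullet> a) * complex_of_real (LINT s|Q. exp (- s * (norm \<omega>)\<^sup>2 / 2))"
    by (simp add: heat_mix_fourier)
  finally show ?thesis by (simp add: inv_fourier_def)
qed

text \<open>The semigroup property of the heat kernel, averaged over both scales.\<close>

lemma nn_integral_heat_mix_convolution:
  fixes u u' :: "'a::euclidean_space"
  assumes "scale_law R"
  shows "(\<integral>\<^sup>+ v. ennreal (heat_mix Q (u - v)) * ennreal (heat_mix R (u' - v)) \<partial>lborel)
     = (\<integral>\<^sup>+ s. (\<integral>\<^sup>+ t. ennreal (heat_kernel (s + t) (u - u')) \<partial>R) \<partial>Q)"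
proof -
  interpret R: scale_law R by fact
  have "(\<integral>\<^sup>+ v. ennreal (heat_mix Q (u - v)) * ennreal (heat_mix R (u' - v)) \<partial>lborel)
    = (\<integral>\<^sup>+ v. (\<integral>\<^sup>+ s. ennreal (heat_kernel s (u - v)) \<partial>Q) * (\<integral>\<^sup>+ t. ennreal (heat_kernel t (u' - v)) \<partial>R) \<partial>lborel)"
    using AE_lborel_reflect[OF AE_ennreal_heat_mix, of u] AE_lborel_reflect[OF R.AE_ennreal_heat_mix, of u']
    by (intro nn_integral_cong_AE, eventually_elim) simp
  also have "\<dots> = (\<integral>\<^sup>+ v. (\<integral>\<^sup>+ s. (\<integral>\<^sup>+ t. ennreal (heat_kernel s (u - v)) * ennreal (heat_kernel t (u' - v)) \<partial>R) \<partial>Q) \<partial>lborel)"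
    by (simp add: nn_integral_cmult nn_integral_multc)
  also have "\<dots> = (\<integral>\<^sup>+ s. (\<integral>\<^sup>+ v. (\<integral>\<^sup>+ t. ennreal (heat_kernel s (u - v)) * ennreal (heat_kernel t (u' - v)) \<partial>R) \<partial>lborel) \<partial>Q)"
    by (rule nn_integral_swap) measurable
  also have "\<dots> = (\<integral>\<^sup>+ s. (\<integral>\<^sup>+ t. (\<integral>\<^sup>+ v. ennreal (heat_kernel s (u - v)) * ennreal (heat_kernel t (u' - v)) \<partial>lborel) \<partial>R) \<partial>Q)"
    by (intro nn_integral_cong R.nn_integral_swap) measurable
  also have "\<dots> = (\<integral>\<^sup>+ s. (\<integral>\<^sup>+ t. ennreal (heat_kernel (s + t) (u - u')) \<partial>R) \<partial>Q)"
    using AE_pos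
  proof (intro nn_integral_cong_AE, eventually_elim)
    case (elim s)
    show ?case
      using R.AE_pos elim by (intro nn_integral_cong_AE) (auto simp: nn_integral_heat_kernel_convolution)
  qed
  finally show ?thesis .
qed

end

lemma scale_law_return:
  assumes "s > 0" shows "scale_law (return borel s)"
proof -
  interpret prob_space "return borel s :: real measure" by (rule prob_space_return) simp
  show ?thesis by standard (use assms in \<open>auto simp: AE_return\<close>)
qed

lemma heat_mix_return: "heat_mix (return borel s) x = heat_kernel s x"
  unfolding heat_mix_def by (subst integral_return) auto

lemma scale_law_gamma_affine:
  assumes "a > 0" "s \<ge> 0" "c > 0"
  shows "scale_law (distr (gamma_law a) borel (\<lambda>t. s + c * t))"
proof -
  interpret G: prob_space "gamma_law a" by (rule prob_space_gamma_law) fact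
  interpret prob_space "distr (gamma_law a) borel (\<lambda>t. s + c * t)"
    by (rule G.prob_space_distr) measurable
  have "AE t in gamma_law a. 0 < s + c * t"
    using AE_gamma_law_pos by eventually_elim (use assms in \<open>auto intro: add_nonneg_pos\<close>)
  then show ?thesis by unfold_locales (auto simp: AE_distr_iff)
qed

section \<open>Mixtures with large scales are Schwartz functions\<close>

text \<open>A family of radial profiles \<open>m k\<close>, centred at \<open>a\<close>, closed under addition and under multiplication
  by affine functions. Allowing the constant term \<open>c\<close> covers scalar multiples as well.\<close>

inductive heat_class :: "(nat \<Rightarrow> 'a::euclidean_space \<Rightarrow> real) \<Rightarrow> 'a \<Rightarrow> ('a \<Rightarrow> complex) \<Rightarrow> bool"
  for m :: "nat \<Rightarrow> 'a \<Rightarrow> real" and a :: 'a where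
  moment: "heat_class m a (\<lambda>x. complex_of_real (m k (x - a)))"
| affine: "heat_class m a f \<Longrightarrow> heat_class m a (\<lambda>x. complex_of_real (c + (x - a) \<bullet> b) * f x)"
| add: "heat_class m a f \<Longrightarrow> heat_class m a g \<Longrightarrow> heat_class m a (\<lambda>x. f x + g x)"

text \<open>The class is closed under partial derivatives because \<open>m k\<close> differentiates to
  \<open>- x\<close> times \<open>m (k + 1)\<close>.\<close>

lemma heat_class_derivative:
  fixes m :: "nat \<Rightarrow> 'a::euclidean_space \<Rightarrow> real"
  assumes m: "\<And>k x. (m k has_derivative (\<lambda>h. - (x \<bullet> h) * m (Suc k) x)) (at x)"
    and f: "heat_class m a f"
  shows "\<exists>D. (\<forall>b. heat_class m a (D b)) \<and>
    (\<forall>x. (f has_derivative (\<lambda>h. \<Sum>b\<in>Basis. complex_of_real (h \<bullet> b) * D b x)) (at x))"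
  using f
proof induction
  case (moment k)
  let ?D = "\<lambda>b x. complex_of_real (0 + (x - a) \<bullet> (- b)) * complex_of_real (m (Suc k) (x - a))"
  have "((\<lambda>x. complex_of_real (m k (x - a))) has_derivative
     (\<lambda>h. \<Sum>b\<in>Basis. complex_of_real (h \<bullet> b) * ?D b x)) (at x)" for x
  proof -
    have "((\<lambda>x. x - a) has_derivative (\<lambda>h. h)) (at x)" by (auto intro!: derivative_eq_intros)
    from has_derivative_compose[OF this m]
    have "((\<lambda>x. m k (x - a)) has_derivative (\<lambda>h. - ((x - a) \<bullet> h) * m (Suc k) (x - a))) (at x)" .
    then have "((\<lambda>x. complex_of_real (m k (x - a))) has_derivative
        (\<lambda>h. complex_of_real (- ((x - a) \<bullet> h) * m (Suc k) (x - a)))) (at x)"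
      by (rule has_derivative_of_real)
    moreover have "complex_of_real (- ((x - a) \<bullet> h) * m (Suc k) (x - a))
       = (\<Sum>b\<in>Basis. complex_of_real (h \<bullet> b) * ?D b x)" for h
    proof -
      have "- ((x - a) \<bullet> h) * M = (\<Sum>b\<in>Basis. (h \<bullet> b) * ((0 + (x - a) \<bullet> (- b)) * M))" for M
        unfolding euclidean_inner[of "x - a" h] sum_negf [symmetric] sum_distrib_right
        by (intro sum.cong) auto
      then show ?thesis by (simp only: of_real_sum of_real_mult)
    qed
    ultimately show ?thesis by (simp only:)
  qed
  moreover have "heat_class m a (?D b)" for b
    by (rule heat_class.affine[OF heat_class.moment[of m a "Suc k"]])
  ultimately show ?case by (intro exI[of _ ?D] conjI allI)
next
  case (affine f r c)
  then obtain D where D: "\<And>b. heat_class m a (D b)"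
    "\<And>x. (f has_derivative (\<lambda>h. \<Sum>b\<in>Basis. complex_of_real (h \<bullet> b) * D b x)) (at x)" by blast
  let ?p = "\<lambda>x. complex_of_real (r + (x - a) \<bullet> c)"
  let ?D = "\<lambda>b x. complex_of_real ((b \<bullet> c) + (x - a) \<bullet> 0) * f x + ?p x * D b x"
  have "((\<lambda>x. ?p x * f x) has_derivative (\<lambda>h. \<Sum>b\<in>Basis. complex_of_real (h \<bullet> b) * ?D b x)) (at x)" for x
  proof -
    have "(?p has_derivative (\<lambda>h. complex_of_real (h \<bullet> c))) (at x)"
      by (auto intro!: derivative_eq_intros has_derivative_of_real)
    from has_derivative_mult[OF this D(2)]
    have "((\<lambda>x. ?p x * f x) has_derivative
      (\<lambda>h. ?p x * (\<Sum>b\<in>Basis. complex_of_real (h \<bullet> b) * D b x) + complex_of_real (h \<bullet> c) * f x)) (at x)" .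
    moreover have "?p x * (\<Sum>b\<in>Basis. complex_of_real (h \<bullet> b) * D b x) + complex_of_real (h \<bullet> c) * f x
       = (\<Sum>b\<in>Basis. complex_of_real (h \<bullet> b) * ?D b x)" for h
    proof -
      have "h \<bullet> c = (\<Sum>b\<in>Basis. (h \<bullet> b) * (b \<bullet> c))"
        by (subst euclidean_inner) (simp add: inner_commute)
      then have "complex_of_real (h \<bullet> c) = (\<Sum>b\<in>Basis. complex_of_real (h \<bullet> b) * complex_of_real (b \<bullet> c))" by simp
      then show ?thesis
        by (simp only:) (simp add: sum_distrib_left sum_distrib_right sum.distrib [symmetric] algebra_simps)
    qed
    ultimately show ?thesis by simp
  qed
  moreover have "heat_class m a (?D b)" for b
    by (rule heat_class.add[OF heat_class.affine[OF affine.hyps] heat_class.affine[OF D(1)]])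
  ultimately show ?case by (intro exI[of _ ?D] conjI allI)
next
  case (add f g)
  from add.IH(1) obtain D where D: "\<And>b. heat_class m a (D b)"
    "\<And>x. (f has_derivative (\<lambda>h. \<Sum>b\<in>Basis. complex_of_real (h \<bullet> b) * D b x)) (at x)" by blast
  from add.IH(2) obtain E where E: "\<And>b. heat_class m a (E b)"
    "\<And>x. (g has_derivative (\<lambda>h. \<Sum>b\<in>Basis. complex_of_real (h \<bullet> b) * E b x)) (at x)" by blast
  have "((\<lambda>x. f x + g x) has_derivative (\<lambda>h. \<Sum>b\<in>Basis. complex_of_real (h \<bullet> b) * (D b x + E b x))) (at x)" for x
    using has_derivative_add[OF D(2) E(2)] by (simp add: distrib_left sum.distrib)
  moreover have "heat_class m a (\<lambda>x. D b x + E b x)" for b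
    by (rule heat_class.add[OF D(1) E(1)])
  ultimately show ?case by (intro exI[of _ "\<lambda>b x. D b x + E b x"] conjI allI)
qed

lemma heat_class_bounded:
  fixes m :: "nat \<Rightarrow> 'a::euclidean_space \<Rightarrow> real"
  assumes m: "\<And>k n. \<exists>C. \<forall>x. norm x ^ n * \<bar>m k x\<bar> \<le> C"
    and f: "heat_class m a f"
  shows "\<exists>C. \<forall>x. norm (x - a) ^ n * norm (f x) \<le> C"
  using f
proof (induction arbitrary: n)
  case (moment k)
  obtain C where "\<And>x. norm x ^ n * \<bar>m k x\<bar> \<le> C" using m by blast
  then show ?case by auto
next
  case (affine f c b)
  from affine.IH obtain C where C: "\<And>x. norm (x - a) ^ Suc n * norm (f x) \<le> C" by blast
  from affine.IH obtain E where E: "\<And>x. norm (x - a) ^ n * norm (f x) \<le> E" by blast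
  have "norm (x - a) ^ n * norm (complex_of_real (c + (x - a) \<bullet> b) * f x) \<le> \<bar>c\<bar> * E + norm b * C" for x
  proof -
    have "\<bar>c + (x - a) \<bullet> b\<bar> \<le> \<bar>c\<bar> + norm (x - a) * norm b"
      using Cauchy_Schwarz_ineq2[of "x - a" b] by linarith
    then have "norm (x - a) ^ n * norm (complex_of_real (c + (x - a) \<bullet> b) * f x)
      \<le> norm (x - a) ^ n * ((\<bar>c\<bar> + norm (x - a) * norm b) * norm (f x))"
      unfolding norm_mult norm_of_real by (intro mult_left_mono mult_right_mono) auto
    also have "\<dots> = \<bar>c\<bar> * (norm (x - a) ^ n * norm (f x)) + norm b * (norm (x - a) ^ Suc n * norm (f x))"
      by (simp add: algebra_simps)
    also have "\<dots> \<le> \<bar>c\<bar> * E + norm b * C" by (intro add_mono mult_left_mono C E) auto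
    finally show ?thesis .
  qed
  then show ?case by blast
next
  case (add f g)
  from add.IH(1) obtain C where C1: "\<And>x. norm (x - a) ^ n * norm (f x) \<le> C" by blast
  from add.IH(2) obtain E where C2: "\<And>x. norm (x - a) ^ n * norm (g x) \<le> E" by blast
  have "norm (x - a) ^ n * norm (f x + g x) \<le> C + E" for x
  proof -
    have "norm (x - a) ^ n * norm (f x + g x) \<le> norm (x - a) ^ n * (norm (f x) + norm (g x))"
      by (intro mult_left_mono norm_triangle_ineq) auto
    also have "\<dots> \<le> C + E" using C1[of x] C2[of x] by (simp add: distrib_left)
    finally show ?thesis .
  qed
  then show ?case by blast
qed

lemma heat_class_schwartz:
  fixes m :: "nat \<Rightarrow> 'a::euclidean_space \<Rightarrow> real"
  assumes m: "\<And>k x. (m k has_derivative (\<lambda>h. - (x \<bullet> h) * m (Suc k) x)) (at x)"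
    and bdd: "\<And>k n. \<exists>C. \<forall>x. norm x ^ n * \<bar>m k x\<bar> \<le> C"
    and f: "heat_class m a f"
  shows "schwartz f"
proof -
  have cls: "heat_class m a (iter_partial bs f)" if "bs \<in> lists Basis" for bs
    using that
  proof (induction bs)
    case Nil
    then show ?case using f by simp
  next
    case (Cons b bs)
    then have "heat_class m a (iter_partial bs f)" by simp
    then obtain D where D: "\<And>b. heat_class m a (D b)"
      "\<And>x. (iter_partial bs f has_derivative (\<lambda>h. \<Sum>b\<in>Basis. complex_of_real (h \<bullet> b) * D b x)) (at x)"
      using heat_class_derivative[where m = m and a = a, OF m] by blast
    have b: "b \<in> Basis" using Cons by simp
    have "frechet_derivative (iter_partial bs f) (at x) b = D b x" for x
    proof -
      have "frechet_derivative (iter_partial bs f) (at x) b = (\<Sum>c\<in>Basis. complex_of_real (b \<bullet> c) * D c x)"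
        using frechet_derivative_at[OF D(2)] by metis
      also have "\<dots> = (\<Sum>c\<in>Basis. if c = b then D c x else 0)"
        using b by (intro sum.cong) (auto simp: inner_Basis)
      finally show ?thesis using b by simp
    qed
    then show ?case using D(1) by simp
  qed
  show ?thesis
    unfolding schwartz_def
  proof (intro ballI conjI allI)
    fix bs :: "'a list" and x assume bs: "bs \<in> lists Basis"
    show "iter_partial bs f differentiable at x"
      using heat_class_derivative[where m = m and a = a, OF m cls[OF bs]] unfolding differentiable_def by blast
  next
    fix bs :: "'a list" and k assume bs: "bs \<in> lists Basis"
    obtain C where C: "\<And>x. norm (x - a) ^ k * norm (iter_partial bs f x) \<le> C"
      using heat_class_bounded[OF bdd cls[OF bs]] by blast
    obtain E where E: "\<And>x. norm (iter_partial bs f x) \<le> E"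
      using heat_class_bounded[OF bdd cls[OF bs], of 0] by auto
    have "norm x ^ k * norm (iter_partial bs f x) \<le> 2 ^ k * (C + norm a ^ k * E)" for x
    proof -
      have "norm x \<le> norm (x - a) + norm a" by (metis diff_add_cancel norm_triangle_ineq)
      also have "\<dots> \<le> 2 * max (norm (x - a)) (norm a)" by simp
      finally have "norm x ^ k \<le> (2 * max (norm (x - a)) (norm a)) ^ k" by (intro power_mono) auto
      also have "\<dots> \<le> 2 ^ k * (norm (x - a) ^ k + norm a ^ k)"
        by (auto simp: power_mult_distrib max_def)
      finally have "norm x ^ k * norm (iter_partial bs f x)
        \<le> 2 ^ k * (norm (x - a) ^ k + norm a ^ k) * norm (iter_partial bs f x)"
        by (intro mult_right_mono) auto
      also have "\<dots> = 2 ^ k * (norm (x - a) ^ k * norm (iter_partial bs f x) + norm a ^ k * norm (iter_partial bs f x))"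
        by (simp add: algebra_simps)
      also have "\<dots> \<le> 2 ^ k * (C + norm a ^ k * E)"
        by (intro mult_left_mono add_mono C mult_left_mono E) auto
      finally show ?thesis .
    qed
    then show "bdd_above (range (\<lambda>x. norm x ^ k * norm (iter_partial bs f x)))"
      by (intro bdd_aboveI2)
  qed
qed

text \<open>Scales bounded away from zero make the mixture smooth, and moments make it decay rapidly.\<close>

locale scale_law_lower = scale_law +
  fixes s0 :: real
  assumes s0: "s0 > 0" and AE_lower: "AE s in Q. s0 \<le> s"
    and moments: "\<And>k. integrable Q (\<lambda>s. s ^ k)"
begin

text \<open>The indicator makes the weight nonnegative for every \<open>s\<close>, not only almost surely, as the convexity
  argument for the derivative requires.\<close>

definition heat_moment :: "nat \<Rightarrow> 'a::euclidean_space \<Rightarrow> real" where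
  "heat_moment k x = (LINT s|Q. indicator {s0..} s * heat_kernel s x / s ^ k)"

lemma heat_moment_0: "heat_moment 0 x = heat_mix Q x"
  unfolding heat_moment_def heat_mix_def
  by (rule integral_cong_AE) (use AE_lower in auto)

lemma heat_moment_weight_bound:
  assumes "s0 \<le> s"
  shows "1 / ((2 * pi * s) powr (real d / 2) * s ^ k) \<le> 1 / ((2 * pi * s0) powr (real d / 2) * s0 ^ k)"
  using assms s0 by (intro divide_left_mono mult_mono powr_mono2 power_mono mult_pos_pos) auto

text \<open>As a function of the squared norm this is a Laplace-type integral with exponent \<open>1 / (2 s)\<close>, and
  \<open>s \<ge> s0\<close> keeps it finite for arguments of either sign. That includes the argument zero, where a
  two-sided derivative is needed.\<close>

lemma heat_moment_has_derivative:
  fixes x :: "'a::euclidean_space"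
  shows "(heat_moment k has_derivative (\<lambda>h. - (x \<bullet> h) * heat_moment (Suc k) x)) (at x)"
proof -
  define w where "w k s = indicator {s0..} s * (1 / ((2 * pi * s) powr (real DIM('a) / 2) * s ^ k))" for k s
  have eq: "heat_moment k = (\<lambda>x::'a. LINT s|Q. w k s * exp (- ((norm x)\<^sup>2) * (1 / (2 * s))))" for k
    unfolding heat_moment_def[abs_def] w_def heat_kernel_def by (simp add: mult_ac)
  have w0: "0 \<le> w k s" for k s using s0 by (auto simp: w_def indicator_def)
  have int: "integrable Q (\<lambda>s. w k s * exp (- y * (1 / (2 * s))))" for k y
  proof (rule integrable_const_bound)
    show "AE s in Q. norm (w k s * exp (- y * (1 / (2 * s))))
       \<le> 1 / ((2 * pi * s0) powr (real DIM('a) / 2) * s0 ^ k) * exp (\<bar>y\<bar> / (2 * s0))"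
    proof (rule AE_I2)
      fix s
      show "norm (w k s * exp (- y * (1 / (2 * s))))
         \<le> 1 / ((2 * pi * s0) powr (real DIM('a) / 2) * s0 ^ k) * exp (\<bar>y\<bar> / (2 * s0))"
      proof (cases "s0 \<le> s")
        case True
        have "- y * (1 / (2 * s)) \<le> \<bar>y\<bar> * (1 / (2 * s))"
          using True s0 by (intro mult_right_mono) auto
        also have "\<dots> \<le> \<bar>y\<bar> * (1 / (2 * s0))"
          using True s0 by (intro mult_left_mono divide_left_mono) auto
        finally have e: "exp (- y * (1 / (2 * s))) \<le> exp (\<bar>y\<bar> / (2 * s0))" by simp
        have "norm (w k s * exp (- y * (1 / (2 * s)))) = w k s * exp (- y * (1 / (2 * s)))"
          using w0[of k s] by (simp add: abs_mult)
        also have "\<dots> \<le> 1 / ((2 * pi * s0) powr (real DIM('a) / 2) * s0 ^ k) * exp (\<bar>y\<bar> / (2 * s0))"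
          using True s0 heat_moment_weight_bound[OF True, of "DIM('a)" k] e
          by (intro mult_mono) (auto simp: w_def)
        finally show ?thesis .
      qed (use s0 in \<open>auto simp: w_def\<close>)
    qed
  qed (unfold w_def, measurable)
  have w1: "w k s * (1 / (2 * s)) = 1 / 2 * w (Suc k) s" for s
    by (simp add: w_def)
  have int1: "integrable Q (\<lambda>s. w k s * (1 / (2 * s)) * exp (- y * (1 / (2 * s))))" for y
    unfolding w1 using integrable_mult_right[OF int[of "Suc k" y], of "1 / 2"] by (simp add: mult.assoc)
  let ?L = "\<lambda>y. LINT s|Q. w k s * exp (- y * (1 / (2 * s)))"
  have "(?L has_real_derivative - (LINT s|Q. w k s * (1 / (2 * s)) * exp (- (norm x)\<^sup>2 * (1 / (2 * s))))) (at ((norm x)\<^sup>2))"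
    by (rule laplace_has_derivative[where c = "(norm x)\<^sup>2 - 1"])
      (use w0 int int1 in \<open>auto simp only: w1\<close>, auto)
  also have "(LINT s|Q. w k s * (1 / (2 * s)) * exp (- (norm x)\<^sup>2 * (1 / (2 * s)))) = heat_moment (Suc k) x / 2"
    unfolding w1 eq by (simp add: mult.assoc)
  finally have d: "(?L has_derivative (*) (- (heat_moment (Suc k) x / 2))) (at ((norm x)\<^sup>2))"
    by (rule has_field_derivative_imp_has_derivative)
  have n: "((\<lambda>x::'a. (norm x)\<^sup>2) has_derivative (\<lambda>h. 2 * (x \<bullet> h))) (at x)"
    unfolding power2_norm_eq_inner by (auto intro!: derivative_eq_intros simp: inner_commute)
  have "((\<lambda>x. ?L ((norm x)\<^sup>2)) has_derivative (\<lambda>h. - (heat_moment (Suc k) x / 2) * (2 * (x \<bullet> h)))) (at x)"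
    by (rule has_derivative_compose[OF n d])
  then show ?thesis unfolding eq[of k] by (simp add: mult_ac)
qed

text \<open>Powers of the norm cost powers of the scale, \<open>|x|\<^bsup>2n\<^esup> exp (- |x|\<^sup>2 / (2 s)) \<le> n! (2 s)\<^sup>n\<close>, and the
  mixing law has moments of all orders.\<close>

lemma heat_moment_bounded:
  "\<exists>C. \<forall>x::'a::euclidean_space. norm x ^ n * \<bar>heat_moment k x\<bar> \<le> C"
proof -
  define c where "c = 1 / ((2 * pi * s0) powr (real DIM('a) / 2) * s0 ^ k)"
  have c: "c \<ge> 0" using s0 by (simp add: c_def)
  have ptw: "norm x ^ n * (indicator {s0..} s * heat_kernel s x / s ^ k) \<le> c * (1 + fact n * 2 ^ n * s ^ n)"
    if "s0 \<le> s" for s and x :: 'a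
  proof -
    have s: "s > 0" using that s0 by simp
    have "norm x ^ n \<le> 1 + (norm x ^ n)\<^sup>2"
      using sum_squares_bound[of "norm x ^ n" 1] zero_le_power[OF norm_ge_zero[of x], of n]
      unfolding power_one mult_1_right by linarith
    then have "norm x ^ n * exp (- (norm x)\<^sup>2 / (2 * s)) \<le> (1 + ((norm x)\<^sup>2) ^ n) * exp (- (norm x)\<^sup>2 / (2 * s))"
      by (intro mult_right_mono) (auto simp: power_mult [symmetric] mult.commute)
    also have "\<dots> \<le> 1 + fact n * 2 ^ n * s ^ n"
    proof -
      have "((norm x)\<^sup>2) ^ n * exp (- (norm x)\<^sup>2 / (2 * s)) \<le> fact n * 2 ^ n * s ^ n"
      proof (cases "x = 0")
        case True
        then show ?thesis using s by (cases n) auto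
      next
        case False
        then have "exp (- ((norm x)\<^sup>2 / (2 * s))) \<le> fact n / ((norm x)\<^sup>2 / (2 * s)) ^ n"
          using s by (intro exp_neg_le_power) auto
        moreover have p: "((norm x)\<^sup>2 / (2 * s)) ^ n > 0" using False s by simp
        ultimately have "((norm x)\<^sup>2 / (2 * s)) ^ n * exp (- ((norm x)\<^sup>2 / (2 * s))) \<le> fact n"
          by (simp add: pos_le_divide_eq mult.commute)
        then have "(2 * s) ^ n * (((norm x)\<^sup>2 / (2 * s)) ^ n * exp (- ((norm x)\<^sup>2 / (2 * s)))) \<le> (2 * s) ^ n * fact n"
          using s by (intro mult_left_mono) auto
        also have "(2 * s) ^ n * (((norm x)\<^sup>2 / (2 * s)) ^ n * exp (- ((norm x)\<^sup>2 / (2 * s))))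
           = ((norm x)\<^sup>2) ^ n * exp (- (norm x)\<^sup>2 / (2 * s))"
          using s by (simp add: power_divide)
        finally show ?thesis by (simp add: power_mult_distrib mult_ac)
      qed
      moreover have "exp (- (norm x)\<^sup>2 / (2 * s)) \<le> 1" using s by simp
      ultimately show ?thesis unfolding distrib_right by linarith
    qed
    finally have 1: "norm x ^ n * exp (- (norm x)\<^sup>2 / (2 * s)) \<le> 1 + fact n * 2 ^ n * s ^ n" .
    have "norm x ^ n * (indicator {s0..} s * heat_kernel s x / s ^ k)
      = 1 / ((2 * pi * s) powr (real DIM('a) / 2) * s ^ k) * (norm x ^ n * exp (- (norm x)\<^sup>2 / (2 * s)))"
      using that by (simp add: heat_kernel_def)
    also have "\<dots> \<le> c * (1 + fact n * 2 ^ n * s ^ n)"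
      using heat_moment_weight_bound[OF that, of "DIM('a)" k] 1 c unfolding c_def
      by (intro mult_mono) auto
    finally show ?thesis .
  qed
  have "norm x ^ n * \<bar>heat_moment k x\<bar> \<le> (LINT s|Q. c * (1 + fact n * 2 ^ n * s ^ n))" for x :: 'a
  proof -
    have "heat_moment k x \<ge> 0"
      unfolding heat_moment_def using s0 by (intro integral_nonneg_AE AE_I2) (auto simp: indicator_def)
    then have "norm x ^ n * \<bar>heat_moment k x\<bar> = (LINT s|Q. norm x ^ n * (indicator {s0..} s * heat_kernel s x / s ^ k))"
      by (simp add: heat_moment_def del: times_divide_eq_right)
    also have "\<dots> \<le> (LINT s|Q. c * (1 + fact n * 2 ^ n * s ^ n))"
    proof (rule integral_mono_AE')
      show "integrable Q (\<lambda>s. c * (1 + fact n * 2 ^ n * s ^ n))"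
        using moments[of n] by auto
      show "AE s in Q. norm x ^ n * (indicator {s0..} s * heat_kernel s x / s ^ k) \<le> c * (1 + fact n * 2 ^ n * s ^ n)"
        using AE_lower by eventually_elim (rule ptw)
      show "AE s in Q. 0 \<le> c * (1 + fact n * 2 ^ n * s ^ n)"
        using AE_lower
      proof eventually_elim
        case (elim s)
        then have "s > 0" using s0 by simp
        then show ?case using c by (intro mult_nonneg_nonneg add_nonneg_nonneg) auto
      qed
    qed
    finally show ?thesis .
  qed
  then show ?thesis by blast
qed

lemma schwartz_heat_mix: "schwartz (\<lambda>x::'a::euclidean_space. complex_of_real (heat_mix Q (x - a)))"
proof -
  have "schwartz (\<lambda>x. complex_of_real (heat_moment 0 (x - a)))"
  proof (rule heat_class_schwartz[where m = heat_moment and a = a])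
    show "heat_class heat_moment a (\<lambda>x. complex_of_real (heat_moment 0 (x - a)))"
      by (rule heat_class.moment[of heat_moment a 0])
  qed (rule heat_moment_has_derivative heat_moment_bounded)+
  then show ?thesis by (simp only: heat_moment_0)
qed

end

section \<open>Fourier inversion for Schwartz functions\<close>

lemma schwartz_iter_partial_differentiable:
  "schwartz f \<Longrightarrow> set bs \<subseteq> Basis \<Longrightarrow> iter_partial bs f differentiable at x"
  by (auto simp: schwartz_def in_lists_conv_set subset_eq)

lemma schwartz_bounded:
  assumes "schwartz f" "set bs \<subseteq> Basis"
  obtains C where "C \<ge> 0" "\<And>x. norm x ^ k * norm (iter_partial bs f x) \<le> C"
proof -
  have "bdd_above (range (\<lambda>x. norm x ^ k * norm (iter_partial bs f x)))"
    using assms by (auto simp: schwartz_def in_lists_conv_set subset_eq)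
  then obtain C where "\<And>x. norm x ^ k * norm (iter_partial bs f x) \<le> C"
    by (auto simp: bdd_above_def)
  then show ?thesis by (intro that[of "max C 0"]) (auto simp: le_max_iff_disj)
qed

lemma schwartz_continuous:
  assumes "schwartz f" "set bs \<subseteq> Basis" shows "continuous_on UNIV (iter_partial bs f)"
  using schwartz_iter_partial_differentiable[OF assms]
  by (intro continuous_at_imp_continuous_on ballI differentiable_imp_continuous_within)

lemma schwartz_measurable:
  assumes "schwartz f" "set bs \<subseteq> Basis" shows "iter_partial bs f \<in> borel_measurable borel"
  using schwartz_continuous[OF assms] by (rule borel_measurable_continuous_onI)

definition decay_weight :: "nat \<Rightarrow> 'a::euclidean_space \<Rightarrow> real" where
  "decay_weight N x = 1 / (1 + (norm x)\<^sup>2) ^ N"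

lemma measurable_decay_weight [measurable]: "decay_weight N \<in> borel_measurable borel"
  unfolding decay_weight_def[abs_def] by measurable

lemma decay_weight_pos: "decay_weight N x > 0"
  by (auto simp: decay_weight_def intro!: divide_pos_pos zero_less_power add_pos_nonneg)

text \<open>Each factor \<open>1 + |x|\<^sup>2\<close> dominates one of the \<open>1 + x\<^sub>b\<^sup>2\<close>, and the resulting product is
  integrable coordinate by coordinate.\<close>

lemma integrable_decay_weight: "integrable lborel (decay_weight DIM('a) :: 'a::euclidean_space \<Rightarrow> real)"
proof (rule integrableI_bounded)
  have one: "(\<integral>\<^sup>+ y. ennreal (1 / (1 + y\<^sup>2)) \<partial>lborel) < \<infinity>"
  proof -
    have "integrable lborel (\<lambda>y::real. 1 / (1 + y\<^sup>2))"
      using integrable_inverse_1_plus_square by (simp add: set_integrable_def einterval_def inverse_eq_divide)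
    then have "(\<integral>\<^sup>+ y. ennreal (norm (1 / (1 + y\<^sup>2 :: real))) \<partial>lborel) < \<infinity>"
      unfolding integrable_iff_bounded by (rule conjunct2)
    then show ?thesis by simp
  qed
  have p: "1 + y\<^sup>2 > 0" for y :: real by (intro add_pos_nonneg) auto
  have "(\<integral>\<^sup>+ x. ennreal (norm (decay_weight DIM('a) (x::'a))) \<partial>lborel)
    \<le> (\<integral>\<^sup>+ x. (\<Prod>b\<in>Basis. ennreal (1 / (1 + ((x::'a) \<bullet> b)\<^sup>2))) \<partial>lborel)"
  proof (rule nn_integral_mono)
    fix x :: 'a
    have "decay_weight DIM('a) x = (\<Prod>b\<in>(Basis :: 'a set). 1 / (1 + (norm x)\<^sup>2))"
      by (simp add: decay_weight_def power_one_over)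
    also have "\<dots> \<le> (\<Prod>b\<in>Basis. 1 / (1 + (x \<bullet> b)\<^sup>2))"
    proof (rule prod_mono, rule conjI)
      fix b :: 'a assume "b \<in> Basis"
      then have "(x \<bullet> b)\<^sup>2 \<le> (norm x)\<^sup>2" by (intro abs_le_square_iff[THEN iffD1]) (simp add: Basis_le_norm)
      then show "1 / (1 + (norm x)\<^sup>2) \<le> 1 / (1 + (x \<bullet> b)\<^sup>2)"
        using p by (intro divide_left_mono mult_pos_pos) auto
    qed (use p[of "norm x"] in auto)
    finally show "ennreal (norm (decay_weight DIM('a) x)) \<le> (\<Prod>b\<in>Basis. ennreal (1 / (1 + (x \<bullet> b)\<^sup>2)))"
      using decay_weight_pos[of "DIM('a)" x] by (simp add: prod_ennreal ennreal_leI)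
  qed
  also have "\<dots> = (\<Prod>b\<in>(Basis :: 'a set). \<integral>\<^sup>+ y. ennreal (1 / (1 + y\<^sup>2)) \<partial>lborel)"
    by (rule nn_integral_lborel_prod) auto
  also have "\<dots> < \<infinity>" using one by (simp add: power_less_top_ennreal)
  finally show "(\<integral>\<^sup>+ x. ennreal (norm (decay_weight DIM('a) (x::'a))) \<partial>lborel) < \<infinity>" .
qed measurable

lemma one_plus_norm_power_le:
  "(1 + (norm x)\<^sup>2) ^ N \<le> 2 ^ N * (1 + norm x ^ (2 * N))"
proof -
  have "(1 + (norm x)\<^sup>2) ^ N \<le> (2 * max 1 ((norm x)\<^sup>2)) ^ N"
    by (intro power_mono) auto
  also have "\<dots> \<le> 2 ^ N * (1 + norm x ^ (2 * N))"
    by (auto simp: power_mult_distrib max_def power_mult)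
  finally show ?thesis .
qed

lemma decay_weight_bound:
  assumes c: "c \<le> A" and B: "norm x ^ (2 * N) * c \<le> B" and "0 \<le> c"
  shows "c \<le> 2 ^ N * (A + B) * decay_weight N x"
proof -
  have "(1 + (norm x)\<^sup>2) ^ N * c \<le> 2 ^ N * (1 + norm x ^ (2 * N)) * c"
    using assms by (intro mult_right_mono one_plus_norm_power_le) auto
  also have "\<dots> = 2 ^ N * (c + norm x ^ (2 * N) * c)" by (simp add: algebra_simps)
  also have "\<dots> \<le> 2 ^ N * (A + B)" using c B by (intro mult_left_mono add_mono) auto
  finally have "(1 + (norm x)\<^sup>2) ^ N * c \<le> 2 ^ N * (A + B)" .
  moreover have "(1 + (norm x)\<^sup>2) ^ N > 0" by (intro zero_less_power add_pos_nonneg) auto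
  ultimately show ?thesis by (simp add: decay_weight_def pos_le_divide_eq mult.commute)
qed

lemma schwartz_decay:
  fixes f :: "'a::euclidean_space \<Rightarrow> complex"
  assumes "schwartz f" "set bs \<subseteq> Basis"
  obtains C where "C \<ge> 0" "\<And>x. norm (iter_partial bs f x) \<le> C * decay_weight N x"
proof -
  obtain A where A: "A \<ge> 0" "\<And>x. norm x ^ 0 * norm (iter_partial bs f x) \<le> A" using schwartz_bounded[OF assms] by blast
  obtain B where B: "B \<ge> 0" "\<And>x. norm x ^ (2 * N) * norm (iter_partial bs f x) \<le> B" using schwartz_bounded[OF assms] by blast
  have "norm (iter_partial bs f x) \<le> 2 ^ N * (A + B) * decay_weight N x" for x
    by (rule decay_weight_bound[OF _ B(2)]) (use A(2)[of x] in auto)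
  then show ?thesis using A B by (intro that[of "2 ^ N * (A + B)"]) auto
qed

lemma schwartz_integrable:
  fixes f :: "'a::euclidean_space \<Rightarrow> complex"
  assumes f: "schwartz f" "set bs \<subseteq> Basis"
  shows "integrable lborel (iter_partial bs f)"
proof -
  obtain C where C: "\<And>x. norm (iter_partial bs f x) \<le> C * decay_weight DIM('a) x"
    using schwartz_decay[OF f] by metis
  show ?thesis
  proof (rule Bochner_Integration.integrable_bound)
    show "integrable lborel (\<lambda>x::'a. C * decay_weight DIM('a) x)"
      by (intro integrable_mult_right integrable_decay_weight)
    show "AE x in lborel. norm (iter_partial bs f x) \<le> norm (C * decay_weight DIM('a) x)"
      using C by (intro AE_I2) (metis abs_ge_self order_trans real_norm_def)
  qed (use schwartz_measurable[OF f] in simp)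
qed

text \<open>The inverse Fourier transform without its normalising constant.\<close>

definition osc_integral :: "('a::euclidean_space \<Rightarrow> complex) \<Rightarrow> 'a \<Rightarrow> complex" where
  "osc_integral f \<omega> = (LINT x|lborel. iexp (\<omega> \<bullet> x) * f x)"

lemma has_vector_derivative_difference_quotient:
  assumes "(f has_vector_derivative v) (at 0)"
  shows "(\<lambda>t::real. (f t - f 0) /\<^sub>R t) \<midarrow>0\<rightarrow> v"
proof (rule LIM_zero_cancel, rule tendsto_norm_zero_cancel)
  have "(\<lambda>h. norm (f (0 + h) - f 0 - h *\<^sub>R v) / norm h) \<midarrow>0\<rightarrow> 0"
    using assms unfolding has_vector_derivative_def has_derivative_at by blast
  then show "(\<lambda>t. norm ((f t - f 0) /\<^sub>R t - v)) \<midarrow>0\<rightarrow> 0"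
  proof (rule Lim_transform_eventually)
    have "norm (f (0 + h) - f 0 - h *\<^sub>R v) / norm h = norm ((f h - f 0) /\<^sub>R h - v)" if "h \<noteq> 0" for h
    proof -
      have "(f h - f 0) /\<^sub>R h - v = (f (0 + h) - f 0 - h *\<^sub>R v) /\<^sub>R h"
        using that by (simp add: scaleR_diff_right)
      then show ?thesis by (simp add: divide_inverse mult.commute)
    qed
    then show "\<forall>\<^sub>F h in at 0. norm (f (0 + h) - f 0 - h *\<^sub>R v) / norm h = norm ((f h - f 0) /\<^sub>R h - v)"
      by (auto simp: eventually_at_filter)
  qed
qed

text \<open>Integration by parts in the form of translation invariance: shifting the argument of a function
  by \<open>h b\<close> multiplies its transform by \<open>exp (- i h \<omega>\<^sub>b)\<close>. Dividing the difference by \<open>h\<close> and letting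
  \<open>h\<close> tend to zero gives the claim; the mean value inequality and the decay of the derivative
  dominate the difference quotients.\<close>

lemma osc_integral_partial:
  fixes f :: "'a::euclidean_space \<Rightarrow> complex"
  assumes f: "schwartz f" "set bs \<subseteq> Basis" and b: "b \<in> Basis"
  shows "osc_integral (iter_partial (b # bs) f) \<omega> = - \<i> * complex_of_real (\<omega> \<bullet> b) * osc_integral (iter_partial bs f) \<omega>"
proof -
  define g where "g = iter_partial bs f"
  define g' where "g' = iter_partial (b # bs) f"
  define e where "e x = iexp (\<omega> \<bullet> x)" for x
  have bs': "set (b # bs) \<subseteq> Basis" using f b by auto
  have [measurable]: "g \<in> borel_measurable borel" "g' \<in> borel_measurable borel"
    unfolding g_def g'_def using schwartz_measurable f(1) f(2) bs' by blast+
  have [measurable]: "e \<in> borel_measurable borel" unfolding e_def by measurable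
  have ne: "norm (e x) = 1" for x by (simp add: e_def)
  have gi: "integrable lborel g" unfolding g_def by (rule schwartz_integrable[OF f])
  have dg: "((\<lambda>t. g (x + t *\<^sub>R b)) has_vector_derivative g' (x + t *\<^sub>R b)) (at t)" for x t
  proof -
    have "(g has_derivative frechet_derivative g (at (x + t *\<^sub>R b))) (at (x + t *\<^sub>R b))"
      using schwartz_iter_partial_differentiable[OF f] unfolding g_def by (simp add: frechet_derivative_works)
    moreover have "((\<lambda>t. x + t *\<^sub>R b) has_derivative (\<lambda>h. h *\<^sub>R b)) (at t)"
      by (auto intro!: derivative_eq_intros)
    ultimately have d: "((\<lambda>t. g (x + t *\<^sub>R b)) has_derivative (\<lambda>h. frechet_derivative g (at (x + t *\<^sub>R b)) (h *\<^sub>R b))) (at t)"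
      by (rule has_derivative_compose[rotated])
    have "linear (frechet_derivative g (at (x + t *\<^sub>R b)))"
      using schwartz_iter_partial_differentiable[OF f] unfolding g_def by (intro linear_frechet_derivative)
    then have "(\<lambda>h. frechet_derivative g (at (x + t *\<^sub>R b)) (h *\<^sub>R b)) = (\<lambda>h. h *\<^sub>R g' (x + t *\<^sub>R b))"
      by (simp add: linear_scale g'_def g_def)
    then show ?thesis using d by (simp add: has_vector_derivative_def)
  qed
  obtain C where C: "C \<ge> 0" "\<And>x. norm (g' x) \<le> C * decay_weight DIM('a) x"
    unfolding g'_def using schwartz_decay[OF f(1) bs'] by metis
  define q where "q n x = complex_of_real (real (Suc n)) * (g (x + (1 / real (Suc n)) *\<^sub>R b) - g x)" for n x
  have qb: "norm (q n x) \<le> C * 3 ^ DIM('a) * decay_weight DIM('a) x" for n x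
  proof -
    define h where "h = 1 / real (Suc n)"
    have h: "0 < h" "h \<le> 1" by (auto simp: h_def)
    have nb: "norm b = 1" using b by simp
    have g'b: "norm (g' (x + t *\<^sub>R b)) \<le> C * 3 ^ DIM('a) * decay_weight DIM('a) x" if "t \<in> {0..h}" for t
    proof -
      have t: "0 \<le> t" "t \<le> 1" using that h by auto
      have "norm x \<le> norm (x + t *\<^sub>R b) + norm (t *\<^sub>R b)"
        using norm_triangle_ineq4[of "x + t *\<^sub>R b" "t *\<^sub>R b"] by simp
      then have "norm x \<le> norm (x + t *\<^sub>R b) + 1" using nb t by simp
      then have "(norm x)\<^sup>2 \<le> (norm (x + t *\<^sub>R b) + 1)\<^sup>2" by (intro power_mono) auto
      also have "\<dots> \<le> 2 * (norm (x + t *\<^sub>R b))\<^sup>2 + 2"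
        using sum_squares_bound[of "norm (x + t *\<^sub>R b)" 1] by (simp add: power2_eq_square algebra_simps)
      finally have "(norm x)\<^sup>2 \<le> 2 * (norm (x + t *\<^sub>R b))\<^sup>2 + 2" .
      have le: "1 + (norm x)\<^sup>2 \<le> 3 * (1 + (norm (x + t *\<^sub>R b))\<^sup>2)"
      proof -
        have "1 + A \<le> 3 * (1 + Y)" if "A \<le> 2 * Y + 2" "0 \<le> Y" for A Y :: real
          using that by simp
        from this[OF \<open>(norm x)\<^sup>2 \<le> 2 * (norm (x + t *\<^sub>R b))\<^sup>2 + 2\<close> zero_le_power2] show ?thesis .
      qed
      have p: "1 + (norm y)\<^sup>2 > 0" for y :: 'a by (intro add_pos_nonneg) auto
      have "(1 + (norm x)\<^sup>2) ^ DIM('a) \<le> (3 * (1 + (norm (x + t *\<^sub>R b))\<^sup>2)) ^ DIM('a)"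
        by (intro power_mono le less_imp_le p)
      then have "(1 + (norm x)\<^sup>2) ^ DIM('a) \<le> 3 ^ DIM('a) * (1 + (norm (x + t *\<^sub>R b))\<^sup>2) ^ DIM('a)"
        by (simp only: power_mult_distrib)
      moreover have "1 / Y \<le> c * (1 / X)" if "X \<le> c * Y" "X > 0" "Y > 0" for X Y c :: real
        using that by (simp add: field_simps)
      ultimately have "decay_weight DIM('a) (x + t *\<^sub>R b) \<le> 3 ^ DIM('a) * decay_weight DIM('a) x"
        unfolding decay_weight_def using p by (meson zero_less_power)
      then have "C * decay_weight DIM('a) (x + t *\<^sub>R b) \<le> C * (3 ^ DIM('a) * decay_weight DIM('a) x)"
        using C by (intro mult_left_mono)
      then show ?thesis using C(2)[of "x + t *\<^sub>R b"] by (simp add: mult.assoc)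
    qed
    have "norm (g (x + h *\<^sub>R b) - g (x + 0 *\<^sub>R b)) \<le> (C * 3 ^ DIM('a) * decay_weight DIM('a) x) * norm (h - 0)"
    proof (rule differentiable_bound[where S = "{0..h}" and f' = "\<lambda>t u. u *\<^sub>R g' (x + t *\<^sub>R b)"])
      fix t assume t: "t \<in> {0..h}"
      show "((\<lambda>t. g (x + t *\<^sub>R b)) has_derivative (\<lambda>u. u *\<^sub>R g' (x + t *\<^sub>R b))) (at t within {0..h})"
        using dg[of x t] by (auto simp: has_vector_derivative_def intro: has_derivative_at_withinI)
      show "onorm (\<lambda>u. u *\<^sub>R g' (x + t *\<^sub>R b)) \<le> C * 3 ^ DIM('a) * decay_weight DIM('a) x"
        using g'b[OF t] by (intro onorm_le) (auto simp: mult.commute intro!: mult_left_mono)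
    qed (use h in auto)
    then have "norm (g (x + h *\<^sub>R b) - g x) * real (Suc n) \<le> (C * 3 ^ DIM('a) * decay_weight DIM('a) x) * h * real (Suc n)"
      using h by (intro mult_right_mono) auto
    then show ?thesis by (simp add: q_def h_def norm_mult mult.commute del: of_nat_Suc)
  qed
  have ql: "(\<lambda>n. q n x) \<longlonglongrightarrow> g' x" for x
  proof -
    have "((\<lambda>t. g (x + t *\<^sub>R b)) has_vector_derivative g' x) (at 0)" using dg[of x 0] by simp
    then have "(\<lambda>t. (g (x + t *\<^sub>R b) - g x) /\<^sub>R t) \<midarrow>0\<rightarrow> g' x"
      using has_vector_derivative_difference_quotient by fastforce
    moreover have "filterlim (\<lambda>n. 1 / real (Suc n)) (at 0) sequentially"
      using LIMSEQ_Suc[OF lim_1_over_n] by (auto simp: filterlim_at)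
    ultimately have "(\<lambda>n. (g (x + (1 / real (Suc n)) *\<^sub>R b) - g x) /\<^sub>R (1 / real (Suc n))) \<longlonglongrightarrow> g' x"
      by (rule filterlim_compose)
    then show ?thesis by (simp add: q_def scaleR_conv_of_real del: of_nat_Suc)
  qed
  have "(\<lambda>n. LINT x|lborel. e x * q n x) \<longlonglongrightarrow> (LINT x|lborel. e x * g' x)"
  proof (rule integral_dominated_convergence)
    show "integrable lborel (\<lambda>x::'a. C * 3 ^ DIM('a) * decay_weight DIM('a) x)"
      by (intro integrable_mult_right integrable_decay_weight)
    show "AE x in lborel. (\<lambda>n. e x * q n x) \<longlonglongrightarrow> e x * g' x"
      by (intro AE_I2 tendsto_intros ql)
    show "AE x in lborel. norm (e x * q n x) \<le> C * 3 ^ DIM('a) * decay_weight DIM('a) x" for n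
      by (intro AE_I2) (simp add: norm_mult ne qb)
  qed (unfold q_def, measurable)
  moreover have "(LINT x|lborel. e x * q n x)
     = complex_of_real (real (Suc n)) * (exp (- \<i> * complex_of_real (\<omega> \<bullet> b) * complex_of_real (1 / real (Suc n))) - 1) * (LINT x|lborel. e x * g x)" for n
  proof -
    define h where "h = 1 / real (Suc n)"
    define c where "c = exp (- \<i> * complex_of_real (\<omega> \<bullet> b) * complex_of_real h)"
    have i1: "integrable lborel (\<lambda>x. e x * g x)"
      by (rule Bochner_Integration.integrable_bound[OF gi]) (auto simp: norm_mult ne)
    have i2: "integrable lborel (\<lambda>x. e x * g (x - (- h *\<^sub>R b)))"
      by (rule Bochner_Integration.integrable_bound[OF integrable_lborel_translate[OF gi, of "- h *\<^sub>R b"]]) (auto simp: norm_mult ne)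
    have "e x = c * e (x - (- h *\<^sub>R b))" for x
      unfolding e_def c_def by (simp add: exp_add [symmetric] inner_add_right algebra_simps)
    then have "(LINT x|lborel. e x * g (x - (- h *\<^sub>R b))) = (LINT x|lborel. c * (e (x - (- h *\<^sub>R b)) * g (x - (- h *\<^sub>R b))))"
      by (metis mult.assoc)
    also have "\<dots> = c * (LINT x|lborel. (\<lambda>y. e y * g y) (x - (- h *\<^sub>R b)))"
      by simp
    also have "\<dots> = c * (LINT x|lborel. e x * g x)"
      by (subst integral_lborel_translate) auto
    finally have t: "(LINT x|lborel. e x * g (x - (- h *\<^sub>R b))) = c * (LINT x|lborel. e x * g x)" .
    have "(LINT x|lborel. e x * q n x) = (LINT x|lborel. complex_of_real (real (Suc n)) * (e x * g (x - (- h *\<^sub>R b)) - e x * g x))"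
      by (simp add: q_def h_def algebra_simps del: of_nat_Suc)
    also have "\<dots> = complex_of_real (real (Suc n)) * (c * (LINT x|lborel. e x * g x) - (LINT x|lborel. e x * g x))"
      using i1 i2 by (simp add: t[symmetric] del: of_nat_Suc)
    finally show ?thesis by (simp add: c_def h_def algebra_simps del: of_nat_Suc)
  qed
  moreover have "(\<lambda>n. complex_of_real (real (Suc n)) * (exp (- \<i> * complex_of_real (\<omega> \<bullet> b) * complex_of_real (1 / real (Suc n))) - 1) * (LINT x|lborel. e x * g x))
    \<longlonglongrightarrow> (- \<i> * complex_of_real (\<omega> \<bullet> b)) * (LINT x|lborel. e x * g x)"
  proof (rule tendsto_mult[OF _ tendsto_const])
    let ?k = "- \<i> * complex_of_real (\<omega> \<bullet> b)"
    have "((\<lambda>t. exp (t *\<^sub>R ?k)) has_vector_derivative ?k * exp (0 *\<^sub>R ?k)) (at 0)"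
      by (rule exp_scaleR_has_vector_derivative_left)
    then have "(\<lambda>t. (exp (t *\<^sub>R ?k) - 1) /\<^sub>R t) \<midarrow>0\<rightarrow> ?k"
      using has_vector_derivative_difference_quotient by fastforce
    moreover have "filterlim (\<lambda>n. 1 / real (Suc n)) (at 0) sequentially"
      using LIMSEQ_Suc[OF lim_1_over_n] by (auto simp: filterlim_at)
    ultimately have "(\<lambda>n. (exp ((1 / real (Suc n)) *\<^sub>R ?k) - 1) /\<^sub>R (1 / real (Suc n))) \<longlonglongrightarrow> ?k"
      by (rule filterlim_compose)
    then show "(\<lambda>n. complex_of_real (real (Suc n)) * (exp (?k * complex_of_real (1 / real (Suc n))) - 1)) \<longlonglongrightarrow> ?k"
      by (simp add: scaleR_conv_of_real mult_ac del: of_nat_Suc)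
  qed
  ultimately have "(LINT x|lborel. e x * g' x) = (- \<i> * complex_of_real (\<omega> \<bullet> b)) * (LINT x|lborel. e x * g x)"
    by (simp add: LIMSEQ_unique)
  then show ?thesis unfolding osc_integral_def g_def g'_def e_def by simp
qed

lemma inv_fourier_eq_osc: "inv_fourier f \<omega> = osc_integral f (\<omega>::'a::euclidean_space) / complex_of_real ((2 * pi) ^ DIM('a))"
  by (simp add: inv_fourier_def osc_integral_def)

lemma measurable_osc_integral [measurable]:
  assumes [measurable]: "f \<in> borel_measurable borel"
  shows "osc_integral f \<in> borel_measurable borel"
proof -
  have "(\<lambda>\<omega>. LINT x|lborel. iexp (\<omega> \<bullet> x) * f x) \<in> borel_measurable lborel"
    by (rule lborel.borel_measurable_lebesgue_integral) measurable
  then show ?thesis unfolding osc_integral_def[abs_def] by simp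
qed

lemma norm_osc_integral_le: "norm (osc_integral f \<omega>) \<le> (LINT x|lborel. norm (f x))"
proof -
  have "norm (osc_integral f \<omega>) \<le> (LINT x|lborel. norm (iexp (\<omega> \<bullet> x) * f x))"
    unfolding osc_integral_def by (rule integral_norm_bound)
  then show ?thesis by (simp add: norm_mult)
qed

lemma osc_integral_partial_power:
  assumes f: "schwartz f" and b: "b \<in> Basis"
  shows "osc_integral (iter_partial (replicate n b) f) \<omega> = (- \<i> * complex_of_real (\<omega> \<bullet> b)) ^ n * osc_integral f \<omega>"
proof (induction n)
  case (Suc n)
  have "set (replicate n b) \<subseteq> Basis" using b by auto
  from osc_integral_partial[OF f this b] Suc show ?case by (simp add: mult_ac)
qed simp

text \<open>Differentiating \<open>2 N\<close> times in the direction of the largest coordinate of \<open>\<omega>\<close> gains the factor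
  \<open>|\<omega>|\<^bsup>2N\<^esup>\<close> up to a constant.\<close>

lemma osc_integral_decay:
  fixes f :: "'a::euclidean_space \<Rightarrow> complex"
  assumes f: "schwartz f"
  obtains C where "C \<ge> 0" "\<And>\<omega>. norm (osc_integral f \<omega>) \<le> C * decay_weight N \<omega>"
proof -
  define n where "n = 2 * N"
  define A where "A b = (LINT x|lborel. norm (iter_partial (replicate n b) f x))" for b
  define A0 where "A0 = (LINT x|lborel. norm (f x))"
  define B where "B = sqrt (real DIM('a)) ^ n * (\<Sum>b\<in>Basis. A b)"
  have A: "A b \<ge> 0" for b by (simp add: A_def)
  have A0: "A0 \<ge> 0" by (simp add: A0_def)
  have B: "B \<ge> 0" using A by (simp add: B_def sum_nonneg)
  have le: "norm \<omega> ^ n * norm (osc_integral f \<omega>) \<le> B" for \<omega>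
  proof -
    have "Max ((\<lambda>i. \<bar>\<omega> \<bullet> i\<bar>) ` Basis) \<in> (\<lambda>i. \<bar>\<omega> \<bullet> i\<bar>) ` Basis" by (intro Max_in) auto
    then have "infnorm \<omega> \<in> (\<lambda>i. \<bar>\<omega> \<bullet> i\<bar>) ` Basis" by (simp only: infnorm_Max)
    then obtain b where b: "b \<in> Basis" "infnorm \<omega> = \<bar>\<omega> \<bullet> b\<bar>" by blast
    have "norm \<omega> ^ n \<le> (sqrt (real DIM('a)) * \<bar>\<omega> \<bullet> b\<bar>) ^ n"
      using norm_le_infnorm[of \<omega>] b by (intro power_mono) auto
    then have "norm \<omega> ^ n * norm (osc_integral f \<omega>) \<le> sqrt (real DIM('a)) ^ n * (\<bar>\<omega> \<bullet> b\<bar> ^ n * norm (osc_integral f \<omega>))"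
      by (simp add: power_mult_distrib mult_right_mono mult.assoc [symmetric])
    also have "\<bar>\<omega> \<bullet> b\<bar> ^ n * norm (osc_integral f \<omega>) = norm (osc_integral (iter_partial (replicate n b) f) \<omega>)"
      by (simp add: osc_integral_partial_power[OF f b(1)] norm_mult norm_power)
    also have "\<dots> \<le> A b" unfolding A_def by (rule norm_osc_integral_le)
    also have "A b \<le> (\<Sum>b\<in>Basis. A b)" using b A by (intro member_le_sum) auto
    finally show ?thesis by (simp add: B_def mult_left_mono)
  qed
  have "norm (osc_integral f \<omega>) \<le> 2 ^ N * (A0 + B) * decay_weight N \<omega>" for \<omega>
    using norm_osc_integral_le[of f \<omega>] le[of \<omega>] by (intro decay_weight_bound) (auto simp: A0_def n_def)
  then show ?thesis using A0 B by (intro that[of "2 ^ N * (A0 + B)"]) auto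
qed

lemma osc_integral_multiplier_integrable:
  fixes f :: "'a::euclidean_space \<Rightarrow> complex"
  assumes f: "schwartz f" and [measurable]: "m \<in> borel_measurable borel"
    and m: "\<And>\<omega>. \<bar>m \<omega>\<bar> \<le> (1 + (norm \<omega>)\<^sup>2) ^ k * c"
  shows "integrable lborel (\<lambda>\<omega>. complex_of_real (m \<omega>) * osc_integral f \<omega>)"
proof -
  obtain C where C: "C \<ge> 0" "\<And>\<omega>. norm (osc_integral f \<omega>) \<le> C * decay_weight (k + DIM('a)) \<omega>"
    using osc_integral_decay[OF f] by metis
  have [measurable]: "f \<in> borel_measurable borel" using schwartz_measurable[OF f, of "[]"] by simp
  show ?thesis
  proof (rule Bochner_Integration.integrable_bound)
    show "integrable lborel (\<lambda>\<omega>::'a. c * C * decay_weight DIM('a) \<omega>)"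
      by (intro integrable_mult_right integrable_decay_weight)
    show "AE \<omega> in lborel. norm (complex_of_real (m \<omega>) * osc_integral f \<omega>) \<le> norm (c * C * decay_weight DIM('a) \<omega>)"
    proof (rule AE_I2)
      fix \<omega> :: 'a
      have p: "(1 + (norm \<omega>)\<^sup>2) > 0" by (intro add_pos_nonneg) auto
      have "norm (complex_of_real (m \<omega>) * osc_integral f \<omega>) \<le> ((1 + (norm \<omega>)\<^sup>2) ^ k * c) * (C * decay_weight (k + DIM('a)) \<omega>)"
        unfolding norm_mult norm_of_real using m[of \<omega>] C
        by (intro mult_mono) (auto intro: order_trans[OF abs_ge_zero])
      also have "\<dots> = c * C * decay_weight DIM('a) \<omega>"
        using p by (simp add: decay_weight_def power_add)
      also have "\<dots> \<le> norm (c * C * decay_weight DIM('a) \<omega>)" by simp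
      finally show "norm (complex_of_real (m \<omega>) * osc_integral f \<omega>) \<le> norm (c * C * decay_weight DIM('a) \<omega>)" .
    qed
  qed measurable
qed

lemma gaussian_osc_integral:
  fixes x :: "'a::euclidean_space"
  assumes s: "s > 0"
  shows "integrable lborel (\<lambda>\<omega>::'a. exp (- s * (norm \<omega>)\<^sup>2 / 2))"
    and "(LINT \<omega>|lborel. iexp (\<omega> \<bullet> x) * complex_of_real (exp (- s * (norm \<omega>)\<^sup>2 / 2)))
      = complex_of_real ((2 * pi) ^ DIM('a) * heat_kernel s x)"
proof -
  have e: "exp (- s * (norm \<omega>)\<^sup>2 / 2) = (2 * pi / s) powr (DIM('a) / 2) * heat_kernel (1 / s) \<omega>" for \<omega> :: 'a
    using s by (simp add: heat_kernel_def mult.commute)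
  show "integrable lborel (\<lambda>\<omega>::'a. exp (- s * (norm \<omega>)\<^sup>2 / 2))"
    unfolding e using s by (intro integrable_mult_right integrable_heat_kernel) auto
  have "(LINT \<omega>|lborel. iexp (\<omega> \<bullet> x) * complex_of_real (exp (- s * (norm \<omega>)\<^sup>2 / 2)))
     = (LINT \<omega>|lborel. complex_of_real ((2 * pi / s) powr (DIM('a) / 2)) * (iexp (\<omega> \<bullet> x) * complex_of_real (heat_kernel (1 / s) \<omega>)))"
    unfolding e by (simp add: mult_ac)
  also have "\<dots> = complex_of_real ((2 * pi / s) powr (DIM('a) / 2)) * complex_of_real (exp (- (1 / s) * (norm x)\<^sup>2 / 2))"
    using heat_kernel_fourier[of "1 / s" x] s by simp
  also have "\<dots> = complex_of_real ((2 * pi) ^ DIM('a) * heat_kernel s x)"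
  proof -
    have "(2 * pi) ^ DIM('a) = ((2 * pi / s) * (2 * pi * s)) powr (DIM('a) / 2)"
    proof -
      have "(2 * pi / s) * (2 * pi * s) = (2 * pi) powr 2" using s by (simp add: powr_numeral power2_eq_square)
      then show ?thesis by (simp add: powr_powr powr_realpow del: powr_numeral)
    qed
    also have "\<dots> = (2 * pi / s) powr (DIM('a) / 2) * (2 * pi * s) powr (DIM('a) / 2)"
      using s by (intro powr_mult)
    finally show ?thesis using s by (simp add: heat_kernel_def mult.commute)
  qed
  finally show "(LINT \<omega>|lborel. iexp (\<omega> \<bullet> x) * complex_of_real (exp (- s * (norm \<omega>)\<^sup>2 / 2)))
      = complex_of_real ((2 * pi) ^ DIM('a) * heat_kernel s x)" .
qed

lemma integral_swap_bounded_kernel: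
  fixes f g :: "'a::euclidean_space \<Rightarrow> complex" and e :: "'a \<Rightarrow> 'a \<Rightarrow> complex"
  assumes f: "integrable lborel f" and g: "integrable lborel g"
    and [measurable]: "(\<lambda>(x, y). e x y) \<in> borel_measurable (borel \<Otimes>\<^sub>M borel)" and e: "\<And>x y. norm (e x y) = 1"
  shows "(LINT x|lborel. (LINT y|lborel. f x * (e x y * g y))) = (LINT y|lborel. (LINT x|lborel. f x * (e x y * g y)))"
proof -
  have [measurable]: "f \<in> borel_measurable borel" "g \<in> borel_measurable borel"
    using f g by (auto dest: borel_measurable_integrable)
  have "integrable (lborel \<Otimes>\<^sub>M lborel) (\<lambda>(x, y). f x * (e x y * g y))"
  proof (rule lborel_pair.Fubini_integrable)
    show "integrable lborel (\<lambda>x. LINT y|lborel. norm (case (x, y) of (x, y) \<Rightarrow> f x * (e x y * g y)))"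
      using f by (simp add: norm_mult e)
    show "AE x in lborel. integrable lborel (\<lambda>y. case (x, y) of (x, y) \<Rightarrow> f x * (e x y * g y))"
    proof (rule AE_I2)
      fix x :: 'a
      have "integrable lborel (\<lambda>y. e x y * g y)"
        by (rule Bochner_Integration.integrable_bound[OF g]) (auto simp: norm_mult e)
      then show "integrable lborel (\<lambda>y. case (x, y) of (x, y) \<Rightarrow> f x * (e x y * g y))" by simp
    qed
  qed measurable
  from lborel_pair.Fubini_integral[OF this] show ?thesis by simp
qed

text \<open>Gaussian regularisation: inserting \<open>exp (- s |\<omega>|\<^sup>2 / 2)\<close> and exchanging the integrals gives the
  heat average of \<open>f\<close> at the origin, and both sides converge as \<open>s\<close> tends to zero.\<close>

lemma schwartz_inversion_at_0:
  fixes f :: "'a::euclidean_space \<Rightarrow> complex"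
  assumes f: "schwartz f"
  shows "(LINT \<omega>|lborel. osc_integral f \<omega>) = complex_of_real ((2 * pi) ^ DIM('a)) * f 0"
proof -
  define s where "s n = 1 / real (Suc n)" for n
  have s: "s n > 0" for n by (simp add: s_def)
  have s0: "s \<longlonglongrightarrow> 0" unfolding s_def by (rule LIMSEQ_Suc[OF lim_1_over_n])
  have [measurable]: "f \<in> borel_measurable borel" using schwartz_measurable[OF f, of "[]"] by simp
  have fi: "integrable lborel f" using schwartz_integrable[OF f, of "[]"] by simp
  obtain C where C: "\<And>x. norm (f x) \<le> C"
    using schwartz_bounded[OF f, of "[]" 0] by auto
  have cont: "isCont f 0"
    using schwartz_continuous[OF f, of "[]"] by (simp add: continuous_on_eq_continuous_at)
  have oi: "integrable lborel (osc_integral f)"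
    using osc_integral_multiplier_integrable[OF f, of "\<lambda>_. 1" 0 1] by simp
  have "(\<lambda>n. LINT \<omega>|lborel. complex_of_real (exp (- s n * (norm \<omega>)\<^sup>2 / 2)) * osc_integral f \<omega>)
    \<longlonglongrightarrow> (LINT \<omega>|lborel. osc_integral f \<omega>)"
  proof (rule integral_dominated_convergence)
    show "integrable lborel (\<lambda>\<omega>. norm (osc_integral f \<omega>))" using oi by simp
    show "AE \<omega> in lborel. (\<lambda>n. complex_of_real (exp (- s n * (norm \<omega>)\<^sup>2 / 2)) * osc_integral f \<omega>) \<longlonglongrightarrow> osc_integral f \<omega>"
    proof (rule AE_I2)
      fix \<omega> :: 'a
      have "(\<lambda>n. complex_of_real (exp (- s n * (norm \<omega>)\<^sup>2 / 2)) * osc_integral f \<omega>)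
         \<longlonglongrightarrow> complex_of_real (exp (- 0 * (norm \<omega>)\<^sup>2 / 2)) * osc_integral f \<omega>"
        by (intro tendsto_intros s0) auto
      then show "(\<lambda>n. complex_of_real (exp (- s n * (norm \<omega>)\<^sup>2 / 2)) * osc_integral f \<omega>) \<longlonglongrightarrow> osc_integral f \<omega>" by simp
    qed
    show "AE \<omega> in lborel. norm (complex_of_real (exp (- s n * (norm \<omega>)\<^sup>2 / 2)) * osc_integral f \<omega>) \<le> norm (osc_integral f \<omega>)" for n
      using s[of n] by (intro AE_I2) (simp add: norm_mult mult_left_le_one_le)
  qed measurable
  moreover have "(LINT \<omega>|lborel. complex_of_real (exp (- s n * (norm \<omega>)\<^sup>2 / 2)) * osc_integral f \<omega>)
     = complex_of_real ((2 * pi) ^ DIM('a)) * (LINT x|lborel. f x * complex_of_real (heat_kernel (s n) (x - 0)))" for n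
  proof -
    let ?h = "\<lambda>\<omega> x. complex_of_real (exp (- s n * (norm \<omega>)\<^sup>2 / 2)) * (iexp (\<omega> \<bullet> x) * f x)"
    have gi: "integrable lborel (\<lambda>\<omega>::'a. exp (- s n * (norm \<omega>)\<^sup>2 / 2))"
      by (rule gaussian_osc_integral(1)[OF s])
    have "(LINT \<omega>|lborel. (LINT x|lborel. ?h \<omega> x)) = (LINT x|lborel. (LINT \<omega>|lborel. ?h \<omega> x))"
      using gi by (intro integral_swap_bounded_kernel fi integrable_of_real) auto
    also have "\<dots> = (LINT x|lborel. f x * (LINT \<omega>|lborel. iexp (\<omega> \<bullet> x) * complex_of_real (exp (- s n * (norm \<omega>)\<^sup>2 / 2))))"
      by (subst integral_mult_right_zero [symmetric]) (simp add: mult_ac)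
    also have "\<dots> = (LINT x|lborel. complex_of_real ((2 * pi) ^ DIM('a)) * (f x * complex_of_real (heat_kernel (s n) x)))"
      by (simp only: gaussian_osc_integral(2)[OF s]) (simp add: mult_ac)
    finally show ?thesis by (simp add: osc_integral_def)
  qed
  moreover have "(\<lambda>n. complex_of_real ((2 * pi) ^ DIM('a)) * (LINT x|lborel. f x * complex_of_real (heat_kernel (s n) (x - 0))))
     \<longlonglongrightarrow> complex_of_real ((2 * pi) ^ DIM('a)) * f 0"
    by (intro tendsto_mult tendsto_const heat_kernel_approximate_identity[where C = C] cont s s0)
      (use C in \<open>auto\<close>)
  ultimately show ?thesis by (simp add: LIMSEQ_unique)
qed

section \<open>The Green's function\<close>

text \<open>The factor \<open>2\<close> is there because the transform of \<open>K\<^sub>s\<close> is \<open>exp (- s |\<omega>|\<^sup>2 / 2)\<close>. The summand \<open>0\<close>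
  keeps the form \<open>s + 2 l\<^sup>2 t\<close> of the mixtures that serve as test functions.\<close>

definition potential_kernel :: "real \<Rightarrow> real \<Rightarrow> 'a::euclidean_space \<Rightarrow> real" where
  "potential_kernel l \<beta> = heat_mix (distr (gamma_law (\<beta> / 2)) borel (\<lambda>t. 0 + 2 * l\<^sup>2 * t))"

lemma gamma_affine_laplace:
  fixes \<omega> :: "'a::euclidean_space"
  assumes a: "a > 0"
  shows "(LINT s|distr (gamma_law a) borel (\<lambda>t. s0 + 2 * l\<^sup>2 * t). exp (- s * (norm \<omega>)\<^sup>2 / 2))
    = exp (- s0 * (norm \<omega>)\<^sup>2 / 2) * (1 + l\<^sup>2 * (norm \<omega>)\<^sup>2) powr (- a)"
proof -
  have "(LINT s|distr (gamma_law a) borel (\<lambda>t. s0 + 2 * l\<^sup>2 * t). exp (- s * (norm \<omega>)\<^sup>2 / 2))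
    = (LINT t|gamma_law a. exp (- s0 * (norm \<omega>)\<^sup>2 / 2) * exp (- (l\<^sup>2 * (norm \<omega>)\<^sup>2) * t))"
    by (subst integral_distr) (auto simp: exp_add [symmetric] algebra_simps add_divide_distrib diff_divide_distrib)
  also have "\<dots> = exp (- s0 * (norm \<omega>)\<^sup>2 / 2) * (LINT t|gamma_law a. exp (- (l\<^sup>2 * (norm \<omega>)\<^sup>2) * t))"
    by simp
  also have "(LINT t|gamma_law a. exp (- (l\<^sup>2 * (norm \<omega>)\<^sup>2) * t)) = (1 + l\<^sup>2 * (norm \<omega>)\<^sup>2) powr (- a)"
    by (rule gamma_law_laplace) (use a in auto)
  finally show ?thesis .
qed

lemma powr_symbol_bound:
  fixes \<omega> :: "'a::euclidean_space"
  assumes a: "a > 0"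
  shows "\<bar>(1 + l\<^sup>2 * (norm \<omega>)\<^sup>2) powr a\<bar> \<le> (1 + (norm \<omega>)\<^sup>2) ^ nat \<lceil>a\<rceil> * (1 + l\<^sup>2) ^ nat \<lceil>a\<rceil>"
proof -
  have "1 + l\<^sup>2 * (norm \<omega>)\<^sup>2 \<ge> 1" by simp
  then have "(1 + l\<^sup>2 * (norm \<omega>)\<^sup>2) powr a \<le> (1 + l\<^sup>2 * (norm \<omega>)\<^sup>2) powr real (nat \<lceil>a\<rceil>)"
    using a by (intro powr_mono) (auto simp: real_nat_ceiling_ge)
  also have "\<dots> = (1 + l\<^sup>2 * (norm \<omega>)\<^sup>2) ^ nat \<lceil>a\<rceil>"
    by (rule powr_realpow) (intro add_pos_nonneg, auto)
  also have "\<dots> \<le> ((1 + (norm \<omega>)\<^sup>2) * (1 + l\<^sup>2)) ^ nat \<lceil>a\<rceil>"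
    by (intro power_mono) (auto simp: algebra_simps)
  finally show ?thesis by (simp add: power_mult_distrib)
qed

lemma whittle_matern_op_apply:
  fixes G :: "'a::euclidean_space distribution"
  shows "whittle_matern_op l \<beta> G f
    = G (fourier (\<lambda>\<omega>. complex_of_real ((1 + l\<^sup>2 * (norm \<omega>)\<^sup>2) powr (\<beta> / 2)) * inv_fourier f \<omega>))"
  by (simp add: whittle_matern_op_def fourier_multiplier_def inv_fourier_dist_def mult_dist_def fourier_dist_def)

lemma integrable_mult_schwartz:
  assumes g: "integrable lborel (g :: 'a::euclidean_space \<Rightarrow> real)" and f: "schwartz f"
  shows "integrable lborel (\<lambda>v. complex_of_real (g v) * f v)"
proof -
  have [measurable]: "f \<in> borel_measurable borel" using schwartz_measurable[OF f, of "[]"] by simp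
  have [measurable]: "g \<in> borel_measurable borel" using g by (auto dest: borel_measurable_integrable)
  obtain C where C: "C \<ge> 0" "\<And>x. norm (f x) \<le> C" using schwartz_bounded[OF f, of "[]" 0] by auto
  show ?thesis
  proof (rule Bochner_Integration.integrable_bound)
    show "integrable lborel (\<lambda>v. g v * C)" using g by auto
  qed (use C in \<open>auto simp: norm_mult abs_mult intro!: mult_left_mono\<close>)
qed

text \<open>The seminorm of order zero is the supremum norm.\<close>

lemma tempered_distribution_integrable:
  assumes g: "integrable lborel (g :: 'a::euclidean_space \<Rightarrow> real)"
  shows "tempered_distribution (\<lambda>f. LINT v|lborel. complex_of_real (g v) * f v)"
  unfolding tempered_distribution_def
proof (intro conjI allI impI)
  fix f h :: "'a \<Rightarrow> complex" assume "schwartz f" "schwartz h"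
  then show "(LINT v|lborel. complex_of_real (g v) * (f v + h v))
     = (LINT v|lborel. complex_of_real (g v) * f v) + (LINT v|lborel. complex_of_real (g v) * h v)"
    using integrable_mult_schwartz[OF g] by (simp add: distrib_left)
next
  fix c and f :: "'a \<Rightarrow> complex"
  have "(LINT v|lborel. complex_of_real (g v) * (c * f v)) = (LINT v|lborel. c * (complex_of_real (g v) * f v))"
    by (simp add: mult_ac)
  then show "(LINT v|lborel. complex_of_real (g v) * (c * f v)) = c * (LINT v|lborel. complex_of_real (g v) * f v)"
    by simp
next
  have "norm (LINT v|lborel. complex_of_real (g v) * f v) \<le> (LINT v|lborel. \<bar>g v\<bar>) * schwartz_seminorm 0 f"
    if f: "schwartz f" for f
  proof -
    have bdd: "bdd_above (range (\<lambda>x. norm (f x)))"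
    proof -
      obtain C where "\<And>x. norm (f x) \<le> C" using schwartz_bounded[OF f, of "[]" 0] by auto
      then show ?thesis by (intro bdd_aboveI2)
    qed
    have "{bs :: 'a list. bs \<in> lists Basis \<and> length bs \<le> 0} = {[]}" by auto
    then have semi: "schwartz_seminorm 0 f = (SUP x. norm (f x))"
      by (simp add: schwartz_seminorm_def)
    have le: "norm (f v) \<le> schwartz_seminorm 0 f" for v
      unfolding semi by (rule cSUP_upper[OF _ bdd]) simp
    have "norm (LINT v|lborel. complex_of_real (g v) * f v) \<le> (LINT v|lborel. norm (complex_of_real (g v) * f v))"
      by (rule integral_norm_bound)
    also have "\<dots> \<le> (LINT v|lborel. \<bar>g v\<bar> * schwartz_seminorm 0 f)"
    proof (rule integral_mono)
      show "integrable lborel (\<lambda>v. norm (complex_of_real (g v) * f v))"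
        by (rule integrable_norm[OF integrable_mult_schwartz[OF g f]])
      show "integrable lborel (\<lambda>v. \<bar>g v\<bar> * schwartz_seminorm 0 f)" using g by simp
    qed (auto simp: norm_mult intro!: mult_left_mono le)
    finally show ?thesis by simp
  qed
  then show "\<exists>N C. \<forall>f. schwartz f \<longrightarrow> norm (LINT v|lborel. complex_of_real (g v) * f v) \<le> C * schwartz_seminorm N f"
    by blast
qed

text \<open>Exchanging integrals moves the Fourier transform from the test function to the kernel. The
  transform of the kernel is the reciprocal of the symbol, so only the integral of \<open>inv_fourier f\<close>
  is left, which is \<open>f 0\<close>.\<close>

theorem potential_kernel_greens_function:
  assumes \<beta>: "\<beta> > 0" and l: "l > 0"
  defines "G \<equiv> (\<lambda>f. LINT v|lborel. complex_of_real (potential_kernel l \<beta> (v::'a::euclidean_space)) * f v)"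
  shows "greens_function l \<beta> G" and "represents (potential_kernel l \<beta>) G"
proof -
  define Q where "Q = distr (gamma_law (\<beta> / 2)) borel (\<lambda>t. 0 + 2 * l\<^sup>2 * t)"
  interpret Q: scale_law Q unfolding Q_def using \<beta> l by (intro scale_law_gamma_affine) auto
  let ?g = "potential_kernel l \<beta> :: 'a \<Rightarrow> real"
  have g: "?g = heat_mix Q" by (simp add: potential_kernel_def Q_def)
  have gi: "integrable lborel ?g" unfolding g by (rule Q.integrable_heat_mix)
  have [measurable]: "?g \<in> borel_measurable borel" unfolding g by measurable
  show "represents ?g G"
    unfolding represents_def G_def using integrable_mult_schwartz[OF gi] by auto
  have FG: "(LINT x|lborel. exp (- \<i> * complex_of_real (\<omega> \<bullet> x)) * complex_of_real (?g x))
    = complex_of_real ((1 + l\<^sup>2 * (norm \<omega>)\<^sup>2) powr (- (\<beta> / 2)))" for \<omega> :: 'a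
    using Q.heat_mix_fourier[of "- \<omega>"] gamma_affine_laplace[of "\<beta> / 2" 0 l \<omega>] \<beta>
    unfolding g Q_def[symmetric] by (simp add: inner_commute)
  have "whittle_matern_op l \<beta> G f = f 0" if f: "schwartz f" for f
  proof -
    define m where "m \<omega> = (1 + l\<^sup>2 * (norm \<omega>)\<^sup>2) powr (\<beta> / 2)" for \<omega> :: 'a
    define k where "k \<omega> = complex_of_real (m \<omega>) * inv_fourier f \<omega>" for \<omega>
    have [measurable]: "f \<in> borel_measurable borel" using schwartz_measurable[OF f, of "[]"] by simp
    have [measurable]: "m \<in> borel_measurable borel" unfolding m_def by measurable
    have "integrable lborel (\<lambda>\<omega>. complex_of_real (m \<omega>) * osc_integral f \<omega>)"
    proof (rule osc_integral_multiplier_integrable[OF f])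
      show "\<bar>m \<omega>\<bar> \<le> (1 + (norm \<omega>)\<^sup>2) ^ nat \<lceil>\<beta> / 2\<rceil> * (1 + l\<^sup>2) ^ nat \<lceil>\<beta> / 2\<rceil>" for \<omega>
        unfolding m_def by (rule powr_symbol_bound) (use \<beta> in simp)
    qed measurable
    then have ki: "integrable lborel k"
      unfolding k_def inv_fourier_eq_osc times_divide_eq_right by (rule integrable_divide_zero)
    have [measurable]: "k \<in> borel_measurable borel" using ki by (auto dest: borel_measurable_integrable)
    let ?h = "\<lambda>x \<omega>. complex_of_real (?g x) * (exp (- \<i> * complex_of_real (\<omega> \<bullet> x)) * k \<omega>)"
    have swap: "(LINT x|lborel. (LINT \<omega>|lborel. ?h x \<omega>)) = (LINT \<omega>|lborel. (LINT x|lborel. ?h x \<omega>))"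
      using gi by (intro integral_swap_bounded_kernel ki integrable_of_real) auto
    have "whittle_matern_op l \<beta> G f = (LINT x|lborel. complex_of_real (?g x) * fourier k x)"
      unfolding whittle_matern_op_apply G_def k_def m_def ..
    also have "\<dots> = (LINT x|lborel. (LINT \<omega>|lborel. ?h x \<omega>))"
      by (simp add: fourier_def)
    also have "\<dots> = (LINT \<omega>|lborel. (LINT x|lborel. ?h x \<omega>))" by (rule swap)
    also have "\<dots> = (LINT \<omega>|lborel. inv_fourier f \<omega>)"
    proof (intro Bochner_Integration.integral_cong refl)
      fix \<omega> :: 'a
      have "(LINT x|lborel. ?h x \<omega>) = (LINT x|lborel. k \<omega> * (exp (- \<i> * complex_of_real (\<omega> \<bullet> x)) * complex_of_real (?g x)))"
        by (simp add: mult_ac)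
      also have "\<dots> = k \<omega> * complex_of_real ((1 + l\<^sup>2 * (norm \<omega>)\<^sup>2) powr (- (\<beta> / 2)))"
        unfolding integral_mult_right_zero FG ..
      also have "\<dots> = complex_of_real (m \<omega> * (1 + l\<^sup>2 * (norm \<omega>)\<^sup>2) powr (- (\<beta> / 2))) * inv_fourier f \<omega>"
        by (simp add: k_def)
      also have "m \<omega> * (1 + l\<^sup>2 * (norm \<omega>)\<^sup>2) powr (- (\<beta> / 2)) = 1"
      proof -
        have "1 + l\<^sup>2 * (norm \<omega>)\<^sup>2 > 0" by (intro add_pos_nonneg) auto
        then show ?thesis unfolding m_def by (simp add: powr_minus)
      qed
      finally show "(LINT x|lborel. ?h x \<omega>) = inv_fourier f \<omega>" by simp
    qed
    also have "\<dots> = f 0"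
      unfolding inv_fourier_eq_osc integral_divide_zero schwartz_inversion_at_0[OF f] by simp
    finally show ?thesis .
  qed
  then show "greens_function l \<beta> G"
    unfolding greens_function_def dirac_delta_def
    using tempered_distribution_integrable[OF gi] by (simp add: G_def)
qed

lemma scale_law_lower_gamma_affine:
  assumes a: "a > 0" and s: "s > 0" and c: "c > 0"
  shows "scale_law_lower (distr (gamma_law a) borel (\<lambda>t. s + c * t)) s"
proof -
  interpret G: prob_space "gamma_law a" by (rule prob_space_gamma_law) fact
  interpret scale_law "distr (gamma_law a) borel (\<lambda>t. s + c * t)"
    using assms by (intro scale_law_gamma_affine) auto
  have "AE t in gamma_law a. s \<le> s + c * t"
    using AE_gamma_law_pos by eventually_elim (use c in auto)
  moreover have "integrable (gamma_law a) (\<lambda>t. (s + c * t) ^ k)" for k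
  proof -
    have "integrable (gamma_law a) (\<lambda>t. \<Sum>i\<le>k. of_nat (k choose i) * s ^ i * (c * t) ^ (k - i))"
      using integrable_gamma_law_power[OF a]
      by (intro Bochner_Integration.integrable_sum integrable_mult_left integrable_mult_right) (auto simp: power_mult_distrib)
    then show ?thesis by (simp add: binomial_ring)
  qed
  ultimately show ?thesis
  proof (unfold_locales, goal_cases)
    case 1 show ?case by (rule s)
  next
    case 2 then show ?case by (simp add: AE_distr_iff)
  next
    case (3 k) then show ?case by (subst integrable_distr_eq) auto
  qed
qed

lemma scale_law_lower_return:
  assumes "s > 0" shows "scale_law_lower (return borel s) s"
proof -
  interpret scale_law "return borel s" by (rule scale_law_return) fact
  show ?thesis
  proof
    show "AE t in return borel s. s \<le> t" by (simp add: AE_return)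
    show "integrable (return borel s) (\<lambda>t. t ^ k)" for k
      by (rule integrableI_bounded) (auto simp: nn_integral_return)
  qed fact
qed

text \<open>The test function \<open>f\<close>, a mixture of heat kernels, is chosen such that the symbol cancels the mixing
  in its inverse transform and a single Gaussian remains. The equation for the Green's function,
  tested with \<open>f\<close>, then evaluates \<open>G\<close> at a heat kernel.\<close>

theorem greens_function_heat_average:
  fixes a :: "'a::euclidean_space"
  assumes \<beta>: "\<beta> > 0" and l: "l > 0" and s: "s > 0"
    and G: "greens_function l \<beta> G" and g: "represents g G"
  shows "integrable lborel (\<lambda>v. g v * heat_kernel s (v - a))"
    and "(LINT v|lborel. g v * heat_kernel s (v - a))
      = heat_mix (distr (gamma_law (\<beta> / 2)) borel (\<lambda>t. s + 2 * l\<^sup>2 * t)) a"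
proof -
  define Q where "Q = distr (gamma_law (\<beta> / 2)) borel (\<lambda>t. s + 2 * l\<^sup>2 * t)"
  interpret Q: scale_law_lower Q s
    unfolding Q_def using \<beta> l s by (intro scale_law_lower_gamma_affine) auto
  interpret R: scale_law_lower "return borel s" s using s by (rule scale_law_lower_return)
  define f where "f x = complex_of_real (heat_mix Q (x - a))" for x
  have f: "schwartz f" unfolding f_def by (rule Q.schwartz_heat_mix)
  have h: "schwartz (\<lambda>x. complex_of_real (heat_kernel s (x - a)))"
    using R.schwartz_heat_mix[of a] by (simp add: heat_mix_return)
  have mf: "complex_of_real ((1 + l\<^sup>2 * (norm \<omega>)\<^sup>2) powr (\<beta> / 2)) * inv_fourier f \<omega>
     = iexp (\<omega> \<bullet> a) * complex_of_real (exp (- s * (norm \<omega>)\<^sup>2 / 2)) / complex_of_real ((2 * pi) ^ DIM('a))" for \<omega>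
  proof -
    have p: "1 + l\<^sup>2 * (norm \<omega>)\<^sup>2 > 0" by (intro add_pos_nonneg) auto
    have "(LINT s|Q. exp (- s * (norm \<omega>)\<^sup>2 / 2)) = exp (- s * (norm \<omega>)\<^sup>2 / 2) * (1 + l\<^sup>2 * (norm \<omega>)\<^sup>2) powr (- (\<beta> / 2))"
      unfolding Q_def using \<beta> by (intro gamma_affine_laplace) auto
    moreover have "complex_of_real ((1 + l\<^sup>2 * (norm \<omega>)\<^sup>2) powr (\<beta> / 2)) * (A * complex_of_real (E * (1 + l\<^sup>2 * (norm \<omega>)\<^sup>2) powr (- (\<beta> / 2)))) = A * complex_of_real E" for E A
    proof -
      have "(1 + l\<^sup>2 * (norm \<omega>)\<^sup>2) powr (\<beta> / 2) * (E * (1 + l\<^sup>2 * (norm \<omega>)\<^sup>2) powr (- (\<beta> / 2))) = E"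
        using p by (simp add: powr_minus)
      moreover have "complex_of_real c * (A * complex_of_real X) = A * complex_of_real (c * X)" for c X
        by simp
      ultimately show ?thesis by (simp only:)
    qed
    ultimately show ?thesis
      unfolding f_def Q.heat_mix_inv_fourier by (simp only: times_divide_eq_right)
  qed
  have Fh: "fourier (\<lambda>\<omega>. complex_of_real ((1 + l\<^sup>2 * (norm \<omega>)\<^sup>2) powr (\<beta> / 2)) * inv_fourier f \<omega>)
     = (\<lambda>x. complex_of_real (heat_kernel s (x - a)))"
  proof
    fix x
    have "exp (- \<i> * complex_of_real (\<omega> \<bullet> x)) * iexp (\<omega> \<bullet> a) = iexp (\<omega> \<bullet> (a - x))" for \<omega>
      by (simp add: exp_add [symmetric] inner_diff_right algebra_simps)
    then have e: "exp (- \<i> * complex_of_real (\<omega> \<bullet> x)) * (iexp (\<omega> \<bullet> a) * E / D) = iexp (\<omega> \<bullet> (a - x)) * E / D" for \<omega> E D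
      by (simp only: times_divide_eq_right mult.assoc [symmetric])
    have "heat_kernel s (a - x) = heat_kernel s (x - a)" by (simp add: heat_kernel_def norm_minus_commute)
    then show "fourier (\<lambda>\<omega>. complex_of_real ((1 + l\<^sup>2 * (norm \<omega>)\<^sup>2) powr (\<beta> / 2)) * inv_fourier f \<omega>) x
      = complex_of_real (heat_kernel s (x - a))"
      unfolding fourier_def mf e integral_divide_zero gaussian_osc_integral(2)[OF s] by simp
  qed
  have "G (\<lambda>x. complex_of_real (heat_kernel s (x - a))) = f 0"
  proof -
    have "whittle_matern_op l \<beta> G f = f 0"
      using G f unfolding greens_function_def dirac_delta_def by blast
    then show ?thesis unfolding whittle_matern_op_apply Fh .
  qed
  then have eq: "(LINT v|lborel. complex_of_real (g v) * complex_of_real (heat_kernel s (v - a))) = f 0"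
    and int: "integrable lborel (\<lambda>v. complex_of_real (g v) * complex_of_real (heat_kernel s (v - a)))"
    using g h unfolding represents_def by auto
  have c: "complex_of_real (g v) * complex_of_real (heat_kernel s (v - a)) = complex_of_real (g v * heat_kernel s (v - a))" for v
    by simp
  show "integrable lborel (\<lambda>v. g v * heat_kernel s (v - a))"
    using int unfolding c complex_of_real_integrable_eq .
  have "complex_of_real (LINT v|lborel. g v * heat_kernel s (v - a)) = complex_of_real (heat_mix Q (- a))"
    using eq unfolding c integral_complex_of_real by (simp add: f_def)
  moreover have "heat_mix Q (- a) = heat_mix Q a" by (simp add: heat_mix_def)
  ultimately show "(LINT v|lborel. g v * heat_kernel s (v - a)) = heat_mix (distr (gamma_law (\<beta> / 2)) borel (\<lambda>t. s + 2 * l\<^sup>2 * t)) a"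
    unfolding Q_def of_real_eq_iff by simp
qed

section \<open>Completeness of the heat kernels\<close>

text \<open>The positive and the negative part of \<open>D\<close> define two measures that agree on boxes, which generate
  the Borel sets and are stable under intersection.\<close>

lemma AE_zero_if_box_integrals_zero:
  fixes D :: "'a::euclidean_space \<Rightarrow> real"
  assumes int: "\<And>a b. set_integrable lborel (box a b) D"
    and zero: "\<And>a b. (LINT v:box a b|lborel. D v) = 0"
    and [measurable]: "D \<in> borel_measurable borel"
  shows "AE v in lborel. D v = 0"
proof -
  let ?P = "density lborel (\<lambda>v. ennreal (D v))" and ?N = "density lborel (\<lambda>v. ennreal (- D v))"
  have em: "emeasure ?P (box a b) = emeasure ?N (box a b) \<and> emeasure ?P (box a b) \<noteq> \<infinity>" for a b :: 'a
  proof -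
    have i: "integrable lborel (\<lambda>v. indicator (box a b) v * D v)"
      using int[of a b] by (simp add: set_integrable_def)
    have p: "integrable lborel (\<lambda>v. max 0 (indicator (box a b) v * D v))"
      and n: "integrable lborel (\<lambda>v. max 0 (- (indicator (box a b) v * D v)))"
      using i by auto
    have "(LINT v|lborel. max 0 (indicator (box a b) v * D v)) - (LINT v|lborel. max 0 (- (indicator (box a b) v * D v)))
      = (LINT v|lborel. max 0 (indicator (box a b) v * D v) - max 0 (- (indicator (box a b) v * D v)))"
      using p n by simp
    also have "\<dots> = (LINT v|lborel. indicator (box a b) v * D v)"
      by (intro Bochner_Integration.integral_cong) auto
    also have "\<dots> = 0" using zero[of a b] by (simp add: set_lebesgue_integral_def)
    finally have eq: "(LINT v|lborel. max 0 (indicator (box a b) v * D v)) = (LINT v|lborel. max 0 (- (indicator (box a b) v * D v)))" by simp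
    have "emeasure ?P (box a b) = (\<integral>\<^sup>+ v. ennreal (max 0 (indicator (box a b) v * D v)) \<partial>lborel)"
      by (subst emeasure_density) (auto simp: indicator_def max_def ennreal_neg intro!: nn_integral_cong)
    also have "\<dots> = ennreal (LINT v|lborel. max 0 (indicator (box a b) v * D v))"
      by (rule nn_integral_eq_integral[OF p]) auto
    finally have 1: "emeasure ?P (box a b) = ennreal (LINT v|lborel. max 0 (indicator (box a b) v * D v))" .
    have "emeasure ?N (box a b) = (\<integral>\<^sup>+ v. ennreal (max 0 (- (indicator (box a b) v * D v))) \<partial>lborel)"
      by (subst emeasure_density) (auto simp: indicator_def max_def ennreal_neg intro!: nn_integral_cong)
    also have "\<dots> = ennreal (LINT v|lborel. max 0 (- (indicator (box a b) v * D v)))"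
      by (rule nn_integral_eq_integral[OF n]) auto
    finally show ?thesis using 1 eq by simp
  qed
  have "?P = ?N"
  proof (rule measure_eqI_generator_eq)
    let ?E = "range (\<lambda>(a, b). box a b::'a set)"
    show "Int_stable ?E"
      by (auto simp: Int_stable_def box_Int_box)
    show "?E \<subseteq> Pow UNIV" "sets ?P = sigma_sets UNIV ?E" "sets ?N = sigma_sets UNIV ?E"
      by (simp_all add: borel_eq_box)
    let ?A = "\<lambda>n::nat. box (- (real n *\<^sub>R One)) (real n *\<^sub>R One) :: 'a set"
    show "range ?A \<subseteq> ?E" "(\<Union>i. ?A i) = UNIV"
      unfolding UN_box_eq_UNIV by auto
    show "emeasure ?P (?A i) \<noteq> \<infinity>" for i using em by blast
    show "emeasure ?P X = emeasure ?N X" if "X \<in> ?E" for X using that em by auto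
  qed
  then have "AE v in lborel. ennreal (D v) = ennreal (- D v)"
    by (intro sigma_finite_measure.density_unique[OF sigma_finite_lborel]) auto
  then show ?thesis
  proof eventually_elim
    case (elim v)
    show ?case
    proof (cases "D v \<ge> 0")
      case True
      then have "ennreal (D v) = 0" using elim by (simp add: ennreal_neg)
      then show ?thesis using True by (simp add: ennreal_eq_0_iff)
    next
      case False
      then have "ennreal (- D v) = 0" using elim[symmetric] by (simp add: ennreal_neg)
      then show ?thesis using False by (simp add: ennreal_eq_0_iff)
    qed
  qed
qed

lemma heat_kernel_exp_quarter:
  fixes y :: "'a::euclidean_space"
  shows "exp ((norm y)\<^sup>2 / 4) * heat_kernel 1 y = 2 powr (DIM('a) / 2) * heat_kernel 2 y"
proof -
  have "exp ((norm y)\<^sup>2 / 4) * exp (- (norm y)\<^sup>2 / 2) = exp (- (norm y)\<^sup>2 / 4)"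
    by (simp add: exp_add [symmetric])
  moreover have "(2 * pi * 2) powr (DIM('a) / 2) = 2 powr (DIM('a) / 2) * (2 * pi) powr (DIM('a) / 2)"
    using powr_mult[of 2 "2 * pi" "DIM('a) / 2"] by (simp add: mult.commute)
  ultimately show ?thesis by (simp add: heat_kernel_def mult.assoc [symmetric])
qed

text \<open>The hypothesis says that every heat average of \<open>D\<close> vanishes. Averaging over the centres \<open>a\<close> in a box
  shows that \<open>D\<close> is orthogonal to the smoothed indicator of the box. As the scale tends to zero this
  gives integral zero over every box.\<close>

lemma heat_kernel_complete:
  fixes D :: "'a::euclidean_space \<Rightarrow> real"
  assumes D: "square_integrable lborel D"
    and zero: "\<And>s a. s > 0 \<Longrightarrow> (LINT v|lborel. D v * heat_kernel s (v - a)) = 0"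
  shows "AE v in lborel. D v = 0"
proof -
  have [measurable]: "D \<in> borel_measurable borel" and D2: "integrable lborel (\<lambda>v. (D v)\<^sup>2)"
    using D by (auto simp: square_integrable_def)
  have prod_int: "integrable lborel (\<lambda>v. D v * h v)"
    if "h \<in> borel_measurable borel" "integrable lborel (\<lambda>v. (h v)\<^sup>2)" for h
    using that by (intro square_integrable_mult[OF D] square_integrableI) auto
  have int: "set_integrable lborel (box a b) D" for a b :: 'a
  proof -
    have "integrable lborel (indicator (box a b) :: 'a \<Rightarrow> real)"
      using emeasure_lborel_box_finite[of a b] by (intro integrable_real_indicator) auto
    then have "integrable lborel (\<lambda>v. D v * indicator (box a b) v)"
      by (intro prod_int) (auto simp: power2_eq_square indicator_inter_arith [symmetric])
    then show ?thesis by (simp add: set_integrable_def mult.commute)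
  qed
  have K2: "integrable lborel (\<lambda>v. (heat_kernel s (v - a))\<^sup>2)" if s: "s > 0" for s and a :: 'a
  proof (rule Bochner_Integration.integrable_bound)
    show "integrable lborel (\<lambda>v. 1 / (2 * pi * s) powr (DIM('a) / 2) * heat_kernel s (v - a))"
      using s by (intro integrable_mult_right integrable_lborel_translate integrable_heat_kernel)
    show "AE v in lborel. norm ((heat_kernel s (v - a))\<^sup>2) \<le> norm (1 / (2 * pi * s) powr (DIM('a) / 2) * heat_kernel s (v - a))"
    proof (rule AE_I2)
      fix v :: 'a
      have "heat_kernel s (v - a) \<le> 1 / (2 * pi * s) powr (DIM('a) / 2)"
        using s by (simp add: heat_kernel_def divide_right_mono)
      then have "heat_kernel s (v - a) * heat_kernel s (v - a) \<le> 1 / (2 * pi * s) powr (DIM('a) / 2) * heat_kernel s (v - a)"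
        by (intro mult_right_mono) auto
      then show "norm ((heat_kernel s (v - a))\<^sup>2) \<le> norm (1 / (2 * pi * s) powr (DIM('a) / 2) * heat_kernel s (v - a))"
        by (simp add: power2_eq_square)
    qed
  qed measurable
  have box0: "(LINT v:box a b|lborel. D v) = 0" for a b :: 'a
  proof -
    let ?I = "indicator (box a b) :: 'a \<Rightarrow> real"
    define s where "s n = 1 / real (Suc n)" for n
    have s: "s n > 0" "s n \<le> 1" for n by (simp_all add: s_def)
    have s0: "s \<longlonglongrightarrow> 0" unfolding s_def by (rule LIMSEQ_Suc[OF lim_1_over_n])
    define H where "H n v = (LINT w|lborel. ?I w * heat_kernel (s n) (w - v))" for n and v
    have [measurable]: "H n \<in> borel_measurable borel" for n
    proof -
      have "(\<lambda>v. LINT w|lborel. ?I w * heat_kernel (s n) (w - v)) \<in> borel_measurable lborel"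
        by (rule lborel.borel_measurable_lebesgue_integral) measurable
      then show ?thesis unfolding H_def[abs_def] by simp
    qed
    obtain R where R: "\<And>w. w \<in> box a b \<Longrightarrow> norm w \<le> R"
      using bounded_box[of a b] by (auto simp: bounded_iff)
    \<comment> \<open>Exchanging the integrals leaves heat averages of \<open>D\<close>, which vanish; the Cauchy--Schwarz
      inequality and translation invariance bound the absolute integrals uniformly in the centre.\<close>
    have HD: "(LINT v|lborel. D v * H n v) = 0" for n
    proof -
      let ?h = "\<lambda>w v. ?I w * (D v * heat_kernel (s n) (v - w))"
      have bI: "integrable lborel (\<lambda>w. ?I w * c)" for c :: real
        by (intro integrable_mult_left integrable_real_indicator) (auto simp: emeasure_lborel_box_eq)
      have "integrable (lborel \<Otimes>\<^sub>M lborel) (case_prod ?h)"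
      proof (rule lborel_pair.Fubini_integrable)
        let ?B = "sqrt (LINT v|lborel. (D v)\<^sup>2) * sqrt (LINT v|lborel. (heat_kernel (s n) (v::'a))\<^sup>2)"
        have le: "(LINT v|lborel. \<bar>D v * heat_kernel (s n) (v - w)\<bar>) \<le> ?B" for w
        proof -
          have "(LINT v|lborel. (\<lambda>v. (heat_kernel (s n) v)\<^sup>2) (v - w)) = (LINT v|lborel. (heat_kernel (s n) (v::'a))\<^sup>2)"
            by (rule integral_lborel_translate) measurable
          then show ?thesis
            using L2_cauchy_schwarz[OF D square_integrableI[OF _ K2[OF s(1)]], of n w] by simp
        qed
        show "integrable lborel (\<lambda>w. LINT v|lborel. norm (case (w, v) of (w, v) \<Rightarrow> ?h w v))"
        proof (rule Bochner_Integration.integrable_bound[OF bI])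
          show "AE w in lborel. norm (LINT v|lborel. norm (case (w, v) of (w, v) \<Rightarrow> ?h w v))
            \<le> norm (?I w * ?B)"
          proof (rule AE_I2)
            fix w :: 'a
            have "(LINT v|lborel. norm (case (w, v) of (w, v) \<Rightarrow> ?h w v)) = ?I w * (LINT v|lborel. \<bar>D v * heat_kernel (s n) (v - w)\<bar>)"
              by (simp add: abs_mult)
            then show "norm (LINT v|lborel. norm (case (w, v) of (w, v) \<Rightarrow> ?h w v))
              \<le> norm (?I w * ?B)"
              using le[of w] by (simp add: abs_mult indicator_def)
          qed
        qed measurable
        show "AE w in lborel. integrable lborel (\<lambda>v. case (w, v) of (w, v) \<Rightarrow> ?h w v)"
          using prod_int[OF _ K2[OF s(1)]] by (intro AE_I2) auto
      qed measurable
      from lborel_pair.Fubini_integral[OF this]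
      have "(LINT v|lborel. (LINT w|lborel. ?h w v)) = (LINT w|lborel. (LINT v|lborel. ?h w v))" by simp
      moreover have "(LINT w|lborel. (LINT v|lborel. ?h w v)) = 0"
        using zero[OF s(1)] by simp
      moreover have "(LINT w|lborel. ?h w v) = D v * H n v" for v
      proof -
        have "heat_kernel (s n) (v - w) = heat_kernel (s n) (w - v)" for w
          by (simp add: heat_kernel_def norm_minus_commute)
        then have "(LINT w|lborel. ?h w v) = (LINT w|lborel. D v * (?I w * heat_kernel (s n) (w - v)))"
          by (simp add: mult_ac)
        then show ?thesis by (simp add: H_def)
      qed
      ultimately show ?thesis by simp
    qed
    have H_eq: "complex_of_real (H n v) = (LINT y|lborel. complex_of_real (?I (v + sqrt (s n) *\<^sub>R y)) * complex_of_real (heat_kernel 1 y))" for n v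
      unfolding H_def using integral_heat_kernel_rescale[OF s(1), of "\<lambda>w. complex_of_real (?I w)" n v]
      by (simp flip: of_real_mult)
    have H_eq': "H n v = (LINT y|lborel. ?I (v + sqrt (s n) *\<^sub>R y) * heat_kernel 1 y)" for n v
      using H_eq[of n v] unfolding of_real_mult[symmetric] integral_complex_of_real of_real_eq_iff .
    \<comment> \<open>A point of the box within distance \<open>|y|\<close> of \<open>v\<close> forces \<open>|v|\<^sup>2 \<le> 2 R\<^sup>2 + 2 |y|\<^sup>2\<close>; one eighth of
      this inequality in the exponent leaves the factor \<open>exp (|y|\<^sup>2 / 4)\<close>, which the kernel absorbs
      at the price of doubling its scale.\<close>
    have Hb: "\<bar>H n v\<bar> \<le> exp (R\<^sup>2 / 4) * 2 powr (DIM('a) / 2) * exp (- (norm v)\<^sup>2 / 8)" for n v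
    proof -
      have "0 \<le> H n v" unfolding H_def by (intro integral_nonneg_AE AE_I2) auto
      then have "\<bar>H n v\<bar> = (LINT y|lborel. ?I (v + sqrt (s n) *\<^sub>R y) * heat_kernel 1 y)" by (simp add: H_eq')
      also have "\<dots> \<le> (LINT y|lborel. exp (R\<^sup>2 / 4) * 2 powr (DIM('a) / 2) * exp (- (norm v)\<^sup>2 / 8) * heat_kernel 2 (y::'a))"
      proof (rule integral_mono_AE')
        show "integrable lborel (\<lambda>y::'a. exp (R\<^sup>2 / 4) * 2 powr (DIM('a) / 2) * exp (- (norm v)\<^sup>2 / 8) * heat_kernel 2 y)"
          by (intro integrable_mult_right integrable_heat_kernel) simp
        show "AE y in lborel. ?I (v + sqrt (s n) *\<^sub>R y) * heat_kernel 1 y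
           \<le> exp (R\<^sup>2 / 4) * 2 powr (DIM('a) / 2) * exp (- (norm v)\<^sup>2 / 8) * heat_kernel 2 y"
        proof (rule AE_I2)
          fix y :: 'a
          let ?w = "v + sqrt (s n) *\<^sub>R y"
          show "?I ?w * heat_kernel 1 y \<le> exp (R\<^sup>2 / 4) * 2 powr (DIM('a) / 2) * exp (- (norm v)\<^sup>2 / 8) * heat_kernel 2 y"
          proof (cases "?w \<in> box a b")
            case True
            have "norm v \<le> norm ?w + norm (sqrt (s n) *\<^sub>R y)"
              using norm_triangle_ineq4[of ?w "sqrt (s n) *\<^sub>R y"] by simp
            also have "\<dots> \<le> R + norm y"
            proof (intro add_mono R True)
              have "sqrt (s n) \<le> 1" using s[of n] by simp
              then show "norm (sqrt (s n) *\<^sub>R y) \<le> norm y"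
                using s[of n] by (simp add: mult_left_le_one_le)
            qed
            finally have "(norm v)\<^sup>2 \<le> (R + norm y)\<^sup>2" by (intro power_mono) auto
            moreover have "(R + norm y)\<^sup>2 \<le> 2 * R\<^sup>2 + 2 * (norm y)\<^sup>2"
              using sum_squares_bound[of R "norm y"] by (simp add: power2_sum)
            ultimately have "0 \<le> R\<^sup>2 / 4 - (norm v)\<^sup>2 / 8 + (norm y)\<^sup>2 / 4" by simp
            then have "1 \<le> exp (R\<^sup>2 / 4 - (norm v)\<^sup>2 / 8 + (norm y)\<^sup>2 / 4)" by simp
            also have "\<dots> = exp (R\<^sup>2 / 4) * exp (- (norm v)\<^sup>2 / 8) * exp ((norm y)\<^sup>2 / 4)"
              by (simp add: exp_add [symmetric])
            finally have "1 * heat_kernel 1 y \<le> exp (R\<^sup>2 / 4) * exp (- (norm v)\<^sup>2 / 8) * exp ((norm y)\<^sup>2 / 4) * heat_kernel 1 y"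
              by (intro mult_right_mono) auto
            also have "\<dots> = exp (R\<^sup>2 / 4) * exp (- (norm v)\<^sup>2 / 8) * (exp ((norm y)\<^sup>2 / 4) * heat_kernel 1 y)"
              by (simp add: mult.assoc)
            finally show ?thesis unfolding heat_kernel_exp_quarter using True by (simp add: mult_ac)
          qed simp
        qed
      qed auto
      also have "\<dots> = exp (R\<^sup>2 / 4) * 2 powr (DIM('a) / 2) * exp (- (norm v)\<^sup>2 / 8)"
        by (simp add: integral_heat_kernel)
      finally show ?thesis .
    qed
    \<comment> \<open>The indicator is continuous off the boundary of the box, which is a null set.\<close>
    have Hl: "(\<lambda>n. H n v) \<longlonglongrightarrow> ?I v" if v: "v \<notin> cbox a b - box a b" for v
    proof -
      have "isCont (\<lambda>w. complex_of_real (?I w)) v"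
      proof (cases "v \<in> box a b")
        case True
        then have "\<forall>\<^sub>F w in nhds v. complex_of_real (?I w) = 1"
          using eventually_nhds_in_open[OF open_box True] by (auto elim: eventually_mono)
        then show ?thesis using isCont_cong[of "\<lambda>w. complex_of_real (?I w)" "\<lambda>_. 1" v] by simp
      next
        case False
        then have "v \<in> - cbox a b" using v by auto
        then have "\<forall>\<^sub>F w in nhds v. w \<in> - cbox a b" by (intro eventually_nhds_in_open) auto
        then have "\<forall>\<^sub>F w in nhds v. complex_of_real (?I w) = 0"
          by eventually_elim (use box_subset_cbox[of a b] in \<open>auto simp: indicator_def\<close>)
        then show ?thesis using isCont_cong[of "\<lambda>w. complex_of_real (?I w)" "\<lambda>_. 0" v] by simp
      qed
      then have "(\<lambda>n. LINT w|lborel. complex_of_real (?I w) * complex_of_real (heat_kernel (s n) (w - v))) \<longlonglongrightarrow> complex_of_real (?I v)"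
        by (intro heat_kernel_approximate_identity[where C = 1] s s0) (auto simp: indicator_def)
      then have "(\<lambda>n. complex_of_real (H n v)) \<longlonglongrightarrow> complex_of_real (?I v)"
        unfolding H_def of_real_mult[symmetric] integral_complex_of_real .
      then show ?thesis by (simp only: tendsto_of_real_iff)
    qed
    have bnull: "AE v in lborel. v \<notin> cbox a b - box a b"
    proof (rule AE_not_in)
      show "cbox a b - box a b \<in> null_sets lborel"
        by (auto simp: null_sets_def emeasure_Diff emeasure_lborel_cbox_eq emeasure_lborel_box_eq box_subset_cbox)
    qed
    have "(\<lambda>n. LINT v|lborel. D v * H n v) \<longlonglongrightarrow> (LINT v|lborel. D v * ?I v)"
    proof (rule integral_dominated_convergence)
      let ?w = "\<lambda>v::'a. exp (R\<^sup>2 / 4) * 2 powr (DIM('a) / 2) * exp (- (norm v)\<^sup>2 / 8)"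
      have "(\<lambda>v. (exp (- (norm v)\<^sup>2 / 8))\<^sup>2) = (\<lambda>v::'a. exp (- (1 / 2) * (norm v)\<^sup>2 / 2))"
        by (simp add: exp_double [symmetric])
      then have "integrable lborel (\<lambda>v::'a. (exp (- (norm v)\<^sup>2 / 8))\<^sup>2)"
        using gaussian_osc_integral(1)[of "1/2", where 'a = 'a] by simp
      then have "integrable lborel (\<lambda>v. (?w v)\<^sup>2)" by (simp add: power_mult_distrib)
      then have "integrable lborel (\<lambda>v. D v * ?w v)" by (intro prod_int) measurable
      then show "integrable lborel (\<lambda>v. \<bar>D v * ?w v\<bar>)" by (rule integrable_abs)
      show "AE v in lborel. (\<lambda>n. D v * H n v) \<longlonglongrightarrow> D v * ?I v"
        using bnull by eventually_elim (intro tendsto_intros Hl)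
      show "AE v in lborel. norm (D v * H n v) \<le> \<bar>D v * ?w v\<bar>" for n
        using Hb by (intro AE_I2) (simp add: abs_mult mult_left_mono)
    qed measurable
    then have "(LINT v|lborel. D v * ?I v) = 0"
      using LIMSEQ_unique[of "\<lambda>n. 0" 0] by (simp add: HD LIMSEQ_const_iff)
    then show ?thesis by (simp add: set_lebesgue_integral_def mult.commute)
  qed
  show ?thesis
    by (rule AE_zero_if_box_integrals_zero[OF int box0]) measurable
qed

section \<open>The autocovariance of the Green's function\<close>

lemma potential_kernel_scale_law:
  assumes "\<beta> > 0" "l > 0"
  shows "scale_law (distr (gamma_law (\<beta> / 2)) borel (\<lambda>t. 0 + 2 * l\<^sup>2 * t))"
  using assms by (intro scale_law_gamma_affine) auto

lemma nn_integral_potential_kernel_product: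
  fixes u u' :: "'a::euclidean_space"
  assumes \<beta>: "\<beta> > 0" and l: "l > 0"
  shows "(\<integral>\<^sup>+ v. ennreal (potential_kernel l \<beta> (u - v)) * ennreal (potential_kernel l \<beta> (u' - v)) \<partial>lborel)
    = (\<integral>\<^sup>+ r. ennreal (heat_kernel (2 * l\<^sup>2 * r) (u - u')) \<partial>gamma_law \<beta>)"
proof -
  define Q where "Q = distr (gamma_law (\<beta> / 2)) borel (\<lambda>t. 0 + 2 * l\<^sup>2 * t)"
  have Q: "scale_law Q" unfolding Q_def by (rule potential_kernel_scale_law[OF \<beta> l])
  interpret Q: scale_law Q by (rule Q)
  have "(\<integral>\<^sup>+ v. ennreal (potential_kernel l \<beta> (u - v)) * ennreal (potential_kernel l \<beta> (u' - v)) \<partial>lborel)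
    = (\<integral>\<^sup>+ s. (\<integral>\<^sup>+ t. ennreal (heat_kernel (s + t) (u - u')) \<partial>Q) \<partial>Q)"
    unfolding potential_kernel_def Q_def[symmetric] by (rule Q.nn_integral_heat_mix_convolution[OF Q])
  also have "\<dots> = (\<integral>\<^sup>+ s. (\<integral>\<^sup>+ t. ennreal (heat_kernel (2 * l\<^sup>2 * (s + t)) (u - u')) \<partial>gamma_law (\<beta> / 2)) \<partial>gamma_law (\<beta> / 2))"
  proof -
    interpret G: prob_space "gamma_law (\<beta> / 2)" by (rule prob_space_gamma_law) (use \<beta> in simp)
    have "(\<integral>\<^sup>+ t. ennreal (heat_kernel (s + t) (u - u')) \<partial>Q) = (\<integral>\<^sup>+ t. ennreal (heat_kernel (s + 2 * l\<^sup>2 * t) (u - u')) \<partial>gamma_law (\<beta> / 2))" for s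
      unfolding Q_def by (subst nn_integral_distr) auto
    then have "(\<integral>\<^sup>+ s. (\<integral>\<^sup>+ t. ennreal (heat_kernel (s + t) (u - u')) \<partial>Q) \<partial>Q)
       = (\<integral>\<^sup>+ s. (\<integral>\<^sup>+ t. ennreal (heat_kernel (s + 2 * l\<^sup>2 * t) (u - u')) \<partial>gamma_law (\<beta> / 2)) \<partial>Q)" by simp
    also have "\<dots> = (\<integral>\<^sup>+ s. (\<integral>\<^sup>+ t. ennreal (heat_kernel ((0 + 2 * l\<^sup>2 * s) + 2 * l\<^sup>2 * t) (u - u')) \<partial>gamma_law (\<beta> / 2)) \<partial>gamma_law (\<beta> / 2))"
      unfolding Q_def by (rule nn_integral_distr) measurable
    finally show ?thesis by (simp add: distrib_left)
  qed
  also have "\<dots> = (\<integral>\<^sup>+ r. ennreal (heat_kernel (2 * l\<^sup>2 * r) (u - u')) \<partial>gamma_law (\<beta> / 2 + \<beta> / 2))"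
    using \<beta> by (intro gamma_law_convolution[where f = "\<lambda>r. ennreal (heat_kernel (2 * l\<^sup>2 * r) (u - u'))"]) auto
  finally show ?thesis by simp
qed

text \<open>The autocorrelation of the kernel at the origin, that is, the marginal variance of the field.\<close>

definition matern_variance :: "real \<Rightarrow> real \<Rightarrow> real \<Rightarrow> real" where
  "matern_variance d l \<nu> = Gamma \<nu> / (Gamma (\<nu> + d / 2) * (4 * pi * l\<^sup>2) powr (d / 2))"

lemma matern_variance_pos:
  assumes "\<nu> > 0" "l > 0" "d \<ge> 0" shows "matern_variance d l \<nu> > 0"
  using assms by (auto simp: matern_variance_def intro!: divide_pos_pos mult_pos_pos Gamma_real_pos)

text \<open>The factor \<open>r powr (- d/2)\<close> of the kernel lowers the shape from \<open>\<nu> + d/2\<close> to \<open>\<nu>\<close>.\<close>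

lemma nn_integral_gamma_heat_kernel:
  fixes x :: "'a::euclidean_space"
  assumes \<nu>: "\<nu> > 0" and l: "l > 0"
  shows "(\<integral>\<^sup>+ r. ennreal (heat_kernel (2 * l\<^sup>2 * r) x) \<partial>gamma_law (\<nu> + DIM('a) / 2))
    = ennreal (matern_variance DIM('a) l \<nu> / Gamma \<nu> * macdonald_integral \<nu> ((norm x / l)\<^sup>2 / 4))"
proof -
  let ?d = "real DIM('a)" and ?z = "(norm x / l)\<^sup>2 / 4"
  have b: "\<nu> + ?d / 2 > 0" using \<nu> by simp
  have G: "Gamma (\<nu> + ?d / 2) > 0" "Gamma \<nu> > 0" using b \<nu> by auto
  have z: "?z > 0 \<or> ?z = 0 \<and> \<nu> > 0" using \<nu> by (cases "x = 0") (use l in auto)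
  define c where "c = matern_variance ?d l \<nu> / Gamma \<nu>"
  have c: "c = 1 / (Gamma (\<nu> + ?d / 2) * (4 * pi * l\<^sup>2) powr (?d / 2))"
    using G by (simp add: c_def matern_variance_def)
  have "(\<integral>\<^sup>+ r. ennreal (heat_kernel (2 * l\<^sup>2 * r) x) \<partial>gamma_law (\<nu> + ?d / 2))
     = (\<integral>\<^sup>+ r. ennreal (gamma_density (\<nu> + ?d / 2) r) * ennreal (heat_kernel (2 * l\<^sup>2 * r) x) \<partial>lborel)"
    by (rule nn_integral_gamma_law) measurable
  also have "\<dots> = (\<integral>\<^sup>+ r. ennreal (c * (indicator {0<..} r *\<^sub>R (r powr (\<nu> - 1) * exp (- r - ?z / r)))) \<partial>lborel)"
  proof (rule nn_integral_cong)
    fix r :: real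
    have "gamma_density (\<nu> + ?d / 2) r * heat_kernel (2 * l\<^sup>2 * r) x
       = c * (indicator {0<..} r *\<^sub>R (r powr (\<nu> - 1) * exp (- r - ?z / r)))"
    proof (cases "r > 0")
      case True
      have "2 * pi * (2 * l\<^sup>2 * r) = (4 * pi * l\<^sup>2) * r" by simp
      then have p: "(2 * pi * (2 * l\<^sup>2 * r)) powr (?d / 2) = (4 * pi * l\<^sup>2) powr (?d / 2) * r powr (?d / 2)"
        using True l by (simp only:) (intro powr_mult)
      have q: "r powr (\<nu> + ?d / 2 - 1) = r powr (\<nu> - 1) * r powr (?d / 2)"
        by (simp add: powr_add [symmetric] algebra_simps)
      have e: "exp (- r - ?z / r) = exp (- r) * exp (- (norm x)\<^sup>2 / (2 * (2 * l\<^sup>2 * r)))"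
        by (simp add: exp_add [symmetric] power_divide)
      have rp: "r powr (?d / 2) > 0" using True by simp
      show ?thesis
        unfolding gamma_density_def heat_kernel_def p q e c using True rp by simp
    qed (simp add: gamma_density_def)
    then show "ennreal (gamma_density (\<nu> + ?d / 2) r) * ennreal (heat_kernel (2 * l\<^sup>2 * r) x)
      = ennreal (c * (indicator {0<..} r *\<^sub>R (r powr (\<nu> - 1) * exp (- r - ?z / r))))"
      using b by (simp only: ennreal_mult' [symmetric] gamma_density_nonneg)
  qed
  also have "\<dots> = ennreal (LINT r|lborel. c * (indicator {0<..} r *\<^sub>R (r powr (\<nu> - 1) * exp (- r - ?z / r))))"
  proof (rule nn_integral_eq_integral)
    show "integrable lborel (\<lambda>r. c * (indicator {0<..} r *\<^sub>R (r powr (\<nu> - 1) * exp (- r - ?z / r))))"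
      using macdonald_integrable[OF z] by (intro integrable_mult_right) (simp add: set_integrable_def)
    have "c \<ge> 0" unfolding c using G by simp
    then show "AE r in lborel. 0 \<le> c * (indicator {0<..} r *\<^sub>R (r powr (\<nu> - 1) * exp (- r - ?z / r)))"
      by (intro AE_I2) simp
  qed
  also have "(LINT r|lborel. c * (indicator {0<..} r *\<^sub>R (r powr (\<nu> - 1) * exp (- r - ?z / r)))) = c * macdonald_integral \<nu> ?z"
    by (simp add: macdonald_integral_def set_lebesgue_integral_def)
  finally show ?thesis unfolding c_def .
qed

lemma matern_cov_eq_macdonald:
  assumes \<nu>: "\<nu> > 0" and l: "l > 0" and r: "r \<ge> 0"
  shows "matern_cov \<sigma>2 \<nu> l r = \<sigma>2 / Gamma \<nu> * macdonald_integral \<nu> ((r / l)\<^sup>2 / 4)"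
proof (cases "r = 0")
  case True
  have "Gamma \<nu> > 0" using \<nu> by simp
  then show ?thesis using True by (simp add: matern_cov_def macdonald_integral_0[OF \<nu>])
next
  case False
  define z where "z = r / l"
  have z: "z > 0" using False r l by (simp add: z_def)
  have "z powr \<nu> * (z / 2) powr (- \<nu>) = 2 powr \<nu>"
    using z by (simp add: powr_divide powr_minus field_simps)
  then have "z powr \<nu> * bessel_K \<nu> z = 2 powr (\<nu> - 1) * macdonald_integral \<nu> (z\<^sup>2 / 4)"
    unfolding bessel_K_eq_integral[OF \<nu> z] by (simp add: powr_diff mult.assoc [symmetric])
  then show ?thesis using False by (simp add: matern_cov_def z_def)
qed

text \<open>For \<open>u = u'\<close> this is also the square integrability of the kernel.\<close>

theorem potential_kernel_autocovariance:
  fixes u u' :: "'a::euclidean_space"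
  assumes \<nu>: "\<nu> > 0" and l: "l > 0" and \<beta>: "\<beta> = \<nu> + DIM('a) / 2"
  shows "has_bochner_integral lborel (\<lambda>v. potential_kernel l \<beta> (u - v) * potential_kernel l \<beta> (u' - v))
    (matern_cov (matern_variance DIM('a) l \<nu>) \<nu> l (norm (u - u')))"
proof -
  have b: "\<beta> > 0" using \<nu> \<beta> by simp
  interpret Q: scale_law "distr (gamma_law (\<beta> / 2)) borel (\<lambda>t. 0 + 2 * l\<^sup>2 * t)"
    by (rule potential_kernel_scale_law[OF b l])
  have [measurable]: "(potential_kernel l \<beta> :: 'a \<Rightarrow> real) \<in> borel_measurable borel"
    unfolding potential_kernel_def by measurable
  have nn: "potential_kernel l \<beta> x \<ge> 0" for x :: 'a
    unfolding potential_kernel_def by (rule Q.heat_mix_nonneg)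
  have z: "(norm (u - u') / l)\<^sup>2 / 4 > 0 \<or> (norm (u - u') / l)\<^sup>2 / 4 = 0 \<and> \<nu> > 0"
    using \<nu> by (cases "u = u'") (use l in auto)
  have v: "matern_cov (matern_variance DIM('a) l \<nu>) \<nu> l (norm (u - u'))
    = matern_variance DIM('a) l \<nu> / Gamma \<nu> * macdonald_integral \<nu> ((norm (u - u') / l)\<^sup>2 / 4)"
    using \<nu> l by (intro matern_cov_eq_macdonald) auto
  have G: "Gamma \<nu> > 0" using \<nu> by simp
  have "(\<integral>\<^sup>+ v. ennreal (potential_kernel l \<beta> (u - v) * potential_kernel l \<beta> (u' - v)) \<partial>lborel)
    = ennreal (matern_cov (matern_variance DIM('a) l \<nu>) \<nu> l (norm (u - u')))"
    using nn_integral_potential_kernel_product[OF b l, of u u'] nn_integral_gamma_heat_kernel[OF \<nu> l, of "u - u'"]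
    unfolding v \<beta>[symmetric] by (simp add: ennreal_mult' nn)
  moreover have "matern_cov (matern_variance DIM('a) l \<nu>) \<nu> l (norm (u - u')) \<ge> 0"
    unfolding v using matern_variance_pos[OF \<nu> l, of "DIM('a)"] macdonald_integral_pos[OF z] G by simp
  ultimately show ?thesis
    by (intro has_bochner_integral_nn_integral) (auto simp: nn)
qed

section \<open>White noise integrals\<close>

definition basis_coeff :: "(nat \<Rightarrow> 'a::euclidean_space \<Rightarrow> real) \<Rightarrow> ('a \<Rightarrow> real) \<Rightarrow> nat \<Rightarrow> real" where
  "basis_coeff \<phi> f j = (LINT v|lborel. f v * \<phi> j v)"

lemma norm_iexp_diff_le: "norm (exp (\<i> * complex_of_real x) - exp (\<i> * complex_of_real y)) \<le> \<bar>x - y\<bar>"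
proof -
  have "exp (\<i> * complex_of_real x) - exp (\<i> * complex_of_real y)
    = exp (\<i> * complex_of_real y) * (iexp (x - y) - 1)"
    by (simp add: exp_diff right_diff_distrib)
  then have "norm (exp (\<i> * complex_of_real x) - exp (\<i> * complex_of_real y)) = norm (iexp (x - y) - 1)"
    by (simp add: norm_mult)
  also have "\<dots> \<le> \<bar>x - y\<bar>" using iexp_approx1[of "x - y" 0] by simp
  finally show ?thesis .
qed

locale gaussian_white_noise = prob_space M for M :: "'w measure" +
  fixes \<phi> :: "nat \<Rightarrow> 'a::euclidean_space \<Rightarrow> real" and \<xi> :: "nat \<Rightarrow> 'w \<Rightarrow> real"
  assumes wn: "white_noise M \<phi> \<xi>"
begin

lemma onb: "orthonormal_basis_L2 \<phi>"
  and indep: "indep_vars (\<lambda>_. borel) \<xi> UNIV"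
  and normal: "distributed M lborel (\<xi> j) std_normal_density"
  using wn by (auto simp: white_noise_def)

lemma \<xi>_measurable [measurable]: "\<xi> j \<in> borel_measurable M"
  using distributed_measurable[OF normal] by simp

lemma \<xi>_distr: "distr M borel (\<xi> j) = std_normal_distribution"
  using distributed_distr_eq_density[OF normal, of j] by (simp cong: distr_cong)

lemma \<xi>_mean: "expectation (\<xi> j) = 0"
  by (rule standard_normal_distributed_expectation[OF normal])

lemma \<xi>_square_integrable: "square_integrable M (\<xi> j)"
proof (rule square_integrableI)
  have "integrable lborel (\<lambda>x. std_normal_density x * x ^ 2)"
    by (rule integrable_std_normal_moment)
  then show "integrable M (\<lambda>w. (\<xi> j w)\<^sup>2)"
    using distributed_integrable[OF normal, of "\<lambda>x. x\<^sup>2" j] by simp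
qed measurable

lemma \<xi>_orthonormal: "expectation (\<lambda>w. \<xi> i w * \<xi> j w) = (if i = j then 1 else 0)"
proof (cases "i = j")
  case True
  have "expectation (\<lambda>w. (\<xi> j w)\<^sup>2) = 1"
    using standard_normal_distributed_variance[OF normal, of j] by (simp add: \<xi>_mean)
  then show ?thesis using True by (simp add: power2_eq_square)
next
  case False
  have one: "square_integrable M (\<lambda>x. 1)" by (simp add: square_integrable_def)
  have int: "integrable M (\<xi> k)" for k
    using square_integrable_mult[OF \<xi>_square_integrable one, of k] by simp
  have "indep_vars (\<lambda>_. borel) \<xi> {i, j}" by (rule indep_vars_subset[OF indep]) auto
  from indep_vars_lebesgue_integral[OF _ this] int
  have "expectation (\<lambda>w. \<Prod>k\<in>{i, j}. \<xi> k w) = (\<Prod>k\<in>{i, j}. expectation (\<xi> k))" by simp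
  then show ?thesis using False by (simp add: \<xi>_mean)
qed

lemma series_char:
  "char (distr M borel (\<lambda>w. \<Sum>j<n. \<xi> j w * a j)) t = complex_of_real (exp (- (\<Sum>j<n. (a j)\<^sup>2) * t\<^sup>2 / 2))"
proof -
  have "indep_vars (\<lambda>_. borel) (\<lambda>j w. (\<lambda>x. x * a j) (\<xi> j w)) {..<n}"
    by (rule indep_vars_compose2[OF indep_vars_subset[OF indep]]) auto
  then have "char (distr M borel (\<lambda>w. \<Sum>j<n. \<xi> j w * a j)) t = (\<Prod>j<n. char (distr M borel (\<lambda>w. \<xi> j w * a j)) t)"
    by (rule char_distr_sum)
  also have "\<dots> = (\<Prod>j<n. complex_of_real (exp (- ((a j)\<^sup>2 * t\<^sup>2) / 2)))"
  proof (rule prod.cong)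
    fix j
    have "char (distr M borel (\<lambda>w. \<xi> j w * a j)) t = char (distr M borel (\<xi> j)) (a j * t)"
      unfolding char_def by (simp add: integral_distr mult_ac)
    also have "\<dots> = complex_of_real (exp (- ((a j)\<^sup>2 * t\<^sup>2) / 2))"
      unfolding \<xi>_distr char_std_normal_distribution by (simp add: power_mult_distrib)
    finally show "char (distr M borel (\<lambda>w. \<xi> j w * a j)) t = complex_of_real (exp (- ((a j)\<^sup>2 * t\<^sup>2) / 2))" .
  qed simp
  also have "\<dots> = complex_of_real (exp (\<Sum>j<n. - ((a j)\<^sup>2 * t\<^sup>2) / 2))"
    by (simp add: exp_sum)
  also have "(\<Sum>j<n. - ((a j)\<^sup>2 * t\<^sup>2) / 2) = - (\<Sum>j<n. (a j)\<^sup>2) * t\<^sup>2 / 2"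
    by (simp add: sum_distrib_right sum_divide_distrib sum_negf)
  finally show ?thesis .
qed

lemma series_inner:
  "expectation (\<lambda>w. (\<Sum>j<n. \<xi> j w * a j) * (\<Sum>j<n. \<xi> j w * b j)) = (\<Sum>j<n. a j * b j)"
  using orthonormal_sum_inner[of M \<xi> "{..<n}" a b, OF \<xi>_square_integrable \<xi>_orthonormal]
  by (simp add: mult.commute)

text \<open>Since \<open>x \<mapsto> exp (i t x)\<close> is Lipschitz, mean square convergence implies convergence of
  characteristic functions.\<close>

lemma tendsto_L2_char:
  assumes "tendsto_L2 M F f"
  shows "(\<lambda>n. char (distr M borel (F n)) t) \<longlonglongrightarrow> char (distr M borel f) t"
proof -
  have sq: "square_integrable M (F n)" "square_integrable M f" for n
    using assms by (auto simp: tendsto_L2_def)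
  note [measurable] = square_integrable_measurable[OF sq(1)] square_integrable_measurable[OF sq(2)]
  have one: "square_integrable M (\<lambda>x. 1)" by (simp add: square_integrable_def)
  have d: "square_integrable M (\<lambda>w. F n w - f w)" for n by (intro square_integrable_diff sq)
  have "(\<lambda>n. char (distr M borel (F n)) t - char (distr M borel f) t) \<longlonglongrightarrow> 0"
  proof (rule Lim_null_comparison)
    show "\<forall>\<^sub>F n in sequentially. norm (char (distr M borel (F n)) t - char (distr M borel f) t)
      \<le> \<bar>t\<bar> * sqrt (LINT w|M. (F n w - f w)\<^sup>2)"
    proof (rule always_eventually, rule allI)
      fix n
      have i: "integrable M (\<lambda>w. iexp (t * h w))" if [measurable]: "h \<in> borel_measurable M" for h
        by (rule integrable_const_bound[of _ 1]) auto
      have "char (distr M borel (F n)) t - char (distr M borel f) t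
         = (LINT w|M. iexp (t * F n w) - iexp (t * f w))"
        unfolding char_def using i[of "F n"] i[of f] by (simp add: integral_distr)
      also have "norm \<dots> \<le> (LINT w|M. norm (iexp (t * F n w) - iexp (t * f w)))"
        by (rule integral_norm_bound)
      also have "\<dots> \<le> (LINT w|M. \<bar>t\<bar> * \<bar>(F n w - f w) * 1\<bar>)"
      proof (rule integral_mono)
        show "integrable M (\<lambda>w. norm (iexp (t * F n w) - iexp (t * f w)))"
          using i[of "F n"] i[of f] by (intro integrable_norm Bochner_Integration.integrable_diff) auto
        show "integrable M (\<lambda>w. \<bar>t\<bar> * \<bar>(F n w - f w) * 1\<bar>)"
          by (intro integrable_mult_right integrable_abs square_integrable_mult d one)
        show "norm (iexp (t * F n w) - iexp (t * f w)) \<le> \<bar>t\<bar> * \<bar>(F n w - f w) * 1\<bar>" for w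
          using norm_iexp_diff_le[of "t * F n w" "t * f w"] by (simp add: right_diff_distrib [symmetric] abs_mult)
      qed
      also have "\<dots> = \<bar>t\<bar> * (LINT w|M. \<bar>(F n w - f w) * 1\<bar>)" by simp
      also have "\<dots> \<le> \<bar>t\<bar> * (sqrt (LINT w|M. (F n w - f w)\<^sup>2) * sqrt (LINT w|M. (1::real)\<^sup>2))"
        by (intro mult_left_mono L2_cauchy_schwarz d one) auto
      finally show "norm (char (distr M borel (F n)) t - char (distr M borel f) t) \<le> \<bar>t\<bar> * sqrt (LINT w|M. (F n w - f w)\<^sup>2)"
        by (simp add: prob_space)
    qed
    have "(\<lambda>n. \<bar>t\<bar> * sqrt (LINT w|M. (F n w - f w)\<^sup>2)) \<longlonglongrightarrow> \<bar>t\<bar> * sqrt 0"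
      using assms unfolding tendsto_L2_def by (intro tendsto_intros) auto
    then show "(\<lambda>n. \<bar>t\<bar> * sqrt (LINT w|M. (F n w - f w)\<^sup>2)) \<longlonglongrightarrow> 0" by simp
  qed
  then show ?thesis by (simp add: LIM_zero_iff)
qed

text \<open>The characteristic function of the limit is that of a centred normal law whose variance \<open>s\<close> is the
  limit of the variances. For \<open>s = 0\<close> the limit is almost surely zero, which counts as normal.\<close>

lemma series_limit_normal:
  assumes X: "tendsto_L2 M (\<lambda>n w. \<Sum>j<n. \<xi> j w * a j) X"
  shows "normal_variable M X" and "expectation X = 0"
proof -
  have sq: "square_integrable M X" using X by (simp add: tendsto_L2_def)
  note [measurable] = square_integrable_measurable[OF sq]
  have one: "square_integrable M (\<lambda>x. 1)" by (simp add: square_integrable_def)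
  have int: "integrable M (\<xi> k)" for k
    using square_integrable_mult[OF \<xi>_square_integrable one, of k] by simp
  have "(\<lambda>n. expectation (\<lambda>w. (\<Sum>j<n. \<xi> j w * a j) * 1)) \<longlonglongrightarrow> expectation (\<lambda>w. X w * 1)"
    by (rule tendsto_L2_inner[OF X tendsto_L2_const[OF one]])
  moreover have "expectation (\<lambda>w. (\<Sum>j<n. \<xi> j w * a j) * 1) = 0" for n
    by (simp add: int \<xi>_mean)
  ultimately show "expectation X = 0" by (simp add: LIMSEQ_const_iff)
  define s where "s = expectation (\<lambda>w. X w * X w)"
  have s0: "s \<ge> 0" by (simp add: s_def)
  have "(\<lambda>n. \<Sum>j<n. a j * a j) \<longlonglongrightarrow> s"
    using tendsto_L2_inner[OF X X] unfolding series_inner s_def .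
  then have s: "(\<lambda>n. \<Sum>j<n. (a j)\<^sup>2) \<longlonglongrightarrow> s" by (simp add: power2_eq_square)
  have charX: "char (distr M borel X) t = complex_of_real (exp (- s * t\<^sup>2 / 2))" for t
  proof (rule LIMSEQ_unique)
    show "(\<lambda>n. char (distr M borel (\<lambda>w. \<Sum>j<n. \<xi> j w * a j)) t) \<longlonglongrightarrow> char (distr M borel X) t"
      by (rule tendsto_L2_char[OF X])
    show "(\<lambda>n. char (distr M borel (\<lambda>w. \<Sum>j<n. \<xi> j w * a j)) t) \<longlonglongrightarrow> complex_of_real (exp (- s * t\<^sup>2 / 2))"
      unfolding series_char by (intro tendsto_intros s) auto
  qed
  show "normal_variable M X"
  proof (cases "s = 0")
    case True
    have "integrable M (\<lambda>w. X w * X w)" by (rule square_integrable_mult[OF sq sq])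
    then have "AE w in M. X w * X w = 0"
      using True unfolding s_def by (subst (asm) integral_nonneg_eq_0_iff_AE) auto
    then have "AE w in M. X w = 0" by eventually_elim simp
    then show ?thesis unfolding normal_variable_def by auto
  next
    case False
    then have s: "s > 0" using s0 by simp
    let ?N = "density lborel (\<lambda>x. ennreal (normal_density 0 (sqrt s) x))"
    have "prob_space ?N" using s by (intro prob_space_normal_density) auto
    then have rN: "real_distribution ?N" by (auto simp: real_distribution_def real_distribution_axioms_def)
    have "prob_space (distr M borel X)" by (rule prob_space_distr) measurable
    then have rX: "real_distribution (distr M borel X)" by (auto simp: real_distribution_def real_distribution_axioms_def)
    have "char ?N t = complex_of_real (exp (- s * t\<^sup>2 / 2))" for t
    proof -
      have "char ?N t = (LINT y|lborel. iexp (y * t) * complex_of_real (normal_density 0 (sqrt s) y))"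
        unfolding char_def by (subst integral_density) (auto simp: scaleR_conv_of_real mult_ac)
      then show ?thesis using integral_normal_density_exp[OF s, of t] by (simp flip: exp_of_real)
    qed
    then have "char (distr M borel X) = char ?N" by (intro ext) (simp add: charX)
    then have "distr M borel X = ?N" by (rule Levy_uniqueness[OF rX rN])
    then have "distributed M lborel X (normal_density 0 (sqrt s))"
      unfolding distributed_def by (auto cong: distr_cong)
    moreover have "sqrt s > 0" using s by simp
    ultimately show ?thesis
      unfolding normal_variable_def using square_integrable_measurable[OF sq] by blast
  qed
qed

text \<open>The partial sums of the expansions of \<open>f\<close> and \<open>h\<close> have the stated inner products, and they
  converge in mean square.\<close>

lemma parseval:
  assumes f: "square_integrable lborel f" and h: "square_integrable lborel h"
  shows "(\<lambda>n. \<Sum>j<n. basis_coeff \<phi> f j * basis_coeff \<phi> h j) \<longlonglongrightarrow> (LINT v|lborel. f v * h v)"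
proof -
  have on: "\<And>j. square_integrable lborel (\<phi> j)" "\<And>i j. (LINT v|lborel. \<phi> i v * \<phi> j v) = (if i = j then 1 else 0)"
    and lim: "\<And>f. square_integrable lborel f \<Longrightarrow> tendsto_L2 lborel (\<lambda>n v. \<Sum>j<n. basis_coeff \<phi> f j * \<phi> j v) f"
    using onb by (auto simp: orthonormal_basis_L2_def basis_coeff_def)
  from tendsto_L2_inner[OF lim[OF f] lim[OF h]] show ?thesis
    by (simp add: orthonormal_sum_inner[of lborel \<phi>, OF on])
qed

text \<open>The partial sums are Cauchy in mean square because the squared coefficients are summable.\<close>

lemma white_noise_integral_exists:
  assumes f: "square_integrable lborel f"
  shows "\<exists>X. white_noise_integral M \<phi> \<xi> f X"
proof -
  let ?c = "basis_coeff \<phi> f"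
  let ?S = "\<lambda>n w. \<Sum>j<n. \<xi> j w * ?c j"
  have "\<exists>X. tendsto_L2 M ?S X"
  proof (rule L2_complete)
    have "square_integrable M (\<lambda>w. \<xi> j w * ?c j)" for j
      using square_integrable_cmult[OF \<xi>_square_integrable, of "?c j" j] by (simp add: mult.commute)
    then show "square_integrable M (?S n)" for n by (intro square_integrable_sum)
    fix e :: real assume e: "e > 0"
    have "Cauchy (\<lambda>n. \<Sum>j<n. (?c j)\<^sup>2)"
      using parseval[OF f f] by (intro LIMSEQ_imp_Cauchy) (simp add: power2_eq_square)
    then obtain N where N: "\<And>m n. m \<ge> N \<Longrightarrow> n \<ge> N \<Longrightarrow> norm ((\<Sum>j<m. (?c j)\<^sup>2) - (\<Sum>j<n. (?c j)\<^sup>2)) < e"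
      using CauchyD[OF _ e] by blast
    have le: "expectation (\<lambda>w. (?S m w - ?S n w)\<^sup>2) < e" if mn: "n \<le> m" "n \<ge> N" for m n
    proof -
      have d: "(\<Sum>j<m. g j) - (\<Sum>j<n. g j) = (\<Sum>j\<in>{n..<m}. g j)" for g :: "nat \<Rightarrow> real"
        using sum.atLeastLessThan_concat[of 0 n m g] mn by (simp add: lessThan_atLeast0)
      have "expectation (\<lambda>w. (?S m w - ?S n w)\<^sup>2) = expectation (\<lambda>w. (\<Sum>j\<in>{n..<m}. ?c j * \<xi> j w) * (\<Sum>j\<in>{n..<m}. ?c j * \<xi> j w))"
        unfolding d by (simp add: power2_eq_square mult.commute)
      also have "\<dots> = (\<Sum>j\<in>{n..<m}. ?c j * ?c j)"
        by (rule orthonormal_sum_inner[OF \<xi>_square_integrable \<xi>_orthonormal]) simp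
      also have "\<dots> = (\<Sum>j<m. (?c j)\<^sup>2) - (\<Sum>j<n. (?c j)\<^sup>2)" unfolding d by (simp add: power2_eq_square)
      also have "\<dots> < e" using N[of m n] mn by auto
      finally show ?thesis .
    qed
    have "expectation (\<lambda>w. (?S m w - ?S n w)\<^sup>2) < e" if "m \<ge> N" "n \<ge> N" for m n
    proof (cases "n \<le> m")
      case True then show ?thesis using le that by simp
    next
      case False
      then have "expectation (\<lambda>w. (?S n w - ?S m w)\<^sup>2) < e" using le[of m n] that by simp
      then show ?thesis by (simp only: power2_commute)
    qed
    then show "\<exists>N. \<forall>m\<ge>N. \<forall>n\<ge>N. expectation (\<lambda>w. (?S m w - ?S n w)\<^sup>2) < e" by blast
  qed
  then show ?thesis using f by (auto simp: white_noise_integral_def basis_coeff_def)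
qed

lemma white_noise_integral_L2:
  "white_noise_integral M \<phi> \<xi> f X \<Longrightarrow> tendsto_L2 M (\<lambda>n w. \<Sum>j<n. \<xi> j w * basis_coeff \<phi> f j) X"
  by (simp add: white_noise_integral_def basis_coeff_def)

lemma white_noise_integral_mean: "white_noise_integral M \<phi> \<xi> f X \<Longrightarrow> expectation X = 0"
  by (rule series_limit_normal(2)[OF white_noise_integral_L2])

lemma white_noise_integral_isometry:
  assumes X: "white_noise_integral M \<phi> \<xi> f X" and Y: "white_noise_integral M \<phi> \<xi> h Y"
  shows "expectation (\<lambda>w. X w * Y w) = (LINT v|lborel. f v * h v)"
proof (rule LIMSEQ_unique)
  show "(\<lambda>n. \<Sum>j<n. basis_coeff \<phi> f j * basis_coeff \<phi> h j) \<longlonglongrightarrow> (LINT v|lborel. f v * h v)"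
    using X Y by (intro parseval) (auto simp: white_noise_integral_def)
  show "(\<lambda>n. \<Sum>j<n. basis_coeff \<phi> f j * basis_coeff \<phi> h j) \<longlonglongrightarrow> expectation (\<lambda>w. X w * Y w)"
    using tendsto_L2_inner[OF white_noise_integral_L2[OF X] white_noise_integral_L2[OF Y]] unfolding series_inner .
qed

lemma white_noise_integral_covariance:
  assumes X: "white_noise_integral M \<phi> \<xi> f X" and Y: "white_noise_integral M \<phi> \<xi> h Y"
  shows "covariance M X Y = (LINT v|lborel. f v * h v)"
  using white_noise_integral_isometry[OF X Y]
  by (simp add: covariance_def white_noise_integral_mean[OF X] white_noise_integral_mean[OF Y])

text \<open>A linear combination of values of the field is the mean square limit of sums over the same
  coefficients \<open>\<xi>\<close>, since the series may be combined term by term.\<close>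

lemma white_noise_integral_gaussian_field:
  fixes x :: "'b::euclidean_space \<Rightarrow> 'w \<Rightarrow> real"
  assumes x: "\<And>u. white_noise_integral M \<phi> \<xi> (f u) (x u)"
  shows "gaussian_field M x"
  unfolding gaussian_field_def normal_vector_def
proof (intro conjI allI impI)
  show "prob_space M" by (rule prob_space_axioms)
  fix k :: nat and u :: "nat \<Rightarrow> 'b"
  have L2: "tendsto_L2 M (\<lambda>n w. \<Sum>j<n. \<xi> j w * basis_coeff \<phi> (f u) j) (x u)" for u
    by (rule white_noise_integral_L2[OF x])
  then show "x (u i) \<in> borel_measurable M" for i
    by (intro square_integrable_measurable) (auto simp: tendsto_L2_def)
  fix c :: "nat \<Rightarrow> real"
  have "tendsto_L2 M (\<lambda>n w. \<Sum>i<k. c i * (\<Sum>j<n. \<xi> j w * basis_coeff \<phi> (f (u i)) j)) (\<lambda>w. \<Sum>i<k. c i * x (u i) w)"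
    by (intro tendsto_L2_sum tendsto_L2_cmult L2)
  also have "(\<lambda>n w. \<Sum>i<k. c i * (\<Sum>j<n. \<xi> j w * basis_coeff \<phi> (f (u i)) j))
    = (\<lambda>n w. \<Sum>j<n. \<xi> j w * (\<Sum>i<k. c i * basis_coeff \<phi> (f (u i)) j))"
    by (intro ext) (simp add: sum_distrib_left mult_ac sum.swap[of _ "{..<k}"])
  finally show "normal_variable M (\<lambda>w. \<Sum>i<k. c i * x (u i) w)"
    by (rule series_limit_normal(1))
qed

end

section \<open>Existence and law of the solution\<close>

text \<open>Both kernels represent Green's functions and so have the same heat averages.\<close>

lemma solution_kernel_AE_unique:
  fixes g :: "'a::euclidean_space \<Rightarrow> real"
  assumes \<beta>: "\<beta> > 0" and l: "l > 0"
    and G: "greens_function l \<beta> G" and g: "represents g G"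
    and sg: "square_integrable lborel g"
    and s0: "square_integrable lborel (potential_kernel l \<beta> :: 'a \<Rightarrow> real)"
  shows "AE v in lborel. g v = potential_kernel l \<beta> v"
proof -
  let ?g0 = "potential_kernel l \<beta> :: 'a \<Rightarrow> real"
  have "AE v in lborel. g v - ?g0 v = 0"
  proof (rule heat_kernel_complete)
    show "square_integrable lborel (\<lambda>v. g v - ?g0 v)" by (rule square_integrable_diff[OF sg s0])
    fix s :: real and a :: 'a assume s: "s > 0"
    note h = greens_function_heat_average[OF \<beta> l s G g, of a]
    note h0 = greens_function_heat_average[OF \<beta> l s potential_kernel_greens_function[OF \<beta> l], of a]
    show "(LINT v|lborel. (g v - ?g0 v) * heat_kernel s (v - a)) = 0"
      unfolding left_diff_distrib using h h0 by (subst Bochner_Integration.integral_diff) auto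
  qed
  then show ?thesis by eventually_elim simp
qed

lemma square_integrable_reflect:
  fixes g :: "'a::euclidean_space \<Rightarrow> real"
  assumes "square_integrable lborel g" shows "square_integrable lborel (\<lambda>v. g (u - v))"
  using assms integrable_lborel_reflect[of "\<lambda>v. (g v)\<^sup>2" u]
  by (auto simp: square_integrable_def)

theorem theorem1:
  fixes M :: "'w measure"
    and \<phi> :: "nat \<Rightarrow> real ^ 'd \<Rightarrow> real"
    and \<xi> :: "nat \<Rightarrow> 'w \<Rightarrow> real"
    and l \<nu> \<beta> :: real
  assumes "l > 0" and "\<nu> > 0" and "\<beta> = \<nu> + real CARD('d) / 2"
    and "white_noise M \<phi> \<xi>"
  shows "(\<exists>x. spde_solution M \<phi> \<xi> l \<beta> x) \<and>
    (\<exists>\<sigma>2 > 0. \<forall>x. spde_solution M \<phi> \<xi> l \<beta> x \<longrightarrow>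
       gaussian_field M x \<and>
       (\<forall>u. (LINT w|M. x u w) = 0) \<and>
       (\<forall>u u'. covariance M (x u) (x u') = matern_cov \<sigma>2 \<nu> l (norm (u - u'))))"
proof -
  have b: "\<beta> = \<nu> + real DIM(real ^ 'd) / 2" using assms(3) by simp
  have \<beta>: "\<beta> > 0" using assms(2) b by simp
  have "prob_space M" using assms(4) by (simp add: white_noise_def)
  then interpret gaussian_white_noise M \<phi> \<xi>
    using assms(4) by (simp add: gaussian_white_noise_def gaussian_white_noise_axioms_def)
  let ?g0 = "potential_kernel l \<beta> :: real ^ 'd \<Rightarrow> real"
  define \<sigma>2 where "\<sigma>2 = matern_variance DIM(real ^ 'd) l \<nu>"
  have \<sigma>2: "\<sigma>2 > 0" unfolding \<sigma>2_def using assms by (intro matern_variance_pos) auto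
  interpret Q: scale_law "distr (gamma_law (\<beta> / 2)) borel (\<lambda>t. 0 + 2 * l\<^sup>2 * t)"
    by (rule potential_kernel_scale_law[OF \<beta> assms(1)])
  have m0 [measurable]: "?g0 \<in> borel_measurable borel" unfolding potential_kernel_def by measurable
  note auto_cov = potential_kernel_autocovariance[OF assms(2,1) b, folded \<sigma>2_def]
  have s0: "square_integrable lborel (\<lambda>v. ?g0 (u - v))" for u
    using auto_cov[of u u] by (auto simp: square_integrable_def has_bochner_integral_iff power2_eq_square)
  have s0': "square_integrable lborel ?g0"
    using square_integrable_reflect[OF s0[of 0], of 0] by simp
  have "\<exists>x. spde_solution M \<phi> \<xi> l \<beta> x"
  proof -
    have "\<forall>u. \<exists>X. white_noise_integral M \<phi> \<xi> (\<lambda>v. ?g0 (u - v)) X"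
      using white_noise_integral_exists[OF s0] by blast
    then obtain x where "\<forall>u. white_noise_integral M \<phi> \<xi> (\<lambda>v. ?g0 (u - v)) (x u)"
      by metis
    then show ?thesis
      unfolding spde_solution_def using potential_kernel_greens_function[OF \<beta> assms(1), where 'a = "real ^ 'd"] by blast
  qed
  moreover have "gaussian_field M x \<and> (\<forall>u. (LINT w|M. x u w) = 0) \<and>
       (\<forall>u u'. covariance M (x u) (x u') = matern_cov \<sigma>2 \<nu> l (norm (u - u')))"
    if sol: "spde_solution M \<phi> \<xi> l \<beta> x" for x
  proof -
    obtain G g where G: "greens_function l \<beta> G" and g: "represents g G"
      and x: "\<And>u. white_noise_integral M \<phi> \<xi> (\<lambda>v. g (u - v)) (x u)"
      using sol unfolding spde_solution_def by blast
    have sgu: "square_integrable lborel (\<lambda>v. g (u - v))" for u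
      using x[of u] by (simp add: white_noise_integral_def)
    have sg: "square_integrable lborel g"
      using square_integrable_reflect[OF sgu[of 0], of 0] by simp
    note [measurable] = square_integrable_measurable[OF sg, simplified]
    have ae: "AE v in lborel. g v = ?g0 v"
      by (rule solution_kernel_AE_unique[OF \<beta> assms(1) G g sg s0'])
    have "covariance M (x u) (x u') = matern_cov \<sigma>2 \<nu> l (norm (u - u'))" for u u'
    proof -
      have "covariance M (x u) (x u') = (LINT v|lborel. g (u - v) * g (u' - v))"
        by (rule white_noise_integral_covariance[OF x x])
      also have "\<dots> = (LINT v|lborel. ?g0 (u - v) * ?g0 (u' - v))"
      proof (rule integral_cong_AE)
        show "AE v in lborel. g (u - v) * g (u' - v) = ?g0 (u - v) * ?g0 (u' - v)"
          using AE_lborel_reflect[OF ae, of u] AE_lborel_reflect[OF ae, of u'] by eventually_elim simp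
      qed measurable
      also have "\<dots> = matern_cov \<sigma>2 \<nu> l (norm (u - u'))"
        using auto_cov[of u u'] by (simp add: has_bochner_integral_iff)
      finally show ?thesis .
    qed
    then show ?thesis
      using white_noise_integral_gaussian_field[of "\<lambda>u v. g (u - v)" x, OF x] white_noise_integral_mean[OF x] by blast
  qed
  ultimately show ?thesis using \<sigma>2 by blast
qed

end
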